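(* Open positroid varieties form a stratification of the Grassmannian $\mathrm{Gr}(k,n)$. Precisely, for every $f\in\mathrm{Bound}(k,n)$, as sets, $$\Pi_f=\coprod_{f'\ge f}\mathring\Pi_{f'}=X_{J_1}\cap\chi(X_{J_2})\cap\cdots\cap\chi^{n-1}(X_{J_n}),$$ where $f'$ ranges over the elements of $\mathrm{Bound}(k,n)$ with $f'\ge f$ and $(J_1,\dots,J_n)\in\mathrm{Jugg}(k,n)$ corresponds to $f$.
   Context: Fix integers $0\le k\le n$. $\mathrm{Gr}(k,n)$ is the Grassmannian of $k$-planes in $\mathbb C^n$ (basis $e_1,\dots,e_n$); for $S\subseteq[n]$, $\mathrm{Project}_S:\mathbb C^n\to\mathbb C^S$ is the coordinate projection. $\chi$ is the permutation $i\mapsto i+1$ ($i<n$), $n\mapsto1$, acting on $\mathbb C^n$ by $e_i\mapsto e_{\chi(i)}$ and hence on $\mathrm{Gr}(k,n)$. For a $k$-element subset $I\subseteq[n]$, $X_I=\{V\in\mathrm{Gr}(k,n):\dim\mathrm{Project}_{[j]}(V)\le\#(I\cap[j])\ \forall j\}$ is the Schubert variety. An affine permutation is a bijection $f:\mathbb Z\to\mathbb Z$ with $f(i+n)=f(i)+n$; $\tilde S_n^k$ is the set of those with $\frac1n\sum_{i=1}^n(f(i)-i)=k$. $\tilde S_n^0$ is the affine symmetric group (Coxeter group of type $\tilde A_{n-1}$) with Bruhat order, and $\tilde S_n^k$ is ordered by transport along $f\mapsto f\circ(i\mapsto i-k)$. $\mathrm{Bound}(k,n)=\{f\in\tilde S_n^k:i\le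 f(i)\le i+n\ \forall i\}$ with the restricted order $\le$. $\mathrm{Jugg}(k,n)$ is the set of sequences $(J_1,\dots,J_n)$ of $k$-element subsets of $[n]$ with $J_{i+1}\supseteq\{j-1:j\in J_i\setminus\{1\}\}$ for all $i$ (indices modulo $n$). The sequence corresponding to $f\in\mathrm{Bound}(k,n)$ is given by $J_r=\{f(i)-(r-1):i\le r-1\}\cap[n]$; this is a bijection $\mathrm{Bound}(k,n)\to\mathrm{Jugg}(k,n)$. For $V\in\mathrm{Gr}(k,n)$, $i,j\in\mathbb Z$, set $r_{ij}(V)=j-i+1$ if $i>j$ and $r_{ij}(V)=\dim\mathrm{Project}_{\{i,\dots,j\}}(V)$ if $i\le j$ ($\{i,\dots,j\}$ read modulo $n$). For $f\in\mathrm{Bound}(k,n)$, $\mathring\Pi_f$ is the set of $V$ such that for all $i,j$: $f(i)=j$ iff $r_{ij}(V)=r_{(i+1)j}(V)=r_{i(j-1)}(V)>r_{(i+1)(j-1)}(V)$; $\Pi_f=\overline{\mathring\Pi_f}$. *)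

theory Defs
  imports Complex_Main "HOL-Library.Function_Algebras" "HOL-Library.Disjoint_Sets"
    "Jordan_Normal_Form.Determinant"
begin

section \<open>The Grassmannian\<close>

text \<open>
  Vectors are functions \<open>int \<Rightarrow> complex\<close>; the space \<open>\<complex>\<^sup>n\<close> consists of those vanishing outside
  \<open>[n] = {1..n}\<close>, and \<open>\<complex>\<^sup>S\<close>, for \<open>S \<subseteq> [n]\<close>, of those vanishing outside \<open>S\<close>. Subspaces, spans and
  dimensions are those of the library locale for vector spaces, over \<open>\<complex>\<close>.
\<close>

definition cscale :: "complex \<Rightarrow> (int \<Rightarrow> complex) \<Rightarrow> int \<Rightarrow> complex" where
  "cscale c v = (\<lambda>i. c * v i)"

global_interpretation cvec: vector_space cscale
  by unfold_locales (auto simp: cscale_def fun_eq_iff algebra_simps)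

definition Cspace :: "nat \<Rightarrow> (int \<Rightarrow> complex) set" where
  "Cspace n = {v. \<forall>i. i \<notin> {1..int n} \<longrightarrow> v i = 0}"

definition Gr :: "nat \<Rightarrow> nat \<Rightarrow> (int \<Rightarrow> complex) set set" where
  "Gr k n = {V. cvec.subspace V \<and> V \<subseteq> Cspace n \<and> cvec.dim V = k}"

definition project :: "int set \<Rightarrow> (int \<Rightarrow> complex) \<Rightarrow> int \<Rightarrow> complex" where
  "project S v = (\<lambda>i. if i \<in> S then v i else 0)"

definition chi :: "nat \<Rightarrow> int \<Rightarrow> int" where
  "chi n i = (if 1 \<le> i \<and> i < int n then i + 1 else if i = int n then 1 else i)"

text \<open>The linear map \<open>e\<^sub>i \<mapsto> e\<^bsub>\<chi>(i)\<^esub>\<close> sends \<open>v\<close> to the vector whose \<open>\<chi>(i)\<close>-th coordinate is \<open>v i\<close>.\<close>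

definition chi_Gr :: "nat \<Rightarrow> (int \<Rightarrow> complex) set \<Rightarrow> (int \<Rightarrow> complex) set" where
  "chi_Gr n V = (\<lambda>v. v \<circ> inv_into UNIV (chi n)) ` V"

definition schubert :: "nat \<Rightarrow> nat \<Rightarrow> int set \<Rightarrow> (int \<Rightarrow> complex) set set" where
  "schubert k n I =
     {V \<in> Gr k n. \<forall>j\<in>{1..int n}. cvec.dim (project {1..j} ` V) \<le> card (I \<inter> {1..j})}"


section \<open>The Zariski topology on the Grassmannian\<close>

text \<open>
  The functions given by homogeneous polynomials of a given degree in variables indexed by \<open>I\<close>.
  As \<open>\<complex>\<close> is infinite, nothing is lost by working with functions instead of formal polynomials.
\<close>

inductive homog_poly :: "'v set \<Rightarrow> nat \<Rightarrow> (('v \<Rightarrow> complex) \<Rightarrow> complex) \<Rightarrow> bool" for I where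
  const: "homog_poly I 0 (\<lambda>x. c)"
| var: "i \<in> I \<Longrightarrow> homog_poly I 1 (\<lambda>x. x i)"
| add: "homog_poly I d p \<Longrightarrow> homog_poly I d q \<Longrightarrow> homog_poly I d (\<lambda>x. p x + q x)"
| mult: "homog_poly I d p \<Longrightarrow> homog_poly I e q \<Longrightarrow> homog_poly I (d + e) (\<lambda>x. p x * q x)"

definition plucker_index :: "nat \<Rightarrow> nat \<Rightarrow> int set set" where
  "plucker_index k n = {I. I \<subseteq> {1..int n} \<and> card I = k}"

text \<open>The maximal minor, in the columns \<open>I\<close>, of the matrix with rows \<open>B 0, \<dots>, B (k - 1)\<close>.\<close>

definition plucker :: "nat \<Rightarrow> (nat \<Rightarrow> int \<Rightarrow> complex) \<Rightarrow> int set \<Rightarrow> complex" where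
  "plucker k B I = det (mat k k (\<lambda>(a, b). B a (sorted_list_of_set I ! b)))"

definition is_basis :: "nat \<Rightarrow> (nat \<Rightarrow> int \<Rightarrow> complex) \<Rightarrow> (int \<Rightarrow> complex) set \<Rightarrow> bool" where
  "is_basis k B V \<longleftrightarrow>
     inj_on B {..<k} \<and> cvec.independent (B ` {..<k}) \<and> cvec.span (B ` {..<k}) = V"

text \<open>
  Closed sets are the zero loci of families of homogeneous polynomials in the Pluecker
  coordinates. Changing the basis multiplies all these coordinates by a common nonzero scalar.
\<close>

definition zariski_closed :: "nat \<Rightarrow> nat \<Rightarrow> (int \<Rightarrow> complex) set set \<Rightarrow> bool" where
  "zariski_closed k n Z \<longleftrightarrow>
     (\<exists>P. (\<forall>p\<in>P. \<exists>d. homog_poly (plucker_index k n) d p) \<and>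
          Z = {V \<in> Gr k n. \<forall>p\<in>P. \<forall>B. is_basis k B V \<longrightarrow> p (plucker k B) = 0})"

definition zariski_closure :: "nat \<Rightarrow> nat \<Rightarrow> (int \<Rightarrow> complex) set set \<Rightarrow> (int \<Rightarrow> complex) set set" where
  "zariski_closure k n A = \<Inter>{Z. zariski_closed k n Z \<and> A \<subseteq> Z}"


section \<open>Bruhat order\<close>

text \<open>
  Here \<open>W\<close> is a group of bijections under composition and \<open>S\<close> its set of Coxeter generators.
\<close>

definition word_length :: "('a \<Rightarrow> 'a) set \<Rightarrow> ('a \<Rightarrow> 'a) \<Rightarrow> nat" where
  "word_length S w = (LEAST m. \<exists>ws. length ws = m \<and> set ws \<subseteq> S \<and> foldr (\<circ>) ws id = w)"

definition reflections :: "('a \<Rightarrow> 'a) set \<Rightarrow> ('a \<Rightarrow> 'a) set \<Rightarrow> ('a \<Rightarrow> 'a) set" where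
  "reflections W S = {w \<circ> s \<circ> inv_into UNIV w | w s. w \<in> W \<and> s \<in> S}"

definition bruhat_le :: "('a \<Rightarrow> 'a) set \<Rightarrow> ('a \<Rightarrow> 'a) set \<Rightarrow> ('a \<Rightarrow> 'a) \<Rightarrow> ('a \<Rightarrow> 'a) \<Rightarrow> bool" where
  "bruhat_le W S u v \<longleftrightarrow>
     (u, v) \<in> {(x, x \<circ> t) | x t. x \<in> W \<and> t \<in> reflections W S \<and>
                              word_length S x < word_length S (x \<circ> t)}\<^sup>*"


section \<open>Affine and bounded affine permutations\<close>

definition affine_perms :: "nat \<Rightarrow> int \<Rightarrow> (int \<Rightarrow> int) set" where
  "affine_perms n k =
     {f. bij f \<and> (\<forall>i. f (i + int n) = f i + int n) \<and>
         (1 / rat_of_nat n) * rat_of_int (\<Sum>i = 1..int n. f i - i) = rat_of_int k}"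

text \<open>Swaps \<open>i + m n\<close> and \<open>i + 1 + m n\<close> for all \<open>m\<close>; this is meaningful only for \<open>n \<ge> 2\<close>.\<close>

definition simple_reflection :: "nat \<Rightarrow> int \<Rightarrow> int \<Rightarrow> int" where
  "simple_reflection n i = (\<lambda>x. if x mod int n = i mod int n then x + 1
                               else if x mod int n = (i + 1) mod int n then x - 1
                               else x)"

text \<open>The group for \<open>n = 1\<close> is trivial and has no generators.\<close>

definition affine_generators :: "nat \<Rightarrow> (int \<Rightarrow> int) set" where
  "affine_generators n = (if n \<ge> 2 then range (simple_reflection n) else {})"

definition affine_le :: "nat \<Rightarrow> int \<Rightarrow> (int \<Rightarrow> int) \<Rightarrow> (int \<Rightarrow> int) \<Rightarrow> bool" where
  "affine_le n k f g \<longleftrightarrow>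
     bruhat_le (affine_perms n 0) (affine_generators n) (f \<circ> (\<lambda>i. i - k)) (g \<circ> (\<lambda>i. i - k))"

definition Bound :: "nat \<Rightarrow> nat \<Rightarrow> (int \<Rightarrow> int) set" where
  "Bound k n = {f \<in> affine_perms n (int k). \<forall>i. i \<le> f i \<and> f i \<le> i + int n}"


section \<open>Juggling sequences\<close>

text \<open>Only the values at \<open>1, \<dots>, n\<close> of a sequence are meaningful.\<close>

definition Jugg :: "nat \<Rightarrow> nat \<Rightarrow> (nat \<Rightarrow> int set) set" where
  "Jugg k n =
     {J. \<forall>r\<in>{1..n}. J r \<subseteq> {1..int n} \<and> card (J r) = k \<and>
                   (\<lambda>j. j - 1) ` (J r - {1}) \<subseteq> J (if r = n then 1 else r + 1)}"

definition jugg_seq :: "nat \<Rightarrow> (int \<Rightarrow> int) \<Rightarrow> nat \<Rightarrow> int set" where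
  "jugg_seq n f r = {f i - (int r - 1) | i. i \<le> int r - 1} \<inter> {1..int n}"


section \<open>Positroid varieties\<close>

definition cyclic_interval :: "nat \<Rightarrow> int \<Rightarrow> int \<Rightarrow> int set" where
  "cyclic_interval n i j = {m \<in> {1..int n}. \<exists>l\<in>{i..j}. l mod int n = m mod int n}"

definition interval_rank :: "nat \<Rightarrow> (int \<Rightarrow> complex) set \<Rightarrow> int \<Rightarrow> int \<Rightarrow> int" where
  "interval_rank n V i j =
     (if i > j then j - i + 1 else int (cvec.dim (project (cyclic_interval n i j) ` V)))"

definition open_positroid :: "nat \<Rightarrow> nat \<Rightarrow> (int \<Rightarrow> int) \<Rightarrow> (int \<Rightarrow> complex) set set" where
  "open_positroid k n f =
     {V \<in> Gr k n. \<forall>i j. f i = j \<longleftrightarrow>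
        interval_rank n V i j = interval_rank n V (i + 1) j \<and>
        interval_rank n V (i + 1) j = interval_rank n V i (j - 1) \<and>
        interval_rank n V i (j - 1) > interval_rank n V (i + 1) (j - 1)}"

definition positroid :: "nat \<Rightarrow> nat \<Rightarrow> (int \<Rightarrow> int) \<Rightarrow> (int \<Rightarrow> complex) set set" where
  "positroid k n f = zariski_closure k n (open_positroid k n f)"

end

theory Submission
  imports Defs
begin

text \<open>
  Both descriptions of \<open>\<Pi>\<^sub>f\<close> are compared with the rank variety \<open>{V. r\<^sub>i\<^sub>j(V) \<le> r\<^sub>i\<^sub>j(f)}\<close>, where
  \<open>r\<^sub>i\<^sub>j(f) = j - i + 1 - #{x \<ge> i. f(x) \<le> j}\<close> is the value of \<open>r\<^sub>i\<^sub>j\<close> on the open stratum of \<open>f\<close>. The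
  Schubert conditions are the inequalities with \<open>i\<close> in one period, so the rank variety is the
  intersection of the shifted Schubert varieties; it is closed, since a bound on the rank of a
  projection is the vanishing of certain Pluecker coordinates. It is the union of the strata with
  \<open>f' \<ge> f\<close>, because \<open>f \<le> f'\<close> in Bruhat order iff \<open>r\<^sub>i\<^sub>j(f') \<le> r\<^sub>i\<^sub>j(f)\<close> for all \<open>i, j\<close>, and in that case \<open>f'\<close>
  descends to \<open>f\<close> through reflections \<open>f' \<mapsto> f' \<circ> t\<^sub>a\<^sub>b\<close> with \<open>a < b\<close> and \<open>f'(a) > f'(b)\<close>.

  It remains to degenerate the stratum of \<open>f'' = f' \<circ> t\<^sub>a\<^sub>b\<close> to any \<open>V\<close> in the stratum of \<open>f'\<close>. Cut the circle
  so that the linear order begins at \<open>f'(b)\<close>. Together with the coordinate flag, \<open>V\<close> determines a complete flag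
  of \<open>\<complex>\<^sup>n\<close>, and the rank conditions record its position relative to the opposite flag.
  A rank-one perturbation \<open>1 + t P q\<^sup>T\<close> moves this relative position to the one prescribed by \<open>f''\<close>;
  factor it as \<open>L U\<close>. The lower triangular factor fixes the opposite flag and the upper triangular one
  the coordinate flag, so \<open>U V\<close> lies in the stratum of \<open>f''\<close>, and \<open>U V \<rightarrow> V\<close> as \<open>t \<rightarrow> 0\<close>.
\<close>


section \<open>Rank functions of bounded affine permutations\<close>

definition perm_rank :: "(int \<Rightarrow> int) \<Rightarrow> int \<Rightarrow> int \<Rightarrow> int" where
  "perm_rank f i j = j - i + 1 - int (card {x. i \<le> x \<and> f x \<le> j})"

lemma sum_periodic_shift:
  fixes g :: "int \<Rightarrow> 'a::ab_group_add"
  assumes "\<And>i. g (i + int n) = g i"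
  shows "(\<Sum>i = 1..int n. g (i + 1)) = (\<Sum>i = 1..int n. g i)"
proof (cases "n = 0")
  case False
  have "(\<Sum>i = 1..int n. g (i + 1)) = (\<Sum>i = 2..int n + 1. g i)"
    by (rule sum.reindex_bij_witness[of _ "\<lambda>i. i - 1" "\<lambda>i. i + 1"]) auto
  also have "{2..int n + 1} = insert (int n + 1) {2..int n}"
    using False by auto
  also have "sum g \<dots> = g (int n + 1) + sum g {2..int n}"
    by simp
  also have "g (int n + 1) = g 1"
    using assms[of 1] by (simp add: add.commute)
  also have "g 1 + sum g {2..int n} = sum g (insert 1 {2..int n})"
    by simp
  also have "insert 1 {2..int n} = {1..int n}"
    using False by auto
  finally show ?thesis .
qed simp

text \<open>By periodicity the subtracted terms, summed over one period, may be shifted from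
  \<open>i + 1\<close> to \<open>i\<close>; the double sum then telescopes in
  \<open>l\<close>.\<close>

lemma sum_rank_differences:
  fixes r :: "int \<Rightarrow> int \<Rightarrow> int"
  assumes per: "\<And>i j. r (i + int n) (j + int n) = r i j"
    and empty: "\<And>i. r (i + 1) i = 0"
  shows "(\<Sum>i = 1..int n. \<Sum>l<m. r i (i + int l) - r (i + 1) (i + int l))
    = (\<Sum>i = 1..int n. r i (i + int m - 1))"
proof (induction m)
  case 0
  have "r i (i - 1) = 0" for i using empty[of "i - 1"] by simp
  then show ?case by simp
next
  case (Suc m)
  have "(\<Sum>i = 1..int n. r (i + 1) (i + int m)) = (\<Sum>i = 1..int n. r i (i + int m - 1))"
    using sum_periodic_shift[of "\<lambda>i. r i (i + int m - 1)" n] per[of _ "_ + int m - 1"]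
    by (simp add: algebra_simps)
  then show ?case
    using Suc by (simp add: sum.distrib sum_subtractf algebra_simps)
qed

lemma sum_indicator_less:
  assumes "i \<le> (m::int)" "m \<le> i + int n"
  shows "(\<Sum>l<n. if i + int l < m then 1 else (0::int)) = m - i"
proof -
  have "(\<Sum>l<n. if i + int l < m then 1 else (0::int)) = int (card {l. l < n \<and> i + int l < m})"
    by (simp add: sum.If_cases lessThan_def Int_def)
  also have "{l. l < n \<and> i + int l < m} = {..<nat (m - i)}"
    using assms by auto
  finally show ?thesis using assms by simp
qed

section \<open>A single bounded affine permutation and its rank function\<close>

locale bounded_perm =
  fixes n :: nat and f :: "int \<Rightarrow> int"
  assumes n_pos: "0 < n" and bij: "bij f" and periodic: "f (i + int n) = f i + int n"
    and lower: "i \<le> f i" and upper: "f i \<le> i + int n"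
begin

lemma finite_dots: "finite {x. i \<le> x \<and> f x \<le> j}"
proof (rule finite_subset)
  show "{x. i \<le> x \<and> f x \<le> j} \<subseteq> {i..j}"
    using order_trans[OF lower] by auto
qed simp

lemma f_inv [simp]: "f (inv_into UNIV f y) = y" and inv_f [simp]: "inv_into UNIV f (f x) = x"
  using bij by (simp_all add: bij_is_surj surj_f_inv_f bij_is_inj)

lemma eq_inv_iff: "f x = y \<longleftrightarrow> x = inv_into UNIV f y"
  using f_inv inv_f by metis

lemma inv_lower: "y - int n \<le> inv_into UNIV f y"
  using upper[of "inv_into UNIV f y"] by simp

lemma inv_periodic: "inv_into UNIV f (y + int n) = inv_into UNIV f y + int n"
  by (metis f_inv inv_f periodic)

lemma perm_rank_empty: "j < i \<Longrightarrow> perm_rank f i j = j - i + 1"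
proof -
  assume "j < i"
  then have "{x. i \<le> x \<and> f x \<le> j} = {}"
    using lower by (fastforce dest: order_trans)
  then show ?thesis unfolding perm_rank_def by (simp only: card.empty)
qed

text \<open>With the points \<open>(x, f x)\<close> viewed as dots, starting one row earlier
  lengthens the interval by one and adds one counted dot exactly when
  \<open>f i \<le> j\<close>.\<close>

lemma perm_rank_left: "perm_rank f i j = perm_rank f (i + 1) j + (if j < f i then 1 else 0)"
proof (cases "j < f i")
  case True
  then have "{x. i \<le> x \<and> f x \<le> j} = {x. i + 1 \<le> x \<and> f x \<le> j}"
    by (auto simp: order.order_iff_strict)
  with True show ?thesis by (simp add: perm_rank_def)
next
  case False
  then have "{x. i \<le> x \<and> f x \<le> j} = insert i {x. i + 1 \<le> x \<and> f x \<le> j}"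
    by auto
  with False show ?thesis
    using finite_dots[of "i + 1" j] by (simp add: perm_rank_def)
qed

lemma perm_rank_right: "perm_rank f i j = perm_rank f i (j - 1) + (if inv_into UNIV f j < i then 1 else 0)"
proof (cases "inv_into UNIV f j < i")
  case True
  have "x \<noteq> inv_into UNIV f j" if "i \<le> x" for x using True that by auto
  then have "f x \<noteq> j" if "i \<le> x" for x using that eq_inv_iff by blast
  then have "{x. i \<le> x \<and> f x \<le> j} = {x. i \<le> x \<and> f x \<le> j - 1}"
    by (force simp: order.order_iff_strict)
  with True show ?thesis by (simp add: perm_rank_def)
next
  case False
  then have "{x. i \<le> x \<and> f x \<le> j} = insert (inv_into UNIV f j) {x. i \<le> x \<and> f x \<le> j - 1}"
    using eq_inv_iff[of _ j] by (auto simp: zle_diff1_eq order.order_iff_strict[of _ j])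
  with False show ?thesis
    using finite_dots[of i "j - 1"] by (simp add: perm_rank_def)
qed

lemma perm_rank_periodic: "perm_rank f (i + int n) (j + int n) = perm_rank f i j"
proof -
  have "{x. i + int n \<le> x \<and> f x \<le> j + int n} = (\<lambda>x. x + int n) ` {x. i \<le> x \<and> f x \<le> j}"
  proof -
    have "x \<in> (\<lambda>x. x + int n) ` {x. i \<le> x \<and> f x \<le> j}"
      if "i + int n \<le> x" "f x \<le> j + int n" for x
      using that periodic[of "x - int n"] by (intro image_eqI[of _ _ "x - int n"]) auto
    then show ?thesis using periodic by auto
  qed
  then have "card {x. i + int n \<le> x \<and> f x \<le> j + int n} = card {x. i \<le> x \<and> f x \<le> j}"
    by (simp add: card_image inj_on_def)
  then show ?thesis by (simp add: perm_rank_def)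
qed

text \<open>The dot in column \<open>j + 1\<close> lies in row at least \<open>j + 1 - n\<close>, so
  columns past a full window add nothing; comparing adjacent windows then shows that the value is
  constant.\<close>

lemma perm_rank_long: "i + int n - 1 \<le> j \<Longrightarrow> perm_rank f i j = perm_rank f 1 (int n)"
proof -
  have extend: "perm_rank f i j = perm_rank f i (i + int n - 1)" if "i + int n - 1 \<le> j" for i j
    using that
  proof (induction rule: int_ge_induct)
    case (step j)
    have "\<not> inv_into UNIV f (j + 1) < i" using inv_lower[of "j + 1"] step by linarith
    then show ?case using step perm_rank_right[of i "j + 1"] by simp
  qed simp
  have step: "perm_rank f (i + 1) (i + int n) = perm_rank f i (i + int n - 1)" for i
    using perm_rank_left[of i "i + int n"] extend[of i "i + int n"] upper[of i] by simp
  have "perm_rank f i (i + int n - 1) = perm_rank f 1 (int n)"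
  proof (induction i rule: int_induct[of _ 1])
    case (step1 i)
    then show ?case using step[of i] by (simp add: algebra_simps)
  next
    case (step2 i)
    then show ?case using step[of "i - 1"] by (simp add: algebra_simps)
  qed simp
  then show "i + int n - 1 \<le> j \<Longrightarrow> perm_rank f i j = perm_rank f 1 (int n)"
    by (metis extend)
qed

text \<open>\<open>f i - i\<close> counts the \<open>l < n\<close> with \<open>i + l < f i\<close>,
  and each of them is a row difference of the rank; \<open>sum_rank_differences\<close> collapses
  the sum to full windows.\<close>

lemma sum_displacement: "(\<Sum>i = 1..int n. f i - i) = int n * perm_rank f 1 (int n)"
proof -
  have "(\<Sum>i = 1..int n. f i - i)
    = (\<Sum>i = 1..int n. \<Sum>l<n. perm_rank f i (i + int l) - perm_rank f (i + 1) (i + int l))"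
  proof (rule sum.cong)
    fix i
    have "perm_rank f i (i + int l) - perm_rank f (i + 1) (i + int l)
      = (if i + int l < f i then 1 else 0)" for l
      using perm_rank_left[of i "i + int l"] by simp
    then show "f i - i = (\<Sum>l<n. perm_rank f i (i + int l) - perm_rank f (i + 1) (i + int l))"
      using sum_indicator_less[of i "f i" n] lower upper by simp
  qed simp
  also have "\<dots> = (\<Sum>i = 1..int n. perm_rank f i (i + int n - 1))"
    by (rule sum_rank_differences) (simp_all add: perm_rank_periodic perm_rank_empty)
  also have "\<dots> = int n * perm_rank f 1 (int n)"
    by (simp add: perm_rank_long[of _ "_ + int n - 1"])
  finally show ?thesis .
qed

text \<open>Every value in \<open>{i..j}\<close> is attained either at some
  \<open>x \<ge> i\<close>, which is what \<open>perm_rank\<close> subtracts, or at some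
  \<open>x < i\<close>. This yields nonnegativity and the link to juggling sequences.\<close>

lemma perm_rank_interval:
  assumes "i \<le> j + 1"
  shows "perm_rank f i j = int (card {x. x < i \<and> i \<le> f x \<and> f x \<le> j})"
proof -
  let ?A = "{x. i \<le> x \<and> f x \<le> j}" and ?B = "{x. x < i \<and> i \<le> f x \<and> f x \<le> j}"
  have "f ` ?A \<union> f ` ?B = {i..j}"
  proof (intro equalityI subsetI)
    fix y assume "y \<in> f ` ?A \<union> f ` ?B"
    then obtain x where x: "y = f x" "x \<in> ?A \<or> x \<in> ?B" by blast
    with lower[of x] show "y \<in> {i..j}" unfolding x(1) by (elim disjE) simp_all
  next
    fix y assume "y \<in> {i..j}"
    moreover have "y = f (inv_into UNIV f y)" by simp
    moreover from calculation have "inv_into UNIV f y \<in> ?A \<or> inv_into UNIV f y \<in> ?B" by (simp add: linorder_not_less[symmetric])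
    ultimately show "y \<in> f ` ?A \<union> f ` ?B" by blast
  qed
  moreover have inj: "inj_on f X" for X using bij bij_is_inj inj_on_subset by blast
  moreover have "?A \<inter> ?B = {}" by auto
  then have "f ` ?A \<inter> f ` ?B = {}" by (simp add: image_Int[OF bij_is_inj[OF bij], symmetric])
  moreover have "finite (f ` ?B)" by (rule finite_subset[of _ "{i..j}"]) auto
  ultimately have "card ?A + card ?B = card {i..j}"
    using finite_dots[of i j] card_Un_disjoint[of "f ` ?A" "f ` ?B"] card_image[OF inj]
    by (metis finite_imageI)
  then show ?thesis using assms by (simp add: perm_rank_def)
qed

text \<open>A dot is detected by the mixed second difference of the rank. This is the condition of
  \<open>open_positroid\<close> with \<open>perm_rank\<close> in place of
  \<open>interval_rank\<close>.\<close>

lemma eq_iff_perm_rank: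
  "f i = j \<longleftrightarrow> perm_rank f i j = perm_rank f (i + 1) j \<and>
     perm_rank f (i + 1) j = perm_rank f i (j - 1) \<and>
     perm_rank f i (j - 1) > perm_rank f (i + 1) (j - 1)"
proof -
  have "i = inv_into UNIV f j \<longleftrightarrow> f i = j" using eq_inv_iff by blast
  then show ?thesis
    using perm_rank_left[of i j] perm_rank_left[of i "j - 1"]
      perm_rank_right[of i j] perm_rank_right[of "i + 1" j]
    by (auto split: if_splits)
qed

end

section \<open>Bounded affine permutations and abstract rank functions\<close>

lemma Bound_bounded_perm:
  assumes "f \<in> Bound k n" "0 < n" shows "bounded_perm n f"
  using assms by unfold_locales (auto simp: Bound_def affine_perms_def)

text \<open>The average displacement equals the rank of a full window, so \<open>k\<close> is read
  off one value of \<open>perm_rank\<close>.\<close>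

lemma Bound_iff:
  assumes "0 < n"
  shows "f \<in> Bound k n \<longleftrightarrow> bounded_perm n f \<and> perm_rank f 1 (int n) = int k"
proof -
  have "f \<in> Bound k n \<longleftrightarrow> (1 / rat_of_nat n) * rat_of_int (\<Sum>i = 1..int n. f i - i) = rat_of_int (int k)"
    if "bounded_perm n f"
    using that by (auto simp: Bound_def affine_perms_def bounded_perm_def)
  moreover have "(1 / rat_of_nat n) * rat_of_int (\<Sum>i = 1..int n. f i - i)
      = rat_of_int (perm_rank f 1 (int n))" if "bounded_perm n f"
    unfolding bounded_perm.sum_displacement[OF that] using assms by simp
  ultimately show ?thesis
    using Bound_bounded_perm assms of_int_eq_iff by metis
qed

lemma Bound_perm_rank_long:
  "f \<in> Bound k n \<Longrightarrow> 0 < n \<Longrightarrow> i + int n - 1 \<le> j \<Longrightarrow> perm_rank f i j = int k"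
  using bounded_perm.perm_rank_long Bound_iff by metis

lemma Bound_eq_if_perm_rank_eq:
  assumes "f \<in> Bound k n" "g \<in> Bound k n" "0 < n" "\<And>i j. perm_rank f i j = perm_rank g i j"
  shows "f = g"
proof
  fix i
  show "f i = g i"
    using bounded_perm.eq_iff_perm_rank[OF Bound_bounded_perm[OF assms(1,3)], of i "g i"]
      bounded_perm.eq_iff_perm_rank[OF Bound_bounded_perm[OF assms(2,3)], of i "g i"] assms(4) by simp
qed

text \<open>Reconstruction of a permutation from its rank function: submodularity makes the row
  difference \<open>d i\<close> drop once from 1 to 0, and \<open>f i\<close> is the column where
  this happens.\<close>

lemma ex_Bound_perm_rank:
  fixes r :: "int \<Rightarrow> int \<Rightarrow> int"
  assumes n: "0 < n"
    and empty: "\<And>i j. j < i \<Longrightarrow> r i j = j - i + 1"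
    and long: "\<And>i j. i + int n - 1 \<le> j \<Longrightarrow> r i j = int k"
    and per: "\<And>i j. r (i + int n) (j + int n) = r i j"
    and left: "\<And>i j. r i j = r (i + 1) j \<or> r i j = r (i + 1) j + 1"
    and right: "\<And>i j. r i j = r i (j - 1) \<or> r i j = r i (j - 1) + 1"
    and submodular: "\<And>i j. r i j + r (i + 1) (j - 1) \<le> r (i + 1) j + r i (j - 1)"
  shows "\<exists>f\<in>Bound k n. \<forall>i j. perm_rank f i j = r i j"
proof -
  define d where "d i j = r i j - r (i + 1) j" for i j
  have d_antimono: "d i j' \<le> d i j" if "j \<le> j'" for i j j'
    using that
  proof (induction rule: int_ge_induct)
    case (step j')
    then show ?case using submodular[of i "j' + 1"] by (simp add: d_def)
  qed simp
  have d01: "d i j = 0 \<or> d i j = 1" for i j using left[of i j] by (auto simp: d_def)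
  \<comment> \<open>The \<open>LEAST\<close> is attained because full windows force
    \<open>d i (i + n) = 0\<close>.\<close>
  define f where "f i = i + int (LEAST m. d i (i + int m) = 0)" for i
  have dn: "d i (i + int n) = 0" for i using long[of i] long[of "i + 1"] by (simp add: d_def)
  have d_before: "d i j = 1" if "j < i" for i j using that empty by (simp add: d_def)
  have lower: "i \<le> f i" for i by (simp add: f_def)
  have upper: "f i \<le> i + int n" for i using dn[of i] by (simp add: f_def Least_le)
  have d_f: "d i (f i) = 0" for i unfolding f_def by (rule LeastI[of _ n]) (rule dn)
  have d_less: "d i j = 1" if "j < f i" for i j
  proof (cases "j < i")
    case False
    then have "nat (j - i) < (LEAST m. d i (i + int m) = 0)" using that by (simp add: f_def)
    from not_less_Least[OF this] False d01[of i j] show ?thesis by simp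
  qed (rule d_before)
  have d_iff: "d i j = (if j < f i then 1 else 0)" for i j
    using d_less d_f d_antimono[of "f i" j i] d01[of i j] by (auto simp: not_less)
  have f_eq: "f i = j \<longleftrightarrow> d i j = 0 \<and> d i (j - 1) = 1" for i j
    by (auto simp: d_iff)
  define e where "e i j = r i j - r i (j - 1)" for i j
  have e01: "e i j = 0 \<or> e i j = 1" for i j using right[of i j] by (auto simp: e_def)
  \<comment> \<open>The mixed second difference is read along columns as well: a dot in column
    \<open>j\<close> is a row where \<open>e\<close> jumps from 0 to 1, and monotonicity of
    \<open>e\<close> makes it unique.\<close>
  have de: "d i j - d i (j - 1) = e i j - e (i + 1) j" for i j by (simp add: d_def e_def)
  have f_eq': "f i = j \<longleftrightarrow> e i j = 0 \<and> e (i + 1) j = 1" for i j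
    unfolding f_eq using de[of i j] e01[of i j] e01[of "i + 1" j] d01[of i j] d01[of i "j - 1"] by auto
  have e_mono: "e i j \<le> e i' j" if "i \<le> i'" for i i' j
    using that
  proof (induction rule: int_ge_induct)
    case (step i')
    then show ?case using submodular[of i' j] by (simp add: e_def)
  qed simp
  have "inj f"
  proof (rule injI)
    fix x y assume "f x = f y"
    then have "e x (f x) = 0" "e (x + 1) (f x) = 1" "e y (f x) = 0" "e (y + 1) (f x) = 1"
      using f_eq' by metis+
    then show "x = y" using e_mono[of "x + 1" y "f x"] e_mono[of "y + 1" x "f x"] by force
  qed
  have "\<exists>i. f i = j" for j
  proof (rule ccontr)
    assume no: "\<nexists>i. f i = j"
    \<comment> \<open>Without a dot in column \<open>j\<close>, \<open>e\<close> would keep its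
      value 0 from row \<open>j - n\<close>, where both intervals contain a full window, to row
      \<open>j + 1\<close>; there the convention for empty intervals gives 1.\<close>
    have "e (j - int n + int m) j = 0" for m
    proof (induction m)
      case 0
      then show ?case using long[of "j - int n" j] long[of "j - int n" "j - 1"] by (simp add: e_def)
    next
      case (Suc m)
      then show ?case using no f_eq'[of "j - int n + int m" j] e01[of "j - int n + int m + 1" j]
        by (simp add: algebra_simps)
    qed
    from this[of "n + 1"] show False using empty[of j "j + 1"] empty[of "j - 1" "j + 1"]
      by (simp add: e_def)
  qed
  then have "surj f" by (metis surjI)
  have "d (i + int n) (j + int n) = d i j" for i j
    using per[of i j] per[of "i + 1" j] by (simp add: d_def algebra_simps)
  then have d_per: "d (i + int n) (i + int n + int m) = d i (i + int m)" for i m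
    by (metis add.assoc add.commute)
  have "f (i + int n) = f i + int n" for i by (simp add: f_def d_per)
  then interpret bounded_perm n f
    using n \<open>inj f\<close> \<open>surj f\<close> lower upper by unfold_locales (auto simp: bij_def)
  have rank: "perm_rank f i j = r i j" for i j
  proof (cases "j < i")
    case False
    \<comment> \<open>The interval grows leftwards from the empty one, both functions having row
      difference \<open>d\<close>.\<close>
    have "perm_rank f (j + 1 - int m) j = r (j + 1 - int m) j" for m
    proof (induction m)
      case 0
      then show ?case by (simp add: perm_rank_empty empty)
    next
      case (Suc m)
      then show ?case using perm_rank_left[of "j - int m" j] d_iff[of "j - int m" j]
        by (simp add: d_def algebra_simps)
    qed
    from this[of "nat (j + 1 - i)"] False show ?thesis by simp
  qed (simp add: perm_rank_empty empty)
  moreover have "f \<in> Bound k n"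
    unfolding Bound_iff[OF n] using bounded_perm_axioms rank long[of 1 "int n"] by simp
  ultimately show ?thesis by blast
qed


section \<open>Reflections and word length in the affine symmetric group\<close>

definition cyc :: "nat \<Rightarrow> int \<Rightarrow> int" where
  "cyc n x = (x - 1) mod int n + 1"

text \<open>The reflection \<open>t\<^sub>a\<^sub>b\<close>, exchanging \<open>a + m n\<close> and
  \<open>b + m n\<close> for every \<open>m\<close>; it is meaningful for \<open>a\<close> and
  \<open>b\<close> incongruent modulo \<open>n\<close>.\<close>

definition affine_transposition :: "nat \<Rightarrow> int \<Rightarrow> int \<Rightarrow> int \<Rightarrow> int" where
  "affine_transposition n a b = (\<lambda>x. if x mod int n = a mod int n then x + (b - a)
     else if x mod int n = b mod int n then x - (b - a) else x)"

lemma cyc_in: "0 < n \<Longrightarrow> cyc n x \<in> {1..int n}"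
  using pos_mod_bound[of "int n" "x - 1"] pos_mod_sign[of "int n" "x - 1"]
  unfolding cyc_def atLeastAtMost_iff by linarith

lemma cyc_eq_iff: "cyc n x = cyc n y \<longleftrightarrow> x mod int n = y mod int n"
proof -
  have "(x - 1) mod int n = (y - 1) mod int n \<longleftrightarrow> x mod int n = y mod int n"
    by (simp add: mod_eq_dvd_iff)
  then show ?thesis by (simp add: cyc_def)
qed

lemma cyc_id: "x \<in> {1..int n} \<Longrightarrow> cyc n x = x"
  by (simp add: cyc_def)

lemma cyc_mod: "cyc n x mod int n = x mod int n"
  by (simp add: cyc_def mod_simps)

lemma cyc_eq_add: "\<exists>m. cyc n x = x + m * int n"
  using cyc_mod[of n x] by (metis add.commute mod_eqE mult.commute mod_eq_dvd_iff diff_add_cancel dvdE)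

lemma mod_eq_add: "x mod int n = a mod int n \<Longrightarrow> \<exists>m. x = a + m * int n"
  by (metis diff_add_cancel add.commute mod_eq_dvd_iff dvdE mult.commute)

lemma periodic_mult:
  fixes g :: "int \<Rightarrow> int"
  assumes "\<And>i. g (i + int n) = g i + c"
  shows "g (i + m * int n) = g i + m * c"
proof (induction m rule: int_induct[of _ 0])
  case (step1 m)
  then show ?case using assms[of "i + m * int n"] by (simp add: algebra_simps)
next
  case (step2 m)
  then show ?case using assms[of "i + (m - 1) * int n"] by (simp add: algebra_simps)
qed simp

lemma periodic_cyc:
  fixes g :: "int \<Rightarrow> int"
  assumes "\<And>i. g (i + int n) = g i"
  shows "g (cyc n i) = g i"
  using periodic_mult[of g n 0 i] cyc_eq_add[of n i] assms by auto

text \<open>\<open>y\<close> induces a permutation of the residues modulo \<open>n\<close>, and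
  \<open>cyc\<close> chooses representatives in the period.\<close>

lemma sum_period_reindex:
  fixes g y :: "int \<Rightarrow> int"
  assumes "0 < n" and g: "\<And>i. g (i + int n) = g i"
    and y: "\<And>i. y (i + int n) = y i + int n" and "bij y"
  shows "(\<Sum>i = 1..int n. g (y i)) = (\<Sum>i = 1..int n. g i)"
proof -
  have inj: "inj_on (\<lambda>i. cyc n (y i)) {1..int n}"
  proof (rule inj_onI)
    fix i j assume ij: "i \<in> {1..int n}" "j \<in> {1..int n}" and "cyc n (y i) = cyc n (y j)"
    then obtain m where "y i = y j + m * int n"
      using mod_eq_add cyc_eq_iff by blast
    then have "y i = y (j + m * int n)"
      using periodic_mult[of y n "int n" j m] y by simp
    then have "i = j + m * int n"
      using \<open>bij y\<close> by (simp add: bij_is_inj inj_eq)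
    then have "cyc n i = cyc n j" by (simp add: cyc_eq_iff)
    then show "i = j" using ij by (simp add: cyc_id)
  qed
  have "(\<lambda>i. cyc n (y i)) ` {1..int n} = {1..int n}"
    by (rule endo_inj_surj[OF _ _ inj]) (use cyc_in[OF \<open>0 < n\<close>] in auto)
  then have "(\<Sum>i = 1..int n. g i) = (\<Sum>i = 1..int n. g (cyc n (y i)))"
    using sum.reindex[OF inj, of g] by simp
  also have "\<dots> = (\<Sum>i = 1..int n. g (y i))"
    using periodic_cyc[of g n] g by simp
  finally show ?thesis by simp
qed

lemma sum_two_residues:
  fixes g :: "int \<Rightarrow> int"
  assumes n: "0 < n" and g: "\<And>i. g (i + int n) = g i" and ab: "a mod int n \<noteq> b mod int n"
    and 0: "\<And>i. i mod int n \<noteq> a mod int n \<Longrightarrow> i mod int n \<noteq> b mod int n \<Longrightarrow> g i = 0"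
  shows "(\<Sum>i = 1..int n. g i) = g a + g b"
proof -
  have "(\<Sum>i = 1..int n. g i) = (\<Sum>i \<in> {cyc n a, cyc n b}. g i)"
  proof (rule sum.mono_neutral_right)
    show "\<forall>i\<in>{1..int n} - {cyc n a, cyc n b}. g i = 0"
      using 0 cyc_id cyc_eq_iff by (metis DiffE insertCI)
  qed (use cyc_in[OF n] in auto)
  also have "\<dots> = g (cyc n a) + g (cyc n b)"
    using ab by (simp add: cyc_eq_iff)
  finally show ?thesis using periodic_cyc[of g n] g by simp
qed

lemma affine_perms_iff:
  assumes "0 < n"
  shows "f \<in> affine_perms n k \<longleftrightarrow>
    bij f \<and> (\<forall>i. f (i + int n) = f i + int n) \<and> (\<Sum>i = 1..int n. f i - i) = int n * k"
proof -
  have "(1 / rat_of_nat n) * rat_of_int s = rat_of_int k \<longleftrightarrow> s = int n * k" for s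
  proof -
    have "(1 / rat_of_nat n) * rat_of_int s = rat_of_int k \<longleftrightarrow> rat_of_int s = rat_of_int (int n * k)"
      using assms by (auto simp: field_simps)
    then show ?thesis by (simp only: of_int_eq_iff)
  qed
  then show ?thesis unfolding affine_perms_def by blast
qed

lemma affine_perms_comp:
  assumes "0 < n" "f \<in> affine_perms n k" "g \<in> affine_perms n l"
  shows "f \<circ> g \<in> affine_perms n (k + l)"
proof -
  note f = assms(2)[unfolded affine_perms_iff[OF \<open>0 < n\<close>]]
    and g = assms(3)[unfolded affine_perms_iff[OF \<open>0 < n\<close>]]
  have "(\<Sum>i = 1..int n. f (g i) - i) = (\<Sum>i = 1..int n. f (g i) - g i) + (\<Sum>i = 1..int n. g i - i)"
    by (simp add: sum.distrib[symmetric])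
  also have "(\<Sum>i = 1..int n. f (g i) - g i) = (\<Sum>i = 1..int n. f i - i)"
    by (rule sum_period_reindex[of n "\<lambda>i. f i - i"]) (use f g assms(1) in auto)
  finally show ?thesis
    using f g unfolding affine_perms_iff[OF \<open>0 < n\<close>]
    by (simp add: bij_comp distrib_left)
qed

lemma translation_affine_perms: "0 < n \<Longrightarrow> (\<lambda>i. i + k) \<in> affine_perms n k"
  using bij_plus_right[of k] by (simp add: affine_perms_iff)

section \<open>Affine transpositions\<close>

context
  fixes n :: nat and a b :: int
  assumes n: "0 < n" and ab: "a mod int n \<noteq> b mod int n"
begin

lemma affine_transposition_simps:
  "affine_transposition n a b (a + m * int n) = b + m * int n"
  "affine_transposition n a b (b + m * int n) = a + m * int n"
  using ab by (simp_all add: affine_transposition_def)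

lemma affine_transposition_swap [simp]:
  "affine_transposition n a b a = b" "affine_transposition n a b b = a"
  using affine_transposition_simps[of 0] by simp_all

lemma affine_transposition_other:
  "x mod int n \<noteq> a mod int n \<Longrightarrow> x mod int n \<noteq> b mod int n \<Longrightarrow> affine_transposition n a b x = x"
  by (simp add: affine_transposition_def)

lemma affine_transposition_cases:
  obtains (left) m where "x = a + m * int n" "affine_transposition n a b x = b + m * int n"
  | (right) m where "x = b + m * int n" "affine_transposition n a b x = a + m * int n"
  | (other) "x mod int n \<noteq> a mod int n" "x mod int n \<noteq> b mod int n" "affine_transposition n a b x = x"
  using affine_transposition_simps affine_transposition_other mod_eq_add by metis

lemma affine_transposition_involutive [simp]:
  "affine_transposition n a b (affine_transposition n a b x) = x"
  by (cases rule: affine_transposition_cases[of x]) (simp_all add: affine_transposition_simps)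

lemma affine_transposition_comp [simp]: "affine_transposition n a b \<circ> affine_transposition n a b = id"
  by (simp add: fun_eq_iff)

lemma affine_transposition_bij: "bij (affine_transposition n a b)"
  by (rule o_bij) (rule affine_transposition_comp)+

lemma affine_transposition_sym: "affine_transposition n b a = affine_transposition n a b"
  using ab by (auto simp: affine_transposition_def fun_eq_iff)

lemma affine_transposition_periodic:
  "affine_transposition n a b (x + int n) = affine_transposition n a b x + int n"
  by (simp add: affine_transposition_def)

lemma affine_transposition_in: "affine_transposition n a b \<in> affine_perms n 0"
  unfolding affine_perms_iff[OF n]
  using sum_two_residues[OF n _ ab, of "\<lambda>i. affine_transposition n a b i - i"]
    affine_transposition_bij affine_transposition_periodic affine_transposition_other
  by simp

lemma affine_transposition_conj:
  assumes "bij w" "\<And>i. w (i + int n) = w i + int n"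
  shows "w a mod int n \<noteq> w b mod int n"
    and "w \<circ> affine_transposition n a b = affine_transposition n (w a) (w b) \<circ> w"
proof -
  have mult: "w (i + m * int n) = w i + m * int n" for i m
    using periodic_mult[of w n "int n" i m] assms(2) by simp
  have mod: "w x mod int n = w y mod int n \<longleftrightarrow> x mod int n = y mod int n" for x y
  proof
    assume "w x mod int n = w y mod int n"
    then obtain m where "w x = w (y + m * int n)" using mod_eq_add mult by metis
    then show "x mod int n = y mod int n"
      using bij_is_inj[OF assms(1)] by (simp add: inj_eq)
  next
    assume "x mod int n = y mod int n"
    then obtain m where "x = y + m * int n" using mod_eq_add by blast
    then show "w x mod int n = w y mod int n" by (simp add: mult)
  qed
  show "w a mod int n \<noteq> w b mod int n" using ab mod by blast
  show "w \<circ> affine_transposition n a b = affine_transposition n (w a) (w b) \<circ> w"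
  proof
    fix x
    show "(w \<circ> affine_transposition n a b) x = (affine_transposition n (w a) (w b) \<circ> w) x"
    proof (cases rule: affine_transposition_cases[of x])
      case (left m)
      have "w (affine_transposition n a b x) = w b + m * int n"
        unfolding left(2) by (rule mult)
      then show ?thesis
        using mult[of a m] by (simp add: left(1) affine_transposition_def[of n "w a"])
    next
      case (right m)
      have "w b mod int n \<noteq> w a mod int n" using ab mod by metis
      moreover have "w (affine_transposition n a b x) = w a + m * int n"
        unfolding right(2) by (rule mult)
      ultimately show ?thesis
        using mult[of b m] by (simp add: right(1) affine_transposition_def[of n "w a"])
    next
      case other
      then show ?thesis by (simp add: mod affine_transposition_def[of n "w a"])
    qed
  qed
qed

text \<open>Source of the termination measure for removing inversions: for \<open>a < b\<close> and
  \<open>w b < w a\<close> the sum strictly decreases. Reindexing by the involution moves it from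
  the argument of \<open>w\<close> onto \<open>i\<close>, and then only two residues
  contribute.\<close>

lemma sum_squares_affine_transposition:
  assumes "bij w" "\<And>i. w (i + int n) = w i + int n"
  shows "(\<Sum>i = 1..int n. (w (affine_transposition n a b i) - i)\<^sup>2)
    = (\<Sum>i = 1..int n. (w i - i)\<^sup>2) - 2 * (b - a) * (w a - w b)"
proof -
  let ?t = "affine_transposition n a b"
  have "(\<Sum>i = 1..int n. (w (?t i) - i)\<^sup>2) = (\<Sum>i = 1..int n. (w i - ?t i)\<^sup>2)"
    using sum_period_reindex[of n "\<lambda>i. (w i - ?t i)\<^sup>2" ?t] n affine_transposition_bij
      affine_transposition_periodic assms(2) by simp
  also have "\<dots> - (\<Sum>i = 1..int n. (w i - i)\<^sup>2) = (\<Sum>i = 1..int n. (w i - ?t i)\<^sup>2 - (w i - i)\<^sup>2)"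
    by (simp add: sum_subtractf)
  also have "\<dots> = (w a - ?t a)\<^sup>2 - (w a - a)\<^sup>2 + ((w b - ?t b)\<^sup>2 - (w b - b)\<^sup>2)"
    by (rule sum_two_residues[OF n _ ab])
      (simp_all add: assms(2) affine_transposition_periodic affine_transposition_other)
  finally show ?thesis by (simp add: power2_eq_square algebra_simps)
qed

end

section \<open>Generation, exchange and word length\<close>

lemma simple_reflection_eq: "simple_reflection n i = affine_transposition n i (i + 1)"
  by (auto simp: simple_reflection_def affine_transposition_def fun_eq_iff)

lemma Suc_mod_neq: "2 \<le> n \<Longrightarrow> i mod int n \<noteq> (i + 1) mod int n"
proof
  assume "2 \<le> n" "i mod int n = (i + 1) mod int n"
  then have "int n dvd 1" by (metis add_diff_cancel_left' mod_eq_dvd_iff)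
  with \<open>2 \<le> n\<close> show False by simp
qed

text \<open>The \<open>n\<close> increments over a period are positive and add up to
  \<open>n\<close>, so all are 1; a translation with average displacement 0 is the identity.\<close>

lemma affine_perms_0_increasing:
  assumes "0 < n" "w \<in> affine_perms n 0" "\<And>i. w i < w (i + 1)"
  shows "w = id"
proof -
  note w = assms(2)[unfolded affine_perms_iff[OF \<open>0 < n\<close>]]
  have mono: "int m \<le> w (i + int m) - w i" for i m
  proof (induction m)
    case (Suc m)
    then show ?case using assms(3)[of "i + int m"] by (simp add: algebra_simps)
  qed simp
  have step: "w (i + 1) = w i + 1" for i
    using mono[of "n - 1" "i + 1"] w assms(1,3) by (smt (verit) Suc_pred' add.assoc add.commute of_nat_Suc)
  have c: "w i - i = w 0" for i
  proof (induction i rule: int_induct[of _ 0])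
    case (step1 i)
    then show ?case using step[of i] by simp
  next
    case (step2 i)
    then show ?case using step[of "i - 1"] by simp
  qed simp
  then have "int n * w 0 = 0" using w by simp
  then show ?thesis using c assms(1) by (simp add: fun_eq_iff)
qed

text \<open>A permutation that is not increasing has an adjacent descent; removing it by a simple
  reflection lowers the sum of squared displacements.\<close>

lemma affine_generated:
  assumes n: "0 < n" and "w \<in> affine_perms n 0"
  shows "\<exists>ws. set ws \<subseteq> affine_generators n \<and> foldr (\<circ>) ws id = w"
  using assms(2)
proof (induction "nat (\<Sum>i = 1..int n. (w i - i)\<^sup>2)" arbitrary: w rule: less_induct)
  case less
  note w = less.prems[unfolded affine_perms_iff[OF n]]
  show ?case
  proof (cases "\<forall>i. w i < w (i + 1)")
    case True
    then have "w = id" using affine_perms_0_increasing n less.prems by blast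
    then show ?thesis by (intro exI[of _ "[]"]) simp
  next
    case False
    then obtain i where i: "\<not> w i < w (i + 1)" by blast
    then have "w (i + 1) < w i"
      using w bij_is_inj[of w] inj_eq[of w i "i + 1"] by force
    \<comment> \<open>For \<open>n = 1\<close> periodicity makes \<open>w\<close> increasing, so a
      descent excludes the case without generators.\<close>
    have "n \<noteq> 1" using i w by force
    then have n2: "2 \<le> n" using n by simp
    note mod = Suc_mod_neq[OF n2, of i]
    let ?s = "affine_transposition n i (i + 1)"
    have "(\<Sum>j = 1..int n. ((w \<circ> ?s) j - j)\<^sup>2) < (\<Sum>j = 1..int n. (w j - j)\<^sup>2)"
      using sum_squares_affine_transposition[OF n mod, of w] w \<open>w (i + 1) < w i\<close> by simp
    moreover have "0 \<le> (\<Sum>j = 1..int n. ((w \<circ> ?s) j - j)\<^sup>2)" by (intro sum_nonneg) simp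
    ultimately have "nat (\<Sum>j = 1..int n. ((w \<circ> ?s) j - j)\<^sup>2) < nat (\<Sum>j = 1..int n. (w j - j)\<^sup>2)"
      by linarith
    moreover have "w \<circ> ?s \<in> affine_perms n 0"
      using affine_perms_comp[OF n less.prems affine_transposition_in[OF n mod]] by simp
    ultimately obtain ws where ws: "set ws \<subseteq> affine_generators n" "foldr (\<circ>) ws id = w \<circ> ?s"
      using less.hyps by blast
    have fold: "foldr (\<circ>) xs x = foldr (\<circ>) xs id \<circ> x" for xs :: "(int \<Rightarrow> int) list" and x
      by (induction xs) (simp_all add: o_assoc)
    have "foldr (\<circ>) (ws @ [?s]) id = w \<circ> (?s \<circ> ?s)"
      using ws(2) fold[of ws ?s] by (simp add: o_assoc)
    also have "\<dots> = w" by (simp add: affine_transposition_comp[OF n mod])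
    finally show ?thesis
      using ws(1) n2 by (intro exI[of _ "ws @ [?s]"])
        (auto simp: affine_generators_def simple_reflection_eq[symmetric])
  qed
qed

lemma foldr_comp_Cons: "foldr (\<circ>) (x # xs) id = x \<circ> foldr (\<circ>) xs id"
  by simp

lemma affine_perms_foldr:
  assumes "2 \<le> n" "set ws \<subseteq> affine_generators n"
  shows "foldr (\<circ>) ws id \<in> affine_perms n 0"
  using assms(2)
proof (induction ws)
  case Nil
  then show ?case using translation_affine_perms[of n 0] assms(1) by (simp add: id_def)
next
  case (Cons s ws)
  then obtain i where "s = affine_transposition n i (i + 1)"
    using assms(1) by (auto simp: affine_generators_def simple_reflection_eq)
  then have "s \<in> affine_perms n 0"
    using assms(1) affine_transposition_in[OF _ Suc_mod_neq] by simp
  moreover have "foldr (\<circ>) ws id \<in> affine_perms n 0"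
    by (rule Cons.IH) (use Cons.prems in simp)
  ultimately show ?case
    using affine_perms_comp[of n s 0 "foldr (\<circ>) ws id" 0] assms(1)
    unfolding foldr_comp_Cons add_0 by linarith
qed

text \<open>Follow the images of \<open>a\<close> and \<open>b\<close> as the letters act from the
  right. A letter that reverses their order exchanges two adjacent images; deleting it amounts to
  multiplying by the transposition.\<close>

lemma strong_exchange:
  assumes n: "2 \<le> n" and ab: "a < b" "a mod int n \<noteq> b mod int n"
    and "set ws \<subseteq> affine_generators n" "foldr (\<circ>) ws id b < foldr (\<circ>) ws id a"
  shows "\<exists>us. set us \<subseteq> affine_generators n \<and> length us < length ws \<and>
    foldr (\<circ>) us id = foldr (\<circ>) ws id \<circ> affine_transposition n a b"
  using assms(4,5)
proof (induction ws)
  case Nil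
  then show ?case using ab by simp
next
  case (Cons s ws)
  define u where "u = foldr (\<circ>) ws id"
  have n0: "0 < n" using n by simp
  have u: "bij u" "\<And>i. u (i + int n) = u i + int n"
    using affine_perms_foldr[OF n, of ws] Cons.prems(1) by (auto simp: u_def affine_perms_iff[OF n0])
  show ?case
  proof (cases "u b < u a")
    case True
    then obtain us where "set us \<subseteq> affine_generators n" "length us < length ws"
      "foldr (\<circ>) us id = u \<circ> affine_transposition n a b"
      using Cons.IH Cons.prems(1) unfolding u_def[symmetric] by (metis insert_subset list.set(2))
    moreover from this(3) have "foldr (\<circ>) (s # us) id = foldr (\<circ>) (s # ws) id \<circ> affine_transposition n a b"
      unfolding foldr_comp_Cons u_def[symmetric] comp_assoc by (rule arg_cong)
    moreover have "set (s # us) \<subseteq> affine_generators n" if "set us \<subseteq> affine_generators n"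
      using that Cons.prems(1) by simp
    moreover have "length (s # us) < length (s # ws)" if "length us < length ws"
      using that by simp
    ultimately show ?thesis by blast
  next
    case False
    then have less: "u a < u b"
      using ab(1) u(1) bij_is_inj[of u] inj_eq[of u a b] by force
    obtain i where s: "s = simple_reflection n i"
      using Cons.prems(1) n by (auto simp: affine_generators_def)
    have gt: "s (u b) < s (u a)"
      using Cons.prems(2) unfolding foldr_comp_Cons u_def[symmetric] by (simp only: o_apply)
    \<comment> \<open>\<open>s\<close> moves each point by at most 1, so it can reverse
      \<open>u a < u b\<close> only if these are adjacent and form a swapped pair.\<close>
    then have *: "u a mod int n = i mod int n" "u b = u a + 1"
      using less by (auto simp: s simple_reflection_def split: if_splits)
    then have "s = affine_transposition n (u a) (u b)"
      by (auto simp: s simple_reflection_def affine_transposition_def fun_eq_iff mod_simps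
          intro: mod_add_cong)
    then have "s \<circ> u = u \<circ> affine_transposition n a b"
      using affine_transposition_conj[OF n0 ab(2) u] by simp
    then have "u = s \<circ> u \<circ> affine_transposition n a b"
      by (simp add: comp_assoc affine_transposition_comp[OF n0 ab(2)])
    then have "foldr (\<circ>) ws id = foldr (\<circ>) (s # ws) id \<circ> affine_transposition n a b"
      unfolding foldr_comp_Cons u_def[symmetric] .
    moreover have "set ws \<subseteq> affine_generators n" "length ws < length (s # ws)"
      using Cons.prems(1) by simp_all
    ultimately show ?thesis by blast
  qed
qed

lemma word_length_transposition:
  assumes n: "2 \<le> n" and ab: "a < b" "a mod int n \<noteq> b mod int n"
    and w: "w \<in> affine_perms n 0" "w b < w a"
  shows "word_length (affine_generators n) (w \<circ> affine_transposition n a b)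
    < word_length (affine_generators n) w"
proof -
  have "\<exists>m ws. length ws = m \<and> set ws \<subseteq> affine_generators n \<and> foldr (\<circ>) ws id = w"
    using affine_generated[OF _ w(1)] n by auto
  from LeastI_ex[OF this] obtain ws where ws: "length ws = word_length (affine_generators n) w"
    "set ws \<subseteq> affine_generators n" "foldr (\<circ>) ws id = w"
    unfolding word_length_def by blast
  then obtain us where "set us \<subseteq> affine_generators n" "length us < length ws"
    "foldr (\<circ>) us id = w \<circ> affine_transposition n a b"
    using strong_exchange[OF n ab ws(2)] w by auto
  moreover from this have "word_length (affine_generators n) (w \<circ> affine_transposition n a b) \<le> length us"
    unfolding word_length_def by (intro Least_le) auto
  ultimately show ?thesis using ws(1) by simp
qed

lemma word_length_transposition_iff:
  assumes n: "2 \<le> n" and ab: "a < b" "a mod int n \<noteq> b mod int n" and w: "w \<in> affine_perms n 0"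
  shows "word_length (affine_generators n) w
    < word_length (affine_generators n) (w \<circ> affine_transposition n a b) \<longleftrightarrow> w a < w b"
proof -
  let ?t = "affine_transposition n a b"
  have n0: "0 < n" using n by simp
  have "w \<circ> ?t \<in> affine_perms n 0"
    using affine_perms_comp[OF n0 w affine_transposition_in[OF n0 ab(2)]] by simp
  note 1 = word_length_transposition[OF n ab this]
  have "w \<circ> ?t \<circ> ?t = w" by (simp add: comp_assoc affine_transposition_comp[OF n0 ab(2)])
  moreover have "w a \<noteq> w b" using ab(1) w bij_is_inj[of w] inj_eq[of w a b]
    by (auto simp: affine_perms_iff[OF n0])
  ultimately show ?thesis
    using 1 word_length_transposition[OF n ab w] affine_transposition_swap[OF n0 ab(2)]
    by (cases "w a < w b") auto
qed

lemma reflections_transposition: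
  assumes "2 \<le> n" "t \<in> reflections (affine_perms n 0) (affine_generators n)"
  obtains a b where "a < b" "a mod int n \<noteq> b mod int n" "t = affine_transposition n a b"
proof -
  have n0: "0 < n" using assms(1) by simp
  obtain w i where w: "w \<in> affine_perms n 0"
    and t: "t = w \<circ> affine_transposition n i (i + 1) \<circ> inv_into UNIV w"
    using assms by (auto simp: reflections_def affine_generators_def simple_reflection_eq)
  note w' = w[unfolded affine_perms_iff[OF n0]]
  note conj = affine_transposition_conj[OF n0 Suc_mod_neq[OF assms(1)], of w i]
  have "w \<circ> inv_into UNIV w = id" using w' by (simp add: bij_is_surj surj_iff[symmetric])
  then have "t = affine_transposition n (w i) (w (i + 1))"
    using conj(2) w' by (simp add: t comp_assoc)
  moreover have "w i mod int n \<noteq> w (i + 1) mod int n" using conj(1) w' by blast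
  ultimately show ?thesis
    using that[of "w i" "w (i + 1)"] that[of "w (i + 1)" "w i"] affine_transposition_sym[OF n0]
    by (metis linorder_neqE)
qed

text \<open>It suffices to find \<open>w\<close> in the group carrying \<open>a\<close>,
  \<open>a + 1\<close> to \<open>a\<close>, \<open>b\<close>, since conjugation by \<open>w\<close>
  then turns the simple reflection into the transposition.\<close>

lemma transposition_in_reflections:
  assumes n: "2 \<le> n" and ab: "a < b" "b < a + int n"
  shows "affine_transposition n a b \<in> reflections (affine_perms n 0) (affine_generators n)"
proof -
  have n0: "0 < n" using n by simp
  \<comment> \<open>Unless \<open>b = a + 1\<close>, the transposition of \<open>a + 1\<close> and
    \<open>b\<close> serves; it fixes \<open>a\<close> because \<open>0 < b - a < n\<close>.\<close>
  have "\<exists>w \<in> affine_perms n 0. w a = a \<and> w (a + 1) = b"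
  proof (cases "b = a + 1")
    case True
    then show ?thesis
      using translation_affine_perms[OF n0, of 0] by (intro bexI[of _ id]) (auto simp: id_def)
  next
    case False
    have nd: "\<not> int n dvd x" if "0 < x" "x < int n" for x
      using that zdvd_imp_le by force
    have 1: "(a + 1) mod int n \<noteq> b mod int n"
      using nd[of "b - (a + 1)"] ab False mod_eq_dvd_iff[of b "int n" "a + 1"] by linarith
    have 2: "a mod int n \<noteq> b mod int n"
      using nd[of "b - a"] ab mod_eq_dvd_iff[of b "int n" a] by linarith
    show ?thesis
      using affine_transposition_in[OF n0 1] affine_transposition_swap[OF n0 1]
        affine_transposition_other[OF n0 1, of a] Suc_mod_neq[OF n, of a] 2 by blast
  qed
  then obtain w where w: "w \<in> affine_perms n 0" "w a = a" "w (a + 1) = b" by blast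
  note w' = w(1)[unfolded affine_perms_iff[OF n0]]
  have "w \<circ> inv_into UNIV w = id" using w' by (simp add: bij_is_surj surj_iff[symmetric])
  then have "affine_transposition n a b = w \<circ> simple_reflection n a \<circ> inv_into UNIV w"
    using affine_transposition_conj(2)[OF n0 Suc_mod_neq[OF n], of w a] w w'
    by (simp add: comp_assoc simple_reflection_eq)
  then show ?thesis
    using w(1) n unfolding reflections_def affine_generators_def by auto
qed


section \<open>The Bruhat order in terms of rank functions\<close>

context bounded_perm
begin

lemma perm_rank_periodic_mult: "perm_rank f (i + m * int n) (j + m * int n) = perm_rank f i j"
proof (induction m rule: int_induct[of _ 0])
  case (step1 m)
  then show ?case
    using perm_rank_periodic[of "i + m * int n" "j + m * int n"] by (simp add: algebra_simps)
next
  case (step2 m)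
  then show ?case
    using perm_rank_periodic[of "i + (m - 1) * int n" "j + (m - 1) * int n"] by (simp add: algebra_simps)
qed simp

text \<open>From \<open>b \<le> f b < f a \<le> a + n\<close>, the rows of an inversion are at
  distance strictly between 0 and \<open>n\<close>.\<close>

lemma inversion_bounds:
  assumes "a < b" "f b < f a"
  shows "b < a + int n" "a mod int n \<noteq> b mod int n"
proof -
  show *: "b < a + int n" using lower[of b] upper[of a] assms by linarith
  show "a mod int n \<noteq> b mod int n"
  proof
    assume "a mod int n = b mod int n"
    then have "int n dvd b - a" by (metis mod_eq_dvd_iff)
    then show False using zdvd_imp_le[of "int n" "b - a"] assms * by simp
  qed
qed

text \<open>The exchanged values satisfy \<open>a < b \<le> f b < f a \<le> a + n < b + n\<close>,
  so they stay within the bounds at both positions.\<close>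

lemma bounded_perm_comp_transposition:
  assumes "a < b" "f b < f a"
  shows "bounded_perm n (f \<circ> affine_transposition n a b)"
proof
  note mod = inversion_bounds(2)[OF assms]
  note per = periodic_mult[of f n "int n", OF periodic]
  show "0 < n" by (rule n_pos)
  show "bij (f \<circ> affine_transposition n a b)"
    using affine_transposition_bij[OF n_pos mod] bij by (rule bij_comp)
  fix i
  show "(f \<circ> affine_transposition n a b) (i + int n) = (f \<circ> affine_transposition n a b) i + int n"
    using affine_transposition_periodic[OF n_pos mod] periodic by simp
  have ab: "a \<le> f b" "f b \<le> a + int n" "b \<le> f a" "f a \<le> b + int n"
    using assms lower[of b] upper[of a] by linarith+
  show "i \<le> (f \<circ> affine_transposition n a b) i"
    by (cases rule: affine_transposition_cases[OF n_pos mod, of i]) (use ab per lower in auto)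
  show "(f \<circ> affine_transposition n a b) i \<le> i + int n"
    by (cases rule: affine_transposition_cases[OF n_pos mod, of i]) (use ab per upper in auto)
qed

text \<open>Uncrossing the dots \<open>(a, f a)\<close> and \<open>(b, f b)\<close> changes the
  count only in the rectangle they span. Its translates occupy disjoint sets of rows because
  \<open>b < a + n\<close>, so at most one \<open>m\<close> contributes.\<close>

lemma perm_rank_transposition:
  assumes ab: "a < b" "f b < f a"
  shows "perm_rank (f \<circ> affine_transposition n a b) i j = perm_rank f i j +
    (if \<exists>m. a + m * int n < i \<and> i \<le> b + m * int n \<and> f b + m * int n \<le> j \<and> j < f a + m * int n
     then 1 else 0)"
proof -
  note mod = inversion_bounds(2)[OF assms] and ban = inversion_bounds(1)[OF assms]
  let ?t = "affine_transposition n a b"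
  note per = periodic_mult[of f n "int n", OF periodic]
  have t_inj: "inj_on ?t X" for X
    using affine_transposition_bij[OF n_pos mod] by (meson bij_is_inj inj_on_subset subset_UNIV)
  have t_image: "?t ` {x. P (?t x)} = {x. P x}" for P
  proof (intro equalityI subsetI)
    fix x assume "x \<in> {x. P x}"
    then show "x \<in> ?t ` {x. P (?t x)}"
      using affine_transposition_involutive[OF n_pos mod, of x]
      by (intro image_eqI[of _ _ "?t x"]) simp_all
  qed auto
  show ?thesis
  proof (cases "\<exists>m. a + m * int n < i \<and> i \<le> b + m * int n")
    case False
    \<comment> \<open>No exchanged pair is separated by row \<open>i\<close>, so the reflection
      permutes the counted rows.\<close>
    have "i \<le> ?t x \<longleftrightarrow> i \<le> x" for x
    proof (cases rule: affine_transposition_cases[OF n_pos mod, of x])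
      case (1 m)
      then show ?thesis using False spec[of _ m] ab by (metis add_less_cancel_right less_le_trans not_le order_less_imp_le order_trans)
    next
      case (2 m)
      then show ?thesis using False ab by (metis add_less_cancel_right less_le_trans not_le order_less_imp_le order_trans)
    qed simp
    then have "{x. i \<le> x \<and> (f \<circ> ?t) x \<le> j} = {x. i \<le> ?t x \<and> f (?t x) \<le> j}" by simp
    moreover have "card {x. i \<le> ?t x \<and> f (?t x) \<le> j} = card {x. i \<le> x \<and> f x \<le> j}"
      using card_image[OF t_inj, of "{x. i \<le> ?t x \<and> f (?t x) \<le> j}"]
        t_image[of "\<lambda>x. i \<le> x \<and> f x \<le> j"] by simp
    ultimately show ?thesis using False by (auto simp: perm_rank_def)
  next
    case True
    then obtain m where m: "a + m * int n < i" "i \<le> b + m * int n" by blast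
    define A where "A = a + m * int n"
    define B where "B = b + m * int n"
    have t_AB: "?t A = B" "?t B = A"
      using affine_transposition_simps[OF n_pos mod] by (simp_all add: A_def B_def)
    have AB: "A < i" "i \<le> B" "B < A + int n" using m ban by (simp_all add: A_def B_def)
    \<comment> \<open>Only the pair \<open>A\<close>, \<open>B\<close> straddles row
      \<open>i\<close>. With \<open>B\<close> removed, the rows from \<open>i\<close> on are
      permuted, so the counts differ only by the dot in row \<open>B\<close>.\<close>
    have stable: "i \<le> ?t x \<and> ?t x \<noteq> B \<longleftrightarrow> i \<le> x \<and> x \<noteq> B" for x
    proof -
      have shift: "int n \<le> l * int n \<or> l = 0 \<or> l * int n \<le> - int n" for l
      proof -
        have "l \<ge> 1 \<or> l = 0 \<or> l \<le> - 1" by linarith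
        then show ?thesis
          using mult_right_mono[of 1 l "int n"] mult_right_mono[of l "- 1" "int n"] by auto
      qed
      show ?thesis
      proof (cases rule: affine_transposition_cases[OF n_pos mod, of x])
        case (1 l)
        define d where "d = (l - m) * int n"
        have "x = A + d" "?t x = B + d"
          using 1 by (simp_all add: A_def B_def d_def algebra_simps)
        moreover have "int n \<le> d \<or> d = 0 \<or> d \<le> - int n"
          using shift[of "l - m"] by (simp only: d_def) auto
        ultimately show ?thesis using AB by auto
      next
        case (2 l)
        define d where "d = (l - m) * int n"
        have "x = B + d" "?t x = A + d"
          using 2 by (simp_all add: A_def B_def d_def algebra_simps)
        moreover have "int n \<le> d \<or> d = 0 \<or> d \<le> - int n"
          using shift[of "l - m"] by (simp only: d_def) auto
        ultimately show ?thesis using AB by auto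
      qed simp
    qed
    have split: "card {x. i \<le> x \<and> g x \<le> j} =
        card {x. (i \<le> x \<and> x \<noteq> B) \<and> g x \<le> j} + (if g B \<le> j then 1 else 0)"
      if "finite {x. (i \<le> x \<and> x \<noteq> B) \<and> g x \<le> j}" for g :: "int \<Rightarrow> int"
    proof -
      have "{x. i \<le> x \<and> g x \<le> j} =
        {x. (i \<le> x \<and> x \<noteq> B) \<and> g x \<le> j} \<union> (if g B \<le> j then {B} else {})"
        using AB by auto
      then show ?thesis using that by simp
    qed
    have fin: "finite {x. (i \<le> x \<and> x \<noteq> B) \<and> f x \<le> j}"
      by (rule finite_subset[OF _ finite_dots[of i j]]) auto
    have "{x. (i \<le> x \<and> x \<noteq> B) \<and> (f \<circ> ?t) x \<le> j} = {x. (i \<le> ?t x \<and> ?t x \<noteq> B) \<and> f (?t x) \<le> j}"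
      by (simp add: stable)
    moreover have img: "?t ` {x. (i \<le> ?t x \<and> ?t x \<noteq> B) \<and> f (?t x) \<le> j} = {x. (i \<le> x \<and> x \<noteq> B) \<and> f x \<le> j}"
      by (rule t_image)
    ultimately have "card {x. (i \<le> x \<and> x \<noteq> B) \<and> (f \<circ> ?t) x \<le> j} = card {x. (i \<le> x \<and> x \<noteq> B) \<and> f x \<le> j}"
      and "finite {x. (i \<le> x \<and> x \<noteq> B) \<and> (f \<circ> ?t) x \<le> j}"
      using card_image[OF t_inj, of "{x. (i \<le> ?t x \<and> ?t x \<noteq> B) \<and> f (?t x) \<le> j}"] fin
        finite_image_iff[OF t_inj, of "{x. (i \<le> ?t x \<and> ?t x \<noteq> B) \<and> f (?t x) \<le> j}"] by simp_all
    then have count: "perm_rank (f \<circ> ?t) i j = perm_rank f i j + (if f B \<le> j then 1 else 0) - (if f A \<le> j then 1 else 0)"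
      using split[of "f \<circ> ?t"] split[of f] fin by (simp add: perm_rank_def t_AB)
    have fA: "f A = f a + m * int n" and fB: "f B = f b + m * int n"
      by (simp_all add: A_def B_def per)
    have uniq: "m' = m" if "a + m' * int n < i" "i \<le> b + m' * int n" for m'
    proof -
      have "m' * int n < (m + 1) * int n" "m * int n < (m' + 1) * int n"
        using that m ban by (simp_all add: algebra_simps)
      then show ?thesis using n_pos by (simp add: mult_less_cancel_right)
    qed
    have "(\<exists>m. a + m * int n < i \<and> i \<le> b + m * int n \<and> f b + m * int n \<le> j \<and> j < f a + m * int n)
      \<longleftrightarrow> f B \<le> j \<and> j < f A"
      using uniq m unfolding fA fB by metis
    moreover have "f B < f A" using ab unfolding fA fB by simp
    ultimately show ?thesis using count by auto
  qed
qed

end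

section \<open>Descents towards a smaller element\<close>

lemma Bound_comp_transposition:
  assumes n: "0 < n" and f: "f \<in> Bound k n" and ab: "a < b" "f b < f a"
  shows "f \<circ> affine_transposition n a b \<in> Bound k n"
proof -
  interpret bounded_perm n f by (rule Bound_bounded_perm[OF f n])
  have "f \<circ> affine_transposition n a b \<in> affine_perms n (int k)"
    using affine_perms_comp[OF n _ affine_transposition_in[OF n inversion_bounds(2)[OF ab]], of f "int k"] f
    by (simp add: Bound_def)
  then show ?thesis
    using bounded_perm.lower[OF bounded_perm_comp_transposition[OF ab]]
      bounded_perm.upper[OF bounded_perm_comp_transposition[OF ab]] by (simp add: Bound_def)
qed

text \<open>On a shortest interval where the ranks differ, they agree after removing either end
  point or both, and this forces a dot of \<open>g\<close> at the corner.\<close>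

lemma ex_excess_dot:
  assumes n: "0 < n" and f: "f \<in> Bound k n" and g: "g \<in> Bound k n" and "f \<noteq> g"
    and le: "\<And>i j. perm_rank g i j \<le> perm_rank f i j"
  obtains b where "perm_rank g b (g b) < perm_rank f b (g b)"
proof -
  interpret f: bounded_perm n f by (rule Bound_bounded_perm[OF f n])
  interpret g: bounded_perm n g by (rule Bound_bounded_perm[OF g n])
  define D where "D i j \<longleftrightarrow> perm_rank g i j < perm_rank f i j" for i j
  have D_pos: "i \<le> j" if "D i j" for i j
    using that f.perm_rank_empty[of j i] g.perm_rank_empty[of j i] by (force simp: D_def)
  have "\<exists>i j. D i j"
    using Bound_eq_if_perm_rank_eq[OF f g n] \<open>f \<noteq> g\<close> le unfolding D_def by (meson order_antisym not_le)
  then have "\<exists>m i. D i (i + int m)"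
    using D_pos by (metis add.commute diff_add_cancel nonneg_int_cases diff_ge_0_iff_ge)
  from LeastI_ex[OF this] obtain i where i: "D i (i + int (LEAST m. \<exists>i. D i (i + int m)))" by blast
  define m where "m = (LEAST m. \<exists>i. D i (i + int m))"
  define j where "j = i + int m"
  have Dij: "D i j" using i by (simp add: m_def j_def)
  have smaller: "\<not> D i' j'" if "j' - i' < int m" for i' j'
  proof
    assume D: "D i' j'"
    then have "D i' (i' + int (nat (j' - i')))" using D_pos[OF D] by simp
    then have "m \<le> nat (j' - i')" unfolding m_def by (intro Least_le) blast
    then show False using that D_pos[OF D] by simp
  qed
  have 1: "\<not> D (i + 1) j" and 2: "\<not> D i (j - 1)" and 3: "\<not> D (i + 1) (j - 1)"
    by (rule smaller, simp add: j_def)+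
  have eq: "perm_rank g i' j' = perm_rank f i' j'" if "\<not> D i' j'" for i' j'
    using that le[of i' j'] by (simp add: D_def)
  have gi: "g i \<le> j" "j < f i"
    using Dij eq[OF 1] f.perm_rank_left[of i j] g.perm_rank_left[of i j]
    by (auto simp: D_def split: if_splits)
  have "g i = j"
    using gi eq[OF 2] eq[OF 3] f.perm_rank_left[of i "j - 1"] g.perm_rank_left[of i "j - 1"]
    by (auto split: if_splits)
  then show ?thesis using Dij that by (auto simp: D_def)
qed

text \<open>
  The rectangle grows from the dot \<open>(b, g b)\<close>: upwards to the last row \<open>i\<^sub>0\<close> on which the excess
  vanishes in column \<open>g b\<close>, and to the right until the excess vanishes somewhere in these rows.
  A count of dots in the remaining corner shows that it contains a dot of \<open>g\<close>.
\<close>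

lemma ex_excess_rectangle:
  assumes n: "0 < n" and f: "f \<in> Bound k n" and g: "g \<in> Bound k n"
    and le: "\<And>i j. perm_rank g i j \<le> perm_rank f i j"
    and b: "perm_rank g b (g b) < perm_rank f b (g b)"
  obtains a where "a < b" "g b < g a"
    and "\<And>i j. a < i \<Longrightarrow> i \<le> b \<Longrightarrow> g b \<le> j \<Longrightarrow> j < g a \<Longrightarrow> perm_rank g i j < perm_rank f i j"
proof -
  interpret f: bounded_perm n f by (rule Bound_bounded_perm[OF f n])
  interpret g: bounded_perm n g by (rule Bound_bounded_perm[OF g n])
  define D where "D i j = perm_rank f i j - perm_rank g i j" for i j
  have D_nonneg: "0 \<le> D i j" for i j using le by (simp add: D_def)
  have D_long: "D i j = 0" if "i + int n \<le> j" for i j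
    using that Bound_perm_rank_long[OF f n, of i j] Bound_perm_rank_long[OF g n, of i j]
    by (simp add: D_def)
  define c where "c = g b"
  have Db: "0 < D b c" using b by (simp add: D_def c_def)
  define P where "P m \<longleftrightarrow> D (b - 1 - int m) c = 0" for m
  have "P (nat (b - 1 - (c - int n)))"
    unfolding P_def using g.upper[of b] by (intro D_long) (simp add: c_def)
  then have "P (LEAST m. P m)" by (rule LeastI)
  define i0 where "i0 = b - 1 - int (LEAST m. P m)"
  have i0: "D i0 c = 0" using \<open>P (LEAST m. P m)\<close> by (simp add: P_def i0_def)
  have above: "0 < D i c" if "i0 < i" "i \<le> b" for i
  proof (cases "i = b")
    case False
    then have "nat (b - 1 - i) < (LEAST m. P m)" using that by (simp add: i0_def)
    from not_less_Least[OF this] False that have "D i c \<noteq> 0" by (simp add: P_def)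
    then show ?thesis using D_nonneg[of i c] by simp
  qed (use Db in simp)
  have "i0 < b" by (simp add: i0_def)
  define Q where "Q l \<longleftrightarrow> (\<exists>i. i0 < i \<and> i \<le> b \<and> D i (c + 1 + int l) = 0)" for l
  have "Q (nat (b + int n - c))"
    unfolding Q_def using \<open>i0 < b\<close> by (intro exI[of _ b] conjI D_long) auto
  then have "Q (LEAST l. Q l)" by (rule LeastI)
  define m where "m = c + 1 + int (LEAST l. Q l)"
  obtain i where i: "i0 < i" "i \<le> b" "D i m = 0"
    using \<open>Q (LEAST l. Q l)\<close> unfolding Q_def m_def by blast
  have right: "0 < D i' j" if "i0 < i'" "i' \<le> b" "c \<le> j" "j < m" for i' j
  proof (cases "j = c")
    case False
    then have "nat (j - c - 1) < (LEAST l. Q l)" using that by (simp add: m_def)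
    from not_less_Least[OF this] False that have "D i' j \<noteq> 0" by (auto simp: Q_def)
    then show ?thesis using D_nonneg[of i' j] by simp
  qed (use above that in simp)
  \<comment> \<open>If the corner held no dot of \<open>g\<close>, the excess in column
    \<open>m\<close> minus that in column \<open>c\<close> could not decrease from row
    \<open>i0\<close> to row \<open>i\<close>; but it is nonnegative at \<open>i0\<close> and
    negative at \<open>i\<close>.\<close>
  have "\<exists>a. i0 \<le> a \<and> a < i \<and> c < g a \<and> g a \<le> m"
  proof (rule ccontr)
    assume no: "\<nexists>a. i0 \<le> a \<and> a < i \<and> c < g a \<and> g a \<le> m"
    have step: "D x m - D x c \<le> D (x + 1) m - D (x + 1) c" if "i0 \<le> x" "x < i" for x
      using no that f.perm_rank_left[of x m] f.perm_rank_left[of x c]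
        g.perm_rank_left[of x m] g.perm_rank_left[of x c]
      by (auto simp: D_def m_def split: if_splits)
    have "D i0 m - D i0 c \<le> D x m - D x c" if "i0 \<le> x" "x \<le> i" for x
      using that
    proof (induction rule: int_ge_induct)
      case (step x)
      then show ?case using \<open>\<And>x. i0 \<le> x \<Longrightarrow> x < i \<Longrightarrow> _\<close>[of x] by simp
    qed simp
    from this[of i] show False using i i0 above[of i] D_nonneg[of i0 m] by simp
  qed
  then obtain a where a: "i0 \<le> a" "a < i" "c < g a" "g a \<le> m" by blast
  show ?thesis
  proof (rule that)
    show "a < b" "g b < g a" using a i by (simp_all add: c_def)
    fix i' j assume "a < i'" "i' \<le> b" "g b \<le> j" "j < g a"
    then show "perm_rank g i' j < perm_rank f i' j"
      using right[of i' j] a by (simp add: D_def c_def)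
  qed
qed

text \<open>The swap raises the rank of \<open>g\<close> by 1 exactly on the translates of a
  rectangle where the rank of \<open>f\<close> leaves room for it.\<close>

lemma ex_descent_between:
  assumes n: "0 < n" and f: "f \<in> Bound k n" and g: "g \<in> Bound k n" and "f \<noteq> g"
    and le: "\<And>i j. perm_rank g i j \<le> perm_rank f i j"
  obtains a b where "a < b" "g b < g a"
    and "\<And>i j. perm_rank (g \<circ> affine_transposition n a b) i j \<le> perm_rank f i j"
proof -
  interpret f: bounded_perm n f by (rule Bound_bounded_perm[OF f n])
  interpret g: bounded_perm n g by (rule Bound_bounded_perm[OF g n])
  obtain b where "perm_rank g b (g b) < perm_rank f b (g b)"
    using ex_excess_dot[OF assms] by blast
  then obtain a where ab: "a < b" "g b < g a"
    and rect: "\<And>i j. a < i \<Longrightarrow> i \<le> b \<Longrightarrow> g b \<le> j \<Longrightarrow> j < g a \<Longrightarrow> perm_rank g i j < perm_rank f i j"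
    using ex_excess_rectangle[OF n f g le] by blast
  have "perm_rank (g \<circ> affine_transposition n a b) i j \<le> perm_rank f i j" for i j
  proof (cases "\<exists>m. a + m * int n < i \<and> i \<le> b + m * int n \<and> g b + m * int n \<le> j \<and> j < g a + m * int n")
    case True
    then obtain m where "a + m * int n < i" "i \<le> b + m * int n" "g b + m * int n \<le> j" "j < g a + m * int n"
      by blast
    then have "perm_rank g (i - m * int n) (j - m * int n) < perm_rank f (i - m * int n) (j - m * int n)"
      by (intro rect) auto
    then show ?thesis
      using f.perm_rank_periodic_mult[of "i - m * int n" m "j - m * int n"]
        g.perm_rank_periodic_mult[of "i - m * int n" m "j - m * int n"]
        g.perm_rank_transposition[OF ab, of i j] by simp
  next
    case False
    then show ?thesis
      unfolding g.perm_rank_transposition[OF ab, of i j] if_not_P[OF False] using le[of i j] by simp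
  qed
  then show ?thesis using that ab by blast
qed

text \<open>The common induction behind Bruhat comparison and closure: a property is pushed up from
  \<open>f\<close> through inversions of \<open>g\<close>, terminating by the sum of squared
  displacements.\<close>

lemma descent_induct [consumes 4, case_names refl step]:
  assumes n: "0 < n" and f: "f \<in> Bound k n" and g: "g \<in> Bound k n"
    and le: "\<And>i j. perm_rank g i j \<le> perm_rank f i j"
    and refl: "P f"
    and step: "\<And>g a b. g \<in> Bound k n \<Longrightarrow> a < b \<Longrightarrow> g b < g a \<Longrightarrow>
      P (g \<circ> affine_transposition n a b) \<Longrightarrow> P g"
  shows "P g"
  using g le
proof (induction "nat (\<Sum>i = 1..int n. (g i - i)\<^sup>2)" arbitrary: g rule: less_induct)
  case less
  show ?case
  proof (cases "f = g")
    case False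
    interpret g: bounded_perm n g by (rule Bound_bounded_perm[OF less.prems(1) n])
    obtain a b where ab: "a < b" "g b < g a"
      and le': "\<And>i j. perm_rank (g \<circ> affine_transposition n a b) i j \<le> perm_rank f i j"
      using ex_descent_between[OF n f less.prems(1) False less.prems(2)] by blast
    let ?h = "g \<circ> affine_transposition n a b"
    have "(\<Sum>i = 1..int n. (?h i - i)\<^sup>2) < (\<Sum>i = 1..int n. (g i - i)\<^sup>2)"
      using sum_squares_affine_transposition[OF n g.inversion_bounds(2)[OF ab] g.bij g.periodic] ab by simp
    moreover have "0 \<le> (\<Sum>i = 1..int n. (?h i - i)\<^sup>2)" by (intro sum_nonneg) simp
    ultimately have "nat (\<Sum>i = 1..int n. (?h i - i)\<^sup>2) < nat (\<Sum>i = 1..int n. (g i - i)\<^sup>2)"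
      by linarith
    then have "P ?h"
      using less.hyps Bound_comp_transposition[OF n less.prems(1) ab] le' by blast
    then show ?thesis using step less.prems(1) ab by blast
  qed (use refl in simp)
qed

section \<open>Comparison with the Bruhat order\<close>

lemma affine_transposition_translate:
  "affine_transposition n a b \<circ> (\<lambda>i. i - k) = (\<lambda>i. i - k) \<circ> affine_transposition n (a + k) (b + k)"
proof -
  have "(x - k) mod int n = a mod int n \<longleftrightarrow> x mod int n = (a + k) mod int n" for x a
    by (simp add: mod_eq_dvd_iff algebra_simps)
  then show ?thesis by (simp add: fun_eq_iff affine_transposition_def)
qed

text \<open>An upward Bruhat step creates an inversion and hence never raises a rank; conversely
  \<open>descent_induct\<close> builds a chain of such steps.\<close>

lemma affine_le_iff_perm_rank:
  assumes n: "0 < n" and f: "f \<in> Bound k n" and g: "g \<in> Bound k n"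
  shows "affine_le n (int k) f g \<longleftrightarrow> (\<forall>i j. perm_rank g i j \<le> perm_rank f i j)"
proof
  let ?W = "affine_perms n 0" and ?S = "affine_generators n"
  let ?R = "{(x, x \<circ> t) | x t. x \<in> ?W \<and> t \<in> reflections ?W ?S \<and> word_length ?S x < word_length ?S (x \<circ> t)}"
  let ?s = "\<lambda>i. i - int k"
  have shift: "h \<circ> ?s \<in> ?W" if "h \<in> Bound k n" for h
    using affine_perms_comp[OF n _ translation_affine_perms[OF n, of "- int k"], of h "int k"] that
    by (simp add: Bound_def)
  {
    assume "affine_le n (int k) f g"
    then have "(f \<circ> ?s, g \<circ> ?s) \<in> ?R\<^sup>*" by (simp add: affine_le_def bruhat_le_def)
    \<comment> \<open>The induction starts at the \<open>g\<close> end and carries boundedness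
      along, since elements below a bounded one are again bounded.\<close>
    then have "f \<circ> ?s \<circ> (\<lambda>i. i + int k) \<in> Bound k n \<and>
      (\<forall>i j. perm_rank g i j \<le> perm_rank (f \<circ> ?s \<circ> (\<lambda>i. i + int k)) i j)"
    proof (induction rule: converse_rtrancl_induct)
      case base
      then show ?case using g by (simp add: comp_def)
    next
      case (step u w)
      define h where "h = w \<circ> (\<lambda>i. i + int k)"
      have h: "h \<in> Bound k n" "\<And>i j. perm_rank g i j \<le> perm_rank h i j"
        using step.IH unfolding h_def by blast+
      interpret h: bounded_perm n h by (rule Bound_bounded_perm[OF h(1) n])
      obtain t where t: "u \<in> ?W" "t \<in> reflections ?W ?S" "word_length ?S u < word_length ?S w" "w = u \<circ> t"
        using step.hyps(1) by blast
      then have n2: "2 \<le> n" by (auto simp: reflections_def affine_generators_def split: if_splits)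
      obtain a b where ab: "a < b" "a mod int n \<noteq> b mod int n" "t = affine_transposition n a b"
        using reflections_transposition[OF n2 t(2)] .
      have "u a < u b"
        using word_length_transposition_iff[OF n2 ab(1,2) t(1)] t(3,4) ab(3) by simp
      \<comment> \<open>Undoing the shift by \<open>k\<close> in the argument moves the inverted
        positions from \<open>a\<close>, \<open>b\<close> to \<open>a - k\<close>,
        \<open>b - k\<close>.\<close>
      then have inv: "a - int k < b - int k" "h (b - int k) < h (a - int k)"
        using ab(1) affine_transposition_swap[OF n ab(2)] by (simp_all add: h_def t(4) ab(3))
      have "u = w \<circ> affine_transposition n a b"
        using t(4) ab(3) affine_transposition_comp[OF n ab(2)] by (simp add: comp_assoc)
      moreover have "w = h \<circ> ?s" by (simp add: h_def comp_def)
      ultimately have eq: "u \<circ> (\<lambda>i. i + int k) = h \<circ> affine_transposition n (a - int k) (b - int k)"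
        using fun_cong[OF affine_transposition_translate[of n "a - int k" "b - int k" "int k"], of "_ + int k"]
        by (simp add: fun_eq_iff)
      have "perm_rank g i j \<le> perm_rank (h \<circ> affine_transposition n (a - int k) (b - int k)) i j" for i j
        unfolding h.perm_rank_transposition[OF inv] using h(2)[of i j] by simp
      then show ?case
        unfolding eq using Bound_comp_transposition[OF n h(1) inv] by blast
    qed
    then show "\<forall>i j. perm_rank g i j \<le> perm_rank f i j" by (simp add: comp_def)
  }
  {
    assume le: "\<forall>i j. perm_rank g i j \<le> perm_rank f i j"
    from n f g le[rule_format] show "affine_le n (int k) f g"
    proof (induction rule: descent_induct)
      case refl
      then show ?case by (simp add: affine_le_def bruhat_le_def)
    next
      case (step g a b)
      interpret g: bounded_perm n g by (rule Bound_bounded_perm[OF step(1) n])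
      note inv = g.inversion_bounds[OF step(2,3)]
      let ?h = "g \<circ> affine_transposition n a b"
      let ?t = "affine_transposition n (a + int k) (b + int k)"
      have n2: "2 \<le> n" using inv step(2) by linarith
      have mod: "(a + int k) mod int n \<noteq> (b + int k) mod int n"
        using inv(2) by (simp add: mod_eq_dvd_iff)
      have h: "?h \<circ> ?s \<in> ?W" by (rule shift[OF Bound_comp_transposition[OF n step(1-3)]])
      have eq: "g \<circ> ?s = ?h \<circ> ?s \<circ> ?t"
        using affine_transposition_translate[of n a b "int k"] affine_transposition_comp[OF n inv(2)]
        by (metis comp_assoc comp_id)
      have "(?h \<circ> ?s) (a + int k) < (?h \<circ> ?s) (b + int k)"
        using step(3) affine_transposition_swap[OF n inv(2)] by simp
      then have "word_length ?S (?h \<circ> ?s) < word_length ?S (?h \<circ> ?s \<circ> ?t)"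
        using word_length_transposition_iff[OF n2 _ mod h] step(2) by simp
      moreover have "?t \<in> reflections ?W ?S"
        using transposition_in_reflections[OF n2] step(2) inv(1) by simp
      ultimately have "(?h \<circ> ?s, g \<circ> ?s) \<in> ?R" unfolding eq using h by blast
      moreover have "(f \<circ> ?s, ?h \<circ> ?s) \<in> ?R\<^sup>*" using step(4) unfolding affine_le_def bruhat_le_def .
      ultimately have "(f \<circ> ?s, g \<circ> ?s) \<in> ?R\<^sup>*" by (rule rtrancl_into_rtrancl[rotated])
      then show ?case by (simp only: affine_le_def bruhat_le_def)
    qed
  }
qed


section \<open>Coordinate projections and Pluecker coordinates\<close>

abbreviation proj_rank :: "(int \<Rightarrow> complex) set \<Rightarrow> int set \<Rightarrow> nat" where
  "proj_rank V S \<equiv> cvec.dim (project S ` V)"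

definition unit_fun :: "int \<Rightarrow> int \<Rightarrow> complex" where
  "unit_fun i = (\<lambda>j. if j = i then 1 else 0)"

lemma sum_apply: "(\<Sum>a\<in>A. f a) x = (\<Sum>a\<in>A. f a x)" for f :: "'a \<Rightarrow> 'b \<Rightarrow> 'c::comm_monoid_add"
  by (induction A rule: infinite_finite_induct) simp_all

lemma Cspace_subset_span: "Cspace n \<subseteq> cvec.span (unit_fun ` {1..int n})"
proof
  fix v assume v: "v \<in> Cspace n"
  have "v = (\<Sum>i = 1..int n. cscale (v i) (unit_fun i))"
  proof
    fix x
    have "(\<Sum>i = 1..int n. v i * unit_fun i x) = (\<Sum>i = 1..int n. if i = x then v i else 0)"
      by (rule sum.cong) (auto simp: unit_fun_def)
    also have "\<dots> = v x" using v by (auto simp: Cspace_def)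
    finally show "v x = (\<Sum>i = 1..int n. cscale (v i) (unit_fun i)) x"
      by (simp add: sum_apply cscale_def)
  qed
  also have "\<dots> \<in> cvec.span (unit_fun ` {1..int n})"
    by (intro cvec.span_sum cvec.span_scale cvec.span_base) auto
  finally show "v \<in> cvec.span (unit_fun ` {1..int n})" .
qed

lemma Cspace_independent_finite:
  assumes "cvec.independent B" "B \<subseteq> Cspace n" shows "finite B"
  using cvec.independent_span_bound[OF _ assms(1), of "unit_fun ` {1..int n}"]
    assms(2) Cspace_subset_span by blast

lemma linear_project: "Vector_Spaces.linear cscale cscale (project S)"
  by unfold_locales (auto simp: project_def cscale_def fun_eq_iff)

lemma Cspace_project: "v \<in> Cspace n \<Longrightarrow> project S v \<in> Cspace n"
  by (simp add: Cspace_def project_def)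

lemma project_project: "project S (project T v) = project (S \<inter> T) v"
  by (auto simp: project_def fun_eq_iff)

text \<open>The projection to \<open>insert x S\<close> maps onto that to \<open>S\<close>. If no
  such \<open>v\<close> exists this map is injective; otherwise the coordinate vector at
  \<open>x\<close> lies in the larger image and splits off a line.\<close>

lemma proj_rank_insert:
  assumes V: "cvec.subspace V" "V \<subseteq> Cspace n"
  shows "proj_rank V (insert x S) =
    proj_rank V S + (if \<exists>v\<in>V. (\<forall>y\<in>S. v y = 0) \<and> v x \<noteq> 0 then 1 else 0)"
proof -
  let ?W' = "project (insert x S) ` V" and ?W = "project S ` V"
  interpret p: Vector_Spaces.linear cscale cscale "project S" by (rule linear_project)
  interpret p': Vector_Spaces.linear cscale cscale "project (insert x S)" by (rule linear_project)
  have sub: "cvec.subspace ?W" "cvec.subspace ?W'"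
    using p.subspace_image p'.subspace_image V(1) by blast+
  have W_Cspace: "?W \<subseteq> Cspace n" "?W' \<subseteq> Cspace n" using Cspace_project V(2) by blast+
  have image: "project S ` ?W' = ?W"
    by (simp add: image_image project_project inf.absorb1 subset_insertI)
  show ?thesis
  proof (cases "\<exists>v\<in>V. (\<forall>y\<in>S. v y = 0) \<and> v x \<noteq> 0")
    case False
    obtain B where B: "B \<subseteq> ?W'" "cvec.independent B" "?W' \<subseteq> cvec.span B" "card B = cvec.dim ?W'"
      using cvec.basis_exists[of ?W'] by blast
    have span: "cvec.span B = ?W'" using cvec.span_subspace B sub by blast
    have inj: "inj_on (project S) (cvec.span B)"
      unfolding span
    proof (rule inj_onI)
      fix u w assume uw: "u \<in> ?W'" "w \<in> ?W'" "project S u = project S w"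
      obtain u0 w0 where 0: "u0 \<in> V" "w0 \<in> V" "u = project (insert x S) u0" "w = project (insert x S) w0"
        using uw by blast
      have "u0 - w0 \<in> V" using cvec.subspace_diff[OF V(1)] 0 by blast
      moreover have "u0 y = w0 y" if "y \<in> S" for y
        using fun_cong[OF uw(3), of y] that by (simp add: 0 project_def)
      ultimately have "u0 x = w0 x" using False by fastforce
      then show "u = w" using \<open>\<And>y. y \<in> S \<Longrightarrow> u0 y = w0 y\<close> by (auto simp: 0 project_def fun_eq_iff)
    qed
    have "cvec.dim ?W = card (project S ` B)"
    proof (rule cvec.dim_unique)
      show "project S ` B \<subseteq> ?W" using image_mono[OF B(1), of "project S"] unfolding image .
      show "?W \<subseteq> cvec.span (project S ` B)" using p.span_image[of B] span image by simp
      show "cvec.independent (project S ` B)"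
        using p.independent_injective_image[OF B(2) inj] .
    qed simp
    also have "\<dots> = cvec.dim ?W'"
      using card_image[OF inj_on_subset[OF inj cvec.span_superset]] B(4) by simp
    finally show ?thesis using False by auto
  next
    case True
    then obtain v where v: "v \<in> V" "\<forall>y\<in>S. v y = 0" "v x \<noteq> 0" by blast
    then have "x \<notin> S" by blast
    let ?e = "unit_fun x"
    have proj: "project (insert x S) u = project S u + cscale (u x) ?e" for u
      using \<open>x \<notin> S\<close> by (auto simp: project_def cscale_def unit_fun_def fun_eq_iff)
    have "?e = project (insert x S) (cscale (1 / v x) v)"
      using v by (auto simp: project_def cscale_def unit_fun_def fun_eq_iff)
    then have e: "?e \<in> ?W'" using cvec.subspace_scale[OF V(1)] v(1) by blast
    obtain B where B: "B \<subseteq> ?W" "cvec.independent B" "?W \<subseteq> cvec.span B" "card B = cvec.dim ?W"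
      using cvec.basis_exists[of ?W] by blast
    have span: "cvec.span B = ?W" using cvec.span_subspace B sub by blast
    have "?e x \<noteq> project S u x" for u
      using \<open>x \<notin> S\<close> by (simp add: project_def unit_fun_def)
    then have "?e \<notin> ?W" by fastforce
    have "finite B" using Cspace_independent_finite[OF B(2)] B(1) W_Cspace(1) by blast
    have "cvec.dim ?W' = card (insert ?e B)"
    proof (rule cvec.dim_unique)
      have "project S u \<in> ?W'" if "u \<in> V" for u
      proof -
        have "project (insert x S) u - cscale (u x) ?e \<in> ?W'"
          using that e by (intro cvec.subspace_diff[OF sub(2)] cvec.subspace_scale[OF sub(2)]) auto
        then show ?thesis by (simp add: proj)
      qed
      then show "insert ?e B \<subseteq> ?W'" using B(1) e by blast
      show "?W' \<subseteq> cvec.span (insert ?e B)"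
      proof
        fix w assume "w \<in> ?W'"
        then obtain u where u: "u \<in> V" "w = project S u + cscale (u x) ?e" by (auto simp: proj)
        have "project S u \<in> cvec.span (insert ?e B)"
          using u(1) B(3) cvec.span_mono[OF subset_insertI[of B ?e]] by blast
        then show "w \<in> cvec.span (insert ?e B)"
          unfolding u(2) using cvec.span_base[of ?e "insert ?e B"]
          by (intro cvec.span_add cvec.span_scale) simp_all
      qed
      show "cvec.independent (insert ?e B)"
        using cvec.independent_insertI[OF _ B(2)] \<open>?e \<notin> ?W\<close> span by simp
    qed simp
    also have "\<dots> = cvec.dim ?W + 1"
      using \<open>?e \<notin> ?W\<close> B(1,4) \<open>finite B\<close> by (subst card_insert_disjoint) auto
    finally show ?thesis using True by auto
  qed
qed

section \<open>Ranks of coordinate sets for a point of the Grassmannian\<close>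

context
  fixes k n :: nat and V :: "(int \<Rightarrow> complex) set"
  assumes V: "V \<in> Gr k n"
begin

lemma Gr_subspace: "cvec.subspace V" and Gr_Cspace: "V \<subseteq> Cspace n" and Gr_dim: "cvec.dim V = k"
  using V by (simp_all add: Gr_def)

lemma Gr_finite_independent: "cvec.independent B \<Longrightarrow> B \<subseteq> V \<Longrightarrow> finite B"
  using Cspace_independent_finite Gr_Cspace by blast

lemmas Gr_proj_rank_insert = proj_rank_insert[OF Gr_subspace Gr_Cspace]

lemma proj_rank_empty: "proj_rank V {} = 0"
proof (rule cvec.dim_unique[of "{}"])
  show "project {} ` V \<subseteq> cvec.span {}" by (auto simp: project_def fun_eq_iff)
qed (use cvec.independent_empty in auto)

lemma proj_rank_full: "proj_rank V {1..int n} = k"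
proof -
  have "project {1..int n} v = v" if "v \<in> V" for v
    using that Gr_Cspace by (auto simp: project_def Cspace_def fun_eq_iff)
  then have "project {1..int n} ` V = V" by force
  then show ?thesis using Gr_dim by simp
qed

lemma proj_rank_Un: "finite F \<Longrightarrow> proj_rank V S \<le> proj_rank V (S \<union> F) \<and> proj_rank V (S \<union> F) \<le> proj_rank V S + card F"
proof (induction F rule: finite_induct)
  case (insert x F)
  then show ?case using Gr_proj_rank_insert[of x "S \<union> F"] by simp
qed simp

lemma proj_rank_mono: "S \<subseteq> T \<Longrightarrow> finite T \<Longrightarrow> proj_rank V S \<le> proj_rank V T"
  using proj_rank_Un[of T S] by (simp add: Un_absorb1)

text \<open>A nonzero vector vanishing on \<open>I\<close> would let a further coordinate raise the
  rank to \<open>k + 1\<close>; without one, no coordinate raises the rank, which is then that of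
  all of \<open>[n]\<close>.\<close>

lemma proj_rank_eq_iff:
  assumes I: "I \<subseteq> {1..int n}"
  shows "proj_rank V I = k \<longleftrightarrow> (\<forall>v\<in>V. (\<forall>y\<in>I. v y = 0) \<longrightarrow> v = 0)"
proof
  assume k: "proj_rank V I = k"
  show "\<forall>v\<in>V. (\<forall>y\<in>I. v y = 0) \<longrightarrow> v = 0"
  proof (intro ballI impI ext, rule ccontr)
    fix v x assume v: "v \<in> V" "\<forall>y\<in>I. v y = 0" "v x \<noteq> 0 x"
    then have "x \<in> {1..int n}" using Gr_Cspace by (auto simp: Cspace_def)
    then have "proj_rank V (insert x I) \<le> k"
      using proj_rank_mono[of "insert x I" "{1..int n}"] I proj_rank_full by simp
    moreover have "proj_rank V (insert x I) = k + 1"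
      using v Gr_proj_rank_insert[of x I] k by auto
    ultimately show False by simp
  qed
next
  assume *: "\<forall>v\<in>V. (\<forall>y\<in>I. v y = 0) \<longrightarrow> v = 0"
  have "proj_rank V (I \<union> F) = proj_rank V I" if "finite F" for F
    using that
  proof (induction F rule: finite_induct)
    case (insert x F)
    have "\<not> (\<exists>v\<in>V. (\<forall>y\<in>I \<union> F. v y = 0) \<and> v x \<noteq> 0)" using * by force
    then show ?case using insert Gr_proj_rank_insert[of x "I \<union> F"] by simp
  qed simp
  from this[of "{1..int n}"] show "proj_rank V I = k"
    using I proj_rank_full by (simp add: Un_absorb1)
qed

text \<open>Basis extension in the matroid of \<open>V\<close>, whose independent sets are those
  with \<open>card\<close> equal to \<open>proj_rank\<close>: coordinates are added greedily
  whenever they raise the rank.\<close>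

lemma ex_proj_rank_extension:
  assumes "finite F" "card T = proj_rank V T" "finite T"
  shows "\<exists>I. T \<subseteq> I \<and> I \<subseteq> T \<union> F \<and> card I = proj_rank V I \<and> proj_rank V I = proj_rank V (T \<union> F)"
  using assms(1)
proof (induction F rule: finite_induct)
  case empty
  then show ?case using assms(2) by auto
next
  case (insert x F)
  then obtain I where I: "T \<subseteq> I" "I \<subseteq> T \<union> F" "card I = proj_rank V I" "proj_rank V I = proj_rank V (T \<union> F)"
    by blast
  have fin: "finite I" using I(2) insert.hyps assms(3) finite_subset by blast
  show ?case
  proof (cases "\<exists>v\<in>V. (\<forall>y\<in>T \<union> F. v y = 0) \<and> v x \<noteq> 0")
    case True
    then have ex: "\<exists>v\<in>V. (\<forall>y\<in>I. v y = 0) \<and> v x \<noteq> 0" using I(2) by blast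
    then have "x \<notin> I" by blast
    then show ?thesis
      using Gr_proj_rank_insert[of x I] Gr_proj_rank_insert[of x "T \<union> F"] ex True I fin
      by (intro exI[of _ "insert x I"]) auto
  next
    case False
    then show ?thesis
      using I Gr_proj_rank_insert[of x "T \<union> F"] by (intro exI[of _ I]) auto
  qed
qed

end

section \<open>Bases and Pluecker coordinates\<close>

lemma is_basis_iff:
  assumes "is_basis k B V"
  shows "v \<in> V \<longleftrightarrow> (\<exists>u. v = (\<Sum>a<k. cscale (u a) (B a)))"
    and "(\<Sum>a<k. cscale (u a) (B a)) = 0 \<Longrightarrow> a < k \<Longrightarrow> u a = 0"
proof -
  note B = assms[unfolded is_basis_def]
  have inj: "inj_on B {..<k}" using B by blast
  have sum: "(\<Sum>b\<in>B ` {..<k}. cscale (w b) b) = (\<Sum>a<k. cscale (w (B a)) (B a))" for w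
    using sum.reindex[OF inj] by simp
  have "v \<in> V \<longleftrightarrow> (\<exists>w. v = (\<Sum>b\<in>B ` {..<k}. cscale (w b) b))"
    using B cvec.span_finite[of "B ` {..<k}"] by (auto simp: image_iff)
  also have "\<dots> \<longleftrightarrow> (\<exists>u. v = (\<Sum>a<k. cscale (u a) (B a)))"
  proof
    assume "\<exists>u. v = (\<Sum>a<k. cscale (u a) (B a))"
    then obtain u where "v = (\<Sum>a<k. cscale (u a) (B a))" by blast
    also have "\<dots> = (\<Sum>a<k. cscale (u (the_inv_into {..<k} B (B a))) (B a))"
      by (rule sum.cong) (simp_all add: the_inv_into_f_f[OF inj])
    also have "\<dots> = (\<Sum>b\<in>B ` {..<k}. cscale (u (the_inv_into {..<k} B b)) b)"
      using sum[of "\<lambda>b. u (the_inv_into {..<k} B b)"] by simp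
    finally show "\<exists>w. v = (\<Sum>b\<in>B ` {..<k}. cscale (w b) b)"
      by (intro exI[of _ "\<lambda>b. u (the_inv_into {..<k} B b)"])
  qed (auto simp: sum)
  finally show "v \<in> V \<longleftrightarrow> (\<exists>u. v = (\<Sum>a<k. cscale (u a) (B a)))" .
  assume 0: "(\<Sum>a<k. cscale (u a) (B a)) = 0" and a: "a < k"
  have "(\<Sum>a<k. cscale (u (the_inv_into {..<k} B (B a))) (B a)) = (\<Sum>a<k. cscale (u a) (B a))"
    by (rule sum.cong) (simp_all add: the_inv_into_f_f[OF inj])
  then have "(\<Sum>b\<in>B ` {..<k}. cscale (u (the_inv_into {..<k} B b)) b) = 0"
    using sum[of "\<lambda>b. u (the_inv_into {..<k} B b)"] 0 by simp
  then have "u (the_inv_into {..<k} B (B a)) = 0"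
    using cvec.independentD[of "B ` {..<k}" "B ` {..<k}" "\<lambda>b. u (the_inv_into {..<k} B b)" "B a"] B a
    by blast
  then show "u a = 0" using a by (simp add: the_inv_into_f_f[OF inj])
qed

text \<open>A vanishing minor gives a kernel vector of the transposed matrix; its entries are the
  coefficients of a vector of \<open>V\<close> vanishing on \<open>I\<close>, nonzero because
  \<open>B\<close> is a basis.\<close>

lemma plucker_eq_0_iff:
  assumes B: "is_basis k B V" and I: "finite I" "card I = k"
  shows "plucker k B I = 0 \<longleftrightarrow> (\<exists>v\<in>V. v \<noteq> 0 \<and> (\<forall>y\<in>I. v y = 0))"
proof -
  let ?s = "sorted_list_of_set I"
  let ?A = "mat k k (\<lambda>(a, b). B a (?s ! b))"
  have s: "length ?s = k" "set ?s = I" using I by simp_all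
  have entry: "(transpose_mat ?A *\<^sub>v u) $ b = (\<Sum>a<k. cscale (u $ a) (B a)) (?s ! b)"
    if "u \<in> carrier_vec k" "b < k" for u b
    using that by (auto simp: scalar_prod_def sum_apply cscale_def lessThan_atLeast0 mult.commute intro!: sum.cong)
  have zero_iff: "transpose_mat ?A *\<^sub>v u = 0\<^sub>v k \<longleftrightarrow> (\<forall>y\<in>I. (\<Sum>a<k. cscale (u $ a) (B a)) y = 0)"
    if "u \<in> carrier_vec k" for u
  proof -
    have "transpose_mat ?A *\<^sub>v u = 0\<^sub>v k \<longleftrightarrow> (\<forall>b<k. (\<Sum>a<k. cscale (u $ a) (B a)) (?s ! b) = 0)"
      using entry[OF that] by (auto simp: vec_eq_iff)
    also have "\<dots> \<longleftrightarrow> (\<forall>y\<in>set ?s. (\<Sum>a<k. cscale (u $ a) (B a)) y = 0)"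
      by (simp only: all_set_conv_all_nth s(1))
    finally show ?thesis using s(2) by simp
  qed
  have "plucker k B I = 0 \<longleftrightarrow> det (transpose_mat ?A) = 0"
    by (simp add: plucker_def det_transpose[of ?A k])
  also have "\<dots> \<longleftrightarrow> (\<exists>u. u \<in> carrier_vec k \<and> u \<noteq> 0\<^sub>v k \<and> transpose_mat ?A *\<^sub>v u = 0\<^sub>v k)"
    by (rule det_0_iff_vec_prod_zero_field) simp
  also have "\<dots> \<longleftrightarrow> (\<exists>v\<in>V. v \<noteq> 0 \<and> (\<forall>y\<in>I. v y = 0))"
  proof
    assume "\<exists>u. u \<in> carrier_vec k \<and> u \<noteq> 0\<^sub>v k \<and> transpose_mat ?A *\<^sub>v u = 0\<^sub>v k"
    then obtain u where u: "u \<in> carrier_vec k" "u \<noteq> 0\<^sub>v k" "transpose_mat ?A *\<^sub>v u = 0\<^sub>v k" by blast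
    then obtain a where "a < k" "u $ a \<noteq> 0" by (auto simp: vec_eq_iff)
    then have "(\<Sum>a<k. cscale (u $ a) (B a)) \<noteq> 0"
      using is_basis_iff(2)[OF B, of "\<lambda>a. u $ a"] by blast
    then show "\<exists>v\<in>V. v \<noteq> 0 \<and> (\<forall>y\<in>I. v y = 0)"
      using zero_iff[OF u(1)] u(3) is_basis_iff(1)[OF B] by blast
  next
    assume "\<exists>v\<in>V. v \<noteq> 0 \<and> (\<forall>y\<in>I. v y = 0)"
    then obtain v where v: "v \<in> V" "v \<noteq> 0" "\<forall>y\<in>I. v y = 0" by blast
    obtain w where "v = (\<Sum>a<k. cscale (w a) (B a))"
      using is_basis_iff(1)[OF B] v(1) by blast
    with v have w: "(\<Sum>a<k. cscale (w a) (B a)) \<noteq> 0" "\<forall>y\<in>I. (\<Sum>a<k. cscale (w a) (B a)) y = 0"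
      by simp_all
    have eq: "(\<Sum>a<k. cscale (vec k w $ a) (B a)) = (\<Sum>a<k. cscale (w a) (B a))"
      by (rule sum.cong) simp_all
    have "vec k w \<noteq> 0\<^sub>v k"
    proof
      assume 0: "vec k w = 0\<^sub>v k"
      have "w a = 0" if "a < k" for a using arg_cong[OF 0, of "\<lambda>u. u $ a"] that by simp
      then have "(\<Sum>a<k. cscale (w a) (B a)) = 0" by (intro sum.neutral) simp
      then show False using w(1) by blast
    qed
    then show "\<exists>u. u \<in> carrier_vec k \<and> u \<noteq> 0\<^sub>v k \<and> transpose_mat ?A *\<^sub>v u = 0\<^sub>v k"
      using w(2) zero_iff[of "vec k w"] eq by (intro exI[of _ "vec k w"]) simp
  qed
  finally show ?thesis .
qed

lemma ex_is_basis:
  assumes "V \<in> Gr k n" obtains B where "is_basis k B V"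
proof -
  obtain A where A: "A \<subseteq> V" "cvec.independent A" "V \<subseteq> cvec.span A" "card A = cvec.dim V"
    using cvec.basis_exists[of V] by blast
  then have "cvec.span A = V" using cvec.span_subspace Gr_subspace[OF assms] by blast
  moreover have "finite A" using Gr_finite_independent[OF assms A(2,1)] .
  moreover obtain h where "bij_betw h {0..<card A} A" using ex_bij_betw_nat_finite \<open>finite A\<close> by blast
  moreover have "card A = k" using A(4) Gr_dim[OF assms] by simp
  ultimately have "is_basis k h V"
    using A(2) by (auto simp: is_basis_def bij_betw_def lessThan_atLeast0)
  then show ?thesis by (rule that)
qed

text \<open>Nonvanishing Pluecker coordinates mark the bases of the matroid of \<open>V\<close>, and
  the rank of \<open>S\<close> is the largest size of the intersection of \<open>S\<close> with a
  basis.\<close>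

lemma proj_rank_le_iff_plucker:
  assumes V: "V \<in> Gr k n" and S: "S \<subseteq> {1..int n}"
  shows "proj_rank V S \<le> m \<longleftrightarrow>
    (\<forall>I\<in>plucker_index k n. m < card (I \<inter> S) \<longrightarrow> (\<forall>B. is_basis k B V \<longrightarrow> plucker k B I = 0))"
proof -
  have iff: "plucker k B I = 0 \<longleftrightarrow> proj_rank V I \<noteq> k" if "I \<in> plucker_index k n" "is_basis k B V" for I B
    using that plucker_eq_0_iff[OF that(2), of I] proj_rank_eq_iff[OF V, of I]
    by (auto simp: plucker_index_def finite_subset[of I "{1..int n}"])
  show ?thesis
  proof
    assume le: "proj_rank V S \<le> m"
    show "\<forall>I\<in>plucker_index k n. m < card (I \<inter> S) \<longrightarrow> (\<forall>B. is_basis k B V \<longrightarrow> plucker k B I = 0)"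
    proof (intro ballI allI impI)
      fix I B assume I: "I \<in> plucker_index k n" and gt: "m < card (I \<inter> S)" and B: "is_basis k B V"
      have fin: "finite I" using I finite_subset[of I "{1..int n}"] by (auto simp: plucker_index_def)
      have "proj_rank V I \<le> proj_rank V (I \<inter> S) + card (I - S)"
        using proj_rank_Un[OF V, of "I - S" "I \<inter> S"] fin by (simp add: Int_Diff_Un)
      also have "proj_rank V (I \<inter> S) \<le> m"
        using proj_rank_mono[OF V, of "I \<inter> S" S] S le finite_subset[of S "{1..int n}"] by simp
      finally have "proj_rank V I < card (I \<inter> S) + card (I - S)" using gt by simp
      also have "\<dots> = k"
        using I fin card_Int_Diff[of I S] by (simp add: plucker_index_def)
      finally show "plucker k B I = 0" using iff[OF I B] by simp
    qed
  next
    assume *: "\<forall>I\<in>plucker_index k n. m < card (I \<inter> S) \<longrightarrow> (\<forall>B. is_basis k B V \<longrightarrow> plucker k B I = 0)"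
    show "proj_rank V S \<le> m"
    proof (rule ccontr)
      assume gt: "\<not> proj_rank V S \<le> m"
      have finS: "finite S" using S finite_subset[of S "{1..int n}"] by simp
      \<comment> \<open>A basis \<open>T\<close> of \<open>S\<close>, extended to a basis
        \<open>I\<close> of the whole matroid, violates the equations.\<close>
      obtain T where T: "T \<subseteq> S" "card T = proj_rank V T" "proj_rank V T = proj_rank V S"
        using ex_proj_rank_extension[OF V finS, of "{}"] proj_rank_empty[OF V] by auto
      have "finite T" using T(1) finS finite_subset by blast
      then obtain I where I: "T \<subseteq> I" "I \<subseteq> T \<union> {1..int n}" "card I = proj_rank V I"
        "proj_rank V I = proj_rank V (T \<union> {1..int n})"
        using ex_proj_rank_extension[OF V, of "{1..int n}" T] T by auto
      have Tn: "T \<union> {1..int n} = {1..int n}" using T(1) S by blast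
      have "I \<in> plucker_index k n" and "proj_rank V I = k"
        using I Tn proj_rank_full[OF V] by (simp_all add: plucker_index_def)
      moreover have "card T \<le> card (I \<inter> S)"
        using I(1,2) T(1) finS by (intro card_mono) auto
      ultimately show False
        using * iff ex_is_basis[OF V] T(2,3) gt by (metis not_le less_le_trans)
    qed
  qed
qed

lemma zariski_closed_proj_rank:
  assumes S: "\<And>S m. (S, m) \<in> C \<Longrightarrow> S \<subseteq> {1..int n}"
  shows "zariski_closed k n {V \<in> Gr k n. \<forall>(S, m)\<in>C. proj_rank V S \<le> m}"
proof -
  let ?P = "(\<lambda>I x. x I) ` {I \<in> plucker_index k n. \<exists>(S, m)\<in>C. m < card (I \<inter> S)}"
  have "(\<forall>p\<in>?P. \<forall>B. is_basis k B V \<longrightarrow> p (plucker k B) = 0) \<longleftrightarrow> (\<forall>(S, m)\<in>C. proj_rank V S \<le> m)"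
    if "V \<in> Gr k n" for V
  proof -
    have "(\<forall>p\<in>?P. \<forall>B. is_basis k B V \<longrightarrow> p (plucker k B) = 0) \<longleftrightarrow>
      (\<forall>I\<in>plucker_index k n. (\<exists>(S, m)\<in>C. m < card (I \<inter> S)) \<longrightarrow> (\<forall>B. is_basis k B V \<longrightarrow> plucker k B I = 0))"
      by (unfold ball_simps) auto
    also have "\<dots> \<longleftrightarrow>
      (\<forall>(S, m)\<in>C. \<forall>I\<in>plucker_index k n. m < card (I \<inter> S) \<longrightarrow> (\<forall>B. is_basis k B V \<longrightarrow> plucker k B I = 0))"
      by fast
    also have "\<dots> \<longleftrightarrow> (\<forall>(S, m)\<in>C. proj_rank V S \<le> m)"
      by (rule ball_cong) (use proj_rank_le_iff_plucker[OF that S] in auto)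
    finally show ?thesis .
  qed
  moreover have "\<forall>p\<in>?P. \<exists>d. homog_poly (plucker_index k n) d p"
    by (auto intro!: exI[of _ 1] homog_poly.var)
  ultimately show ?thesis
    unfolding zariski_closed_def by (intro exI[of _ ?P]) auto
qed

section \<open>Cyclic intervals and the permutation attached to V\<close>

lemma cyclic_interval_eq: "0 < n \<Longrightarrow> cyclic_interval n i j = cyc n ` {i..j}"
proof -
  assume n: "0 < n"
  show ?thesis
  proof (intro equalityI subsetI)
    fix m assume "m \<in> cyclic_interval n i j"
    then obtain l where "m \<in> {1..int n}" "l \<in> {i..j}" "l mod int n = m mod int n"
      by (auto simp: cyclic_interval_def)
    then show "m \<in> cyc n ` {i..j}" using cyc_eq_iff[of n m l] cyc_id[of m n] by auto
  next
    fix m assume "m \<in> cyc n ` {i..j}"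
    then show "m \<in> cyclic_interval n i j"
      using cyc_in[OF n] cyc_mod[of n] unfolding cyclic_interval_def by fastforce
  qed
qed

lemma cyc_interval_full:
  assumes n: "0 < n" and "i + int n - 1 \<le> j"
  shows "cyc n ` {i..j} = {1..int n}"
proof (intro equalityI subsetI)
  fix m assume m: "m \<in> {1..int n}"
  let ?l = "i + (m - i) mod int n"
  have "?l \<in> {i..j}"
    using pos_mod_bound[of "int n" "m - i"] pos_mod_sign[of "int n" "m - i"] assms
    unfolding atLeastAtMost_iff by linarith
  moreover have "cyc n ?l = m"
    using cyc_eq_iff[of n ?l m] cyc_id[OF m] by (simp add: mod_simps)
  ultimately show "m \<in> cyc n ` {i..j}" by (metis imageI)
qed (use cyc_in[OF n] in auto)

context
  fixes k n :: nat and V :: "(int \<Rightarrow> complex) set"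
  assumes n: "0 < n" and V: "V \<in> Gr k n"
begin

lemma interval_rank_eq: "i \<le> j + 1 \<Longrightarrow> interval_rank n V i j = int (proj_rank V (cyc n ` {i..j}))"
  using proj_rank_empty[OF V] by (cases "i = j + 1") (simp_all add: interval_rank_def cyclic_interval_eq[OF n])

text \<open>The clause \<open>j < i\<close> reflects the convention for empty intervals, along which
  every step adds 1.\<close>

lemma interval_rank_left:
  "interval_rank n V i j = interval_rank n V (i + 1) j +
    (if j < i \<or> (\<exists>v\<in>V. (\<forall>l\<in>{i + 1..j}. v (cyc n l) = 0) \<and> v (cyc n i) \<noteq> 0) then 1 else 0)"
proof (cases "j < i")
  case False
  then have "{i..j} = insert i {i + 1..j}" by auto
  then show ?thesis
    using False interval_rank_eq Gr_proj_rank_insert[OF V, of "cyc n i" "cyc n ` {i + 1..j}"] by auto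
qed (simp add: interval_rank_def)

lemma interval_rank_right:
  "interval_rank n V i j = interval_rank n V i (j - 1) +
    (if j < i \<or> (\<exists>v\<in>V. (\<forall>l\<in>{i..j - 1}. v (cyc n l) = 0) \<and> v (cyc n j) \<noteq> 0) then 1 else 0)"
proof (cases "j < i")
  case False
  then have "{i..j} = insert j {i..j - 1}" by auto
  then show ?thesis
    using False interval_rank_eq Gr_proj_rank_insert[OF V, of "cyc n j" "cyc n ` {i..j - 1}"] by auto
qed (simp add: interval_rank_def)

lemma interval_rank_long: "i + int n - 1 \<le> j \<Longrightarrow> interval_rank n V i j = int k"
  using n interval_rank_eq[of i j] cyc_interval_full[OF n] proj_rank_full[OF V] by simp

lemma interval_rank_periodic: "interval_rank n V (i + int n) (j + int n) = interval_rank n V i j"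
proof -
  have "cyclic_interval n (i + int n) (j + int n) = cyclic_interval n i j"
  proof -
    have "cyc n (l + int n) = cyc n l" for l by (simp add: cyc_eq_iff)
    moreover have "{i + int n..j + int n} = (\<lambda>l. l + int n) ` {i..j}" by simp
    ultimately show ?thesis by (simp only: cyclic_interval_eq[OF n] image_image)
  qed
  then show ?thesis by (simp add: interval_rank_def)
qed

text \<open>\<open>interval_rank\<close> satisfies the axioms of \<open>ex_Bound_perm_rank\<close>;
  submodularity holds because a vector that vanishes on an interval vanishes on a shorter
  one.\<close>

lemma ex_Bound_interval_rank: "\<exists>f\<in>Bound k n. \<forall>i j. perm_rank f i j = interval_rank n V i j"
proof (rule ex_Bound_perm_rank[OF n])
  show "interval_rank n V i j = j - i + 1" if "j < i" for i j
    using that by (simp add: interval_rank_def)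
  show "interval_rank n V i j + interval_rank n V (i + 1) (j - 1)
    \<le> interval_rank n V (i + 1) j + interval_rank n V i (j - 1)" for i j
  proof -
    let ?P = "\<lambda>j. \<exists>v\<in>V. (\<forall>l\<in>{i + 1..j}. v (cyc n l) = 0) \<and> v (cyc n i) \<noteq> 0"
    have "{i + 1..j - 1} \<subseteq> {i + 1..j}" by simp
    then have "?P (j - 1)" if "?P j" using that by (meson subsetD)
    then show ?thesis using interval_rank_left[of i j] interval_rank_left[of i "j - 1"] by simp
  qed
  show "interval_rank n V i j = interval_rank n V (i + 1) j \<or>
    interval_rank n V i j = interval_rank n V (i + 1) j + 1" for i j
    using interval_rank_left[of i j] by presburger
  show "interval_rank n V i j = interval_rank n V i (j - 1) \<or>
    interval_rank n V i j = interval_rank n V i (j - 1) + 1" for i j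
    using interval_rank_right[of i j] by presburger
qed (rule interval_rank_long interval_rank_periodic, assumption?)+

text \<open>The permutation attached to \<open>V\<close> is recovered from its ranks by the same dot
  criterion that defines the stratum of \<open>f\<close>, so lying in the stratum means that the two
  permutations coincide.\<close>

lemma open_positroid_iff:
  assumes f: "f \<in> Bound k n"
  shows "V \<in> open_positroid k n f \<longleftrightarrow> (\<forall>i j. interval_rank n V i j = perm_rank f i j)"
proof
  obtain g where g: "g \<in> Bound k n" "\<And>i j. perm_rank g i j = interval_rank n V i j"
    using ex_Bound_interval_rank by blast
  assume "V \<in> open_positroid k n f"
  then have "f i = j \<longleftrightarrow> g i = j" for i j
    using bounded_perm.eq_iff_perm_rank[OF Bound_bounded_perm[OF g(1) n], of i j]
    by (simp add: open_positroid_def g(2))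
  then have "f = g" by blast
  then show "\<forall>i j. interval_rank n V i j = perm_rank f i j" using g(2) by simp
next
  assume "\<forall>i j. interval_rank n V i j = perm_rank f i j"
  then show "V \<in> open_positroid k n f"
    using bounded_perm.eq_iff_perm_rank[OF Bound_bounded_perm[OF f n]] V by (simp add: open_positroid_def)
qed

text \<open>Column differences of the rank at row \<open>p + 1\<close> tell whether the preimage of
  \<open>y\<close> is at most \<open>p\<close>. This expresses the stratum through leading
  coordinates of vectors of \<open>V\<close>, the form used for degenerations.\<close>

lemma open_positroid_inverse_le_iff:
  assumes f: "f \<in> Bound k n" and "V \<in> open_positroid k n f"
  shows "inv_into UNIV f y \<le> p \<longleftrightarrow>
    y \<le> p \<or> (\<exists>v\<in>V. (\<forall>l\<in>{p + 1..y - 1}. v (cyc n l) = 0) \<and> v (cyc n y) \<noteq> 0)"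
  using interval_rank_right[of "p + 1" y] open_positroid_iff[OF f] assms(2)
    bounded_perm.perm_rank_right[OF Bound_bounded_perm[OF f n], of "p + 1" y]
  by (auto split: if_splits)

end


section \<open>Degeneration to higher strata\<close>

text \<open>Row \<open>x\<close> involves only the unknowns \<open>q j\<close> with
  \<open>j \<ge> x\<close>, so back substitution applies and \<open>q c\<close> is found
  last.\<close>

lemma triangular_solvable:
  fixes S :: "int \<Rightarrow> int \<Rightarrow> complex"
  assumes "\<And>x. x \<in> {c..e} \<Longrightarrow> S x x \<noteq> 0"
    and "\<And>x j. x \<in> {c..e} \<Longrightarrow> j \<in> {c..<x} \<Longrightarrow> S x j = 0"
  shows "\<exists>q. \<forall>x\<in>{c..e}. (\<Sum>j = c..e. q j * S x j) = r x"
  using assms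
proof (induction "nat (e + 1 - c)" arbitrary: c)
  case 0
  then show ?case by simp
next
  case (Suc m)
  then have ce: "c \<le> e" by simp
  obtain q where q: "\<forall>x\<in>{c + 1..e}. (\<Sum>j = c + 1..e. q j * S x j) = r x"
    using Suc.hyps(1)[of "c + 1"] Suc.hyps(2) Suc.prems by force
  define q' where "q' = q(c := (r c - (\<Sum>j = c + 1..e. q j * S c j)) / S c c)"
  have split: "{c..e} = insert c {c + 1..e}" using ce by auto
  have "(\<Sum>j = c..e. q' j * S x j) = q' c * S x c + (\<Sum>j = c + 1..e. q j * S x j)" for x
  proof -
    have "(\<Sum>j = c + 1..e. q' j * S x j) = (\<Sum>j = c + 1..e. q j * S x j)"
      by (rule sum.cong) (auto simp: q'_def)
    then show ?thesis by (simp add: split)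
  qed
  moreover have "S x c = 0" if "x \<in> {c + 1..e}" for x using Suc.prems(2)[of x c] that by simp
  moreover have "S c c \<noteq> 0" using Suc.prems(1) ce by simp
  ultimately have "\<forall>x\<in>{c..e}. (\<Sum>j = c..e. q' j * S x j) = r x"
    using q by (auto simp: split q'_def)
  then show ?case by blast
qed

text \<open>
  The matrix \<open>1 + t P q\<^sup>T\<close> is the product of a lower unitriangular matrix, the one applied to \<open>z\<close>
  on the right, and the upper triangular matrix sending \<open>v\<close> to \<open>z\<close>.
\<close>

lemma rank_one_LU:
  fixes P q v z D :: "int \<Rightarrow> complex"
  assumes D: "\<And>i. D i = 1 + t * (\<Sum>j = c..i. P j * q j)"
    and z: "\<And>i. i \<in> {c..e} \<Longrightarrow> z i = v i + t * P i / D (i - 1) * (\<Sum>j = i..e. q j * v j)"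
    and nz: "\<And>i. i \<in> {c - 1..e} \<Longrightarrow> D i \<noteq> 0"
    and i: "i \<in> {c..e}"
  shows "v i + t * P i * (\<Sum>j = c..e. q j * v j) = z i + t * P i * (\<Sum>j = c..i - 1. q j * z j / D j)"
proof -
  let ?Q = "\<lambda>i. \<Sum>j = i..e. q j * v j"
  \<comment> \<open>\<open>D i\<close> is the leading principal minor of
    \<open>1 + t P q\<^sup>T\<close> up to \<open>i\<close>. It increases by
    \<open>t * P i * q i\<close>, which makes the strictly lower part telescope.\<close>
  have partial: "(\<Sum>j = c..i - 1. q j * z j / D j) = ?Q c - ?Q i / D (i - 1)" if "c \<le> i" "i \<le> e" for i
    using that
  proof (induction rule: int_ge_induct)
    case base
    then show ?case by (simp add: D)
  next
    case (step i)
    have "{c..i} = insert i {c..i - 1}" using step by auto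
    then have sum: "(\<Sum>j = c..i. q j * z j / D j) = q i * z i / D i + (?Q c - ?Q i / D (i - 1))"
      using step by simp
    have D_step: "D i = D (i - 1) + t * P i * q i"
      using \<open>{c..i} = insert i {c..i - 1}\<close> by (simp add: D distrib_left)
    have "{i..e} = insert i {i + 1..e}" using step by auto
    then have Q_step: "?Q i = q i * v i + ?Q (i + 1)" by simp
    have nz': "D i \<noteq> 0" "D (i - 1) \<noteq> 0" using nz step by simp_all
    have zi: "z i = v i + t * P i / D (i - 1) * ?Q i" using z step by simp
    have "q i * z i / D i + (?Q c - ?Q i / D (i - 1))
      = ?Q c + (q i * v i * D (i - 1) + t * P i * q i * ?Q i - ?Q i * D i) / (D i * D (i - 1))"
      unfolding zi using nz' by (simp add: field_simps)
    also have "q i * v i * D (i - 1) + t * P i * q i * ?Q i - ?Q i * D i = - ?Q (i + 1) * D (i - 1)"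
      unfolding D_step Q_step by (simp add: algebra_simps)
    also have "?Q c + - ?Q (i + 1) * D (i - 1) / (D i * D (i - 1)) = ?Q c - ?Q (i + 1) / D i"
      using nz' by simp
    finally show ?case using sum by simp
  qed
  have "c \<le> i" "i \<le> e" using i by simp_all
  then show ?thesis
    unfolding partial[OF \<open>c \<le> i\<close> \<open>i \<le> e\<close>] z[OF i] by (simp add: algebra_simps)
qed

text \<open>The upper triangular factor of \<open>1 + t P q\<^sup>T\<close> for the coordinates in
  cyclic order from \<open>c\<close>: \<open>i\<close> is the place of \<open>y\<close> in the
  window, the denominator the preceding principal minor. The value 0 outside \<open>[n]\<close>
  keeps the image in \<open>Cspace n\<close>.\<close>

definition window_shear ::
  "nat \<Rightarrow> int \<Rightarrow> complex \<Rightarrow> (int \<Rightarrow> complex) \<Rightarrow> (int \<Rightarrow> complex) \<Rightarrow> (int \<Rightarrow> complex) \<Rightarrow> int \<Rightarrow> complex" where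
  "window_shear n c t P q v = (\<lambda>y. if y \<in> {1..int n} then
     let i = c + (y - c) mod int n
     in v y + t * P i / (1 + t * (\<Sum>j = c..i - 1. P j * q j)) * (\<Sum>j = i..c + int n - 1. q j * v (cyc n j))
     else 0)"

lemma cyc_window_inj: "x \<in> {c..c + int n - 1} \<Longrightarrow> y \<in> {c..c + int n - 1} \<Longrightarrow> cyc n x = cyc n y \<Longrightarrow> x = y"
proof -
  assume xy: "x \<in> {c..c + int n - 1}" "y \<in> {c..c + int n - 1}" "cyc n x = cyc n y"
  then have "(x - c) mod int n = (y - c) mod int n" by (metis cyc_eq_iff mod_diff_left_eq)
  moreover have "(x - c) mod int n = x - c" "(y - c) mod int n = y - c"
    using xy by (simp_all add: mod_pos_pos_trivial)
  ultimately show "x = y" by simp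
qed

lemma window_position:
  assumes "x \<in> {c..c + int n - 1}" shows "c + (cyc n x - c) mod int n = x"
proof -
  have "(cyc n x - c) mod int n = (x - c) mod int n" by (metis cyc_mod mod_diff_left_eq)
  then show ?thesis using assms by (simp add: mod_pos_pos_trivial)
qed

lemma window_position_in:
  assumes "0 < n" "y \<in> {1..int n}"
  shows "c + (y - c) mod int n \<in> {c..c + int n - 1}" "cyc n (c + (y - c) mod int n) = y"
  using pos_mod_bound[of "int n" "y - c"] pos_mod_sign[of "int n" "y - c"] assms
    cyc_eq_iff[of n "c + (y - c) mod int n" y] cyc_id[of y n] by (auto simp: mod_simps)

lemma Cspace_eqI:
  assumes "0 < n" "u \<in> Cspace n" "v \<in> Cspace n"
    and "\<And>l. l \<in> {c..c + int n - 1} \<Longrightarrow> u (cyc n l) = v (cyc n l)"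
  shows "u = v"
proof
  fix y
  show "u y = v y"
    using assms(2,3) assms(4)[OF window_position_in(1)[OF assms(1)], of y] window_position_in(2)[OF assms(1)]
    by (cases "y \<in> {1..int n}") (auto simp: Cspace_def)
qed

section \<open>The triangular factor in window coordinates\<close>

context
  fixes n :: nat and c :: int
  assumes n: "0 < n"
begin

lemma window_shear_cyc:
  assumes "i \<in> {c..c + int n - 1}"
  shows "window_shear n c t P q v (cyc n i) = v (cyc n i) +
    t * P i / (1 + t * (\<Sum>j = c..i - 1. P j * q j)) * (\<Sum>j = i..c + int n - 1. q j * v (cyc n j))"
  using cyc_in[OF n, of i] unfolding window_shear_def window_position[OF assms] Let_def by simp

lemma window_shear_Cspace: "window_shear n c t P q v \<in> Cspace n"
  by (simp add: window_shear_def Cspace_def)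

lemma window_shear_linear: "Vector_Spaces.linear cscale cscale (window_shear n c t P q)"
  by unfold_locales
    (auto simp: window_shear_def cscale_def fun_eq_iff Let_def sum.distrib sum_distrib_left algebra_simps)

text \<open>Upper triangularity: only coordinates from \<open>i\<close> on enter coordinate
  \<open>i\<close> of the image.\<close>

lemma window_shear_cong:
  assumes "i \<in> {c..c + int n - 1}" "\<And>l. l \<in> {i..c + int n - 1} \<Longrightarrow> u (cyc n l) = v (cyc n l)"
  shows "window_shear n c t P q u (cyc n i) = window_shear n c t P q v (cyc n i)"
  using assms by (simp add: window_shear_cyc)

lemma window_shear_tendsto:
  assumes "v \<in> Cspace n"
  shows "((\<lambda>t. window_shear n c t P q v y) \<longlongrightarrow> v y) (at 0)"
proof (cases "y \<in> {1..int n}")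
  case True
  define i where "i = c + (y - c) mod int n"
  have "((\<lambda>t. v y + t * P i / (1 + t * (\<Sum>j = c..i - 1. P j * q j)) * (\<Sum>j = i..c + int n - 1. q j * v (cyc n j)))
    \<longlongrightarrow> v y + 0 * P i / (1 + 0 * (\<Sum>j = c..i - 1. P j * q j)) * (\<Sum>j = i..c + int n - 1. q j * v (cyc n j))) (at 0)"
    by (intro tendsto_intros) simp
  then show ?thesis using True by (simp add: window_shear_def Let_def i_def)
next
  case False
  then have "v y = 0" using assms by (simp add: Cspace_def)
  then show ?thesis unfolding window_shear_def if_not_P[OF False] by simp
qed

lemma window_shear_LU:
  assumes D: "\<And>i. i \<in> {c - 1..c + int n - 1} \<Longrightarrow> 1 + t * (\<Sum>j = c..i. P j * q j) \<noteq> 0"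
    and i: "i \<in> {c..c + int n - 1}"
  shows "v (cyc n i) + t * P i * (\<Sum>j = c..c + int n - 1. q j * v (cyc n j)) =
    window_shear n c t P q v (cyc n i) + t * P i *
      (\<Sum>j = c..i - 1. q j * window_shear n c t P q v (cyc n j) / (1 + t * (\<Sum>l = c..j. P l * q l)))"
  by (rule rank_one_LU[where D = "\<lambda>i. 1 + t * (\<Sum>j = c..i. P j * q j)"
        and z = "\<lambda>i. window_shear n c t P q v (cyc n i)" and v = "\<lambda>i. v (cyc n i)",
        OF refl window_shear_cyc D i])

text \<open>Since \<open>L\<close> is lower unitriangular, \<open>L z\<close> and \<open>z\<close>
  have the same leading position and leading entry. So those of \<open>U v\<close> can be read off
  \<open>v + t P Q\<close>.\<close>

lemma window_shear_leading:
  assumes D: "\<And>i. i \<in> {c - 1..c + int n - 1} \<Longrightarrow> 1 + t * (\<Sum>j = c..i. P j * q j) \<noteq> 0"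
    and x: "x \<in> {c..c + int n - 1}"
    and Q: "Q = (\<Sum>j = c..c + int n - 1. q j * v (cyc n j))"
    and 0: "\<And>l. l \<in> {c..<x} \<Longrightarrow> v (cyc n l) + t * P l * Q = 0"
  shows "\<And>l. l \<in> {c..<x} \<Longrightarrow> window_shear n c t P q v (cyc n l) = 0"
    and "window_shear n c t P q v (cyc n x) = v (cyc n x) + t * P x * Q"
proof -
  have zero: "window_shear n c t P q v (cyc n (c + int m)) = 0" if "c + int m < x" for m
    using that
  proof (induction m rule: less_induct)
    case (less m)
    have "window_shear n c t P q v (cyc n j) = 0" if "j \<in> {c..c + int m - 1}" for j
    proof -
      have "nat (j - c) < m" using that by auto
      moreover have "c + int (nat (j - c)) = j" using that by simp
      ultimately show ?thesis using less.IH[of "nat (j - c)"] less.prems that by simp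
    qed
    then have "(\<Sum>j = c..c + int m - 1. q j * window_shear n c t P q v (cyc n j) / (1 + t * (\<Sum>l = c..j. P l * q l))) = 0"
      by (intro sum.neutral) simp
    then show ?case
      using window_shear_LU[OF D, of "c + int m" v] 0[of "c + int m"] less.prems x Q by simp
  qed
  show vanish: "window_shear n c t P q v (cyc n l) = 0" if "l \<in> {c..<x}" for l
    using zero[of "nat (l - c)"] that by simp
  then have "(\<Sum>j = c..x - 1. q j * window_shear n c t P q v (cyc n j) / (1 + t * (\<Sum>l = c..j. P l * q l))) = 0"
    by (intro sum.neutral) simp
  then show "window_shear n c t P q v (cyc n x) = v (cyc n x) + t * P x * Q"
    using window_shear_LU[OF D x, of v] Q by simp
qed

text \<open>If \<open>U v = 0\<close>, then \<open>v + t P Q = 0\<close> with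
  \<open>Q = q\<^sup>T v\<close>. Applying \<open>q\<close> and using \<open>q\<^sup>T P = 0\<close>
  gives \<open>Q = 0\<close>, hence \<open>v = 0\<close>.\<close>

lemma window_shear_inj:
  assumes D: "\<And>i. i \<in> {c - 1..c + int n - 1} \<Longrightarrow> 1 + t * (\<Sum>j = c..i. P j * q j) \<noteq> 0"
    and Pq: "(\<Sum>j = c..c + int n - 1. q j * P j) = 0"
    and v: "v \<in> Cspace n" "window_shear n c t P q v = 0"
  shows "v = 0"
proof -
  let ?W = "{c..c + int n - 1}"
  let ?Q = "\<Sum>j = c..c + int n - 1. q j * v (cyc n j)"
  have eq: "v (cyc n i) = - (t * P i * ?Q)" if "i \<in> ?W" for i
    using window_shear_LU[OF D that, of v] v(2) by (simp add: eq_neg_iff_add_eq_0)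
  have "?Q = (\<Sum>j = c..c + int n - 1. q j * - (t * P j * ?Q))"
    by (rule sum.cong) (simp_all add: eq)
  also have "(\<Sum>j = c..c + int n - 1. q j * - (t * P j * Q)) = - t * Q * (\<Sum>j = c..c + int n - 1. q j * P j)" for Q
    unfolding sum_distrib_left by (rule sum.cong) (simp_all add: algebra_simps)
  finally have "?Q = 0" by (simp add: Pq)
  then have "v (cyc n l) = 0 (cyc n l)" if "l \<in> ?W" for l using eq[OF that] by simp
  then show ?thesis
    using Cspace_eqI[OF n v(1), of 0 c] by (simp add: Cspace_def)
qed

end

text \<open>
  In the coordinates of the window \<open>c, \<dots>, c + n - 1\<close>: for \<open>p < c\<close> these are the vectors of \<open>V\<close> that
  vanish beyond \<open>p + n\<close>, for \<open>p \<ge> c\<close> those that agree with a vector of \<open>V\<close> beyond \<open>p\<close>.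
\<close>

definition window_flag :: "nat \<Rightarrow> int \<Rightarrow> (int \<Rightarrow> complex) set \<Rightarrow> int \<Rightarrow> (int \<Rightarrow> complex) set" where
  "window_flag n c V p = {u \<in> Cspace n.
     (\<exists>v\<in>V. \<forall>l\<in>{c..c + int n - 1}. p < l \<longrightarrow> u (cyc n l) = v (cyc n l)) \<and>
     (\<forall>l\<in>{c..c + int n - 1}. p + int n < l \<longrightarrow> u (cyc n l) = 0)}"

lemma window_flag_mono: "p \<le> p' \<Longrightarrow> window_flag n c V p \<subseteq> window_flag n c V p'"
  unfolding window_flag_def by fastforce

lemma window_flag_diff_scale:
  assumes "cvec.subspace V" "u \<in> window_flag n c V p" "w \<in> window_flag n c V p"
  shows "u - cscale t w \<in> window_flag n c V p"
proof -
  obtain u' w' where u: "u' \<in> V" "\<forall>l\<in>{c..c + int n - 1}. p < l \<longrightarrow> u (cyc n l) = u' (cyc n l)"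
    and w: "w' \<in> V" "\<forall>l\<in>{c..c + int n - 1}. p < l \<longrightarrow> w (cyc n l) = w' (cyc n l)"
    using assms(2,3) unfolding window_flag_def by blast
  have "u' - cscale t w' \<in> V" using assms(1) u(1) w(1) by (intro cvec.subspace_diff cvec.subspace_scale)
  moreover have "\<forall>l\<in>{c..c + int n - 1}. p < l \<longrightarrow> (u - cscale t w) (cyc n l) = (u' - cscale t w') (cyc n l)"
    using u w by (simp add: cscale_def)
  moreover have "u - cscale t w \<in> Cspace n"
    using assms(2,3) by (simp add: window_flag_def Cspace_def cscale_def)
  moreover have "\<forall>l\<in>{c..c + int n - 1}. p + int n < l \<longrightarrow> (u - cscale t w) (cyc n l) = 0"
    using assms(2,3) by (simp add: window_flag_def cscale_def)
  ultimately show ?thesis unfolding window_flag_def by blast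
qed

text \<open>Both conditions concern only the coordinates beyond some position, which an upper
  triangular map respects.\<close>

lemma window_flag_shear:
  assumes n: "0 < n" and u: "u \<in> window_flag n c V p"
  shows "window_shear n c t P q u \<in> window_flag n c (window_shear n c t P q ` V) p"
proof -
  obtain v where v: "v \<in> V" "\<forall>l\<in>{c..c + int n - 1}. p < l \<longrightarrow> u (cyc n l) = v (cyc n l)"
    using u unfolding window_flag_def by blast
  have "window_shear n c t P q u (cyc n l) = window_shear n c t P q v (cyc n l)"
    if "l \<in> {c..c + int n - 1}" "p < l" for l
    using that v(2) by (intro window_shear_cong[OF n]) auto
  moreover have "window_shear n c t P q u (cyc n l) = 0"
    if "l \<in> {c..c + int n - 1}" "p + int n < l" for l
  proof -
    have "window_shear n c t P q u (cyc n l) = window_shear n c t P q 0 (cyc n l)"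
      using that u by (intro window_shear_cong[OF n]) (auto simp: window_flag_def)
    then show ?thesis using that by (simp add: window_shear_cyc[OF n])
  qed
  ultimately show ?thesis
    using v(1) window_shear_Cspace[of n c] n unfolding window_flag_def by blast
qed

text \<open>Supplies vectors adapted to the flag: a coordinate vector if \<open>x\<close> is a fixed
  point, otherwise the vector of \<open>V\<close> given by
  \<open>open_positroid_inverse_le_iff\<close>, cut off at the preimage of \<open>x\<close>.\<close>

lemma ex_window_flag_leading:
  assumes n: "0 < n" and f: "f \<in> Bound k n" and V: "V \<in> open_positroid k n f"
    and x: "x \<in> {c..c + int n - 1}"
  shows "\<exists>u\<in>window_flag n c V (inv_into UNIV f x). (\<forall>l\<in>{c..<x}. u (cyc n l) = 0) \<and> u (cyc n x) \<noteq> 0"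
proof -
  define p where "p = inv_into UNIV f x"
  have Gr: "V \<in> Gr k n" using V by (simp add: open_positroid_def)
  consider (fixed) "x \<le> p" | (free) v where "p < x" "v \<in> V"
    "\<forall>l\<in>{p + 1..x - 1}. v (cyc n l) = 0" "v (cyc n x) \<noteq> 0"
    using open_positroid_inverse_le_iff[OF n Gr f V, of x p] unfolding p_def[symmetric] by (meson not_le order_refl)
  then show ?thesis
  proof cases
    case fixed
    have other: "unit_fun (cyc n x) (cyc n l) = 0" if "l \<in> {c..c + int n - 1}" "l \<noteq> x" for l
      using cyc_window_inj[OF that(1) x] that(2) by (auto simp: unit_fun_def)
    have "unit_fun (cyc n x) \<in> window_flag n c V p"
    proof -
      have "unit_fun (cyc n x) \<in> Cspace n"
        using cyc_in[OF n, of x] by (auto simp: Cspace_def unit_fun_def)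
      moreover have "0 \<in> V" using cvec.subspace_0[OF Gr_subspace[OF Gr]] .
      moreover have "\<forall>l\<in>{c..c + int n - 1}. p < l \<longrightarrow> unit_fun (cyc n x) (cyc n l) = 0 (cyc n l)"
        using other fixed by simp
      moreover have "\<forall>l\<in>{c..c + int n - 1}. p + int n < l \<longrightarrow> unit_fun (cyc n x) (cyc n l) = 0"
        using fixed x by simp
      ultimately show ?thesis unfolding window_flag_def by blast
    qed
    moreover have "\<forall>l\<in>{c..<x}. unit_fun (cyc n x) (cyc n l) = 0" using other x by simp
    moreover have "unit_fun (cyc n x) (cyc n x) \<noteq> 0" by (simp add: unit_fun_def)
    ultimately show ?thesis unfolding p_def by blast
  next
    case free
    define u where "u = (\<lambda>y. if p < c + (y - c) mod int n then v y else 0)"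
    have u: "u (cyc n l) = (if p < l then v (cyc n l) else 0)" if "l \<in> {c..c + int n - 1}" for l
      by (simp add: u_def window_position[OF that])
    have "u \<in> Cspace n"
      using Gr_Cspace[OF Gr] free(2) by (auto simp: Cspace_def u_def)
    moreover have "u (cyc n l) = 0" if "l \<in> {c..c + int n - 1}" "p + int n < l" for l
    proof -
      \<comment> \<open>Positions of the window beyond \<open>p + n\<close> are translates of
        positions in \<open>{p + 1..x - 1}\<close>, where \<open>v\<close> vanishes.\<close>
      have "l - int n \<in> {p + 1..x - 1}" using that x by auto
      then have "v (cyc n (l - int n)) = 0" using free(3) by blast
      moreover have "cyc n (l - int n) = cyc n l" by (simp add: cyc_eq_iff)
      ultimately show ?thesis using u[OF that(1)] by simp
    qed
    ultimately have "u \<in> window_flag n c V p"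
      using u free(2) unfolding window_flag_def by auto
    moreover have "\<forall>l\<in>{c..<x}. u (cyc n l) = 0" using u free(3) x by simp
    moreover have "u (cyc n x) \<noteq> 0" using u[OF x] free(1,4) by simp
    ultimately show ?thesis unfolding p_def by blast
  qed
qed

text \<open>Conversely, leading positions bound preimages; \<open>x - n \<le> p\<close> keeps
  \<open>{p + 1..x - 1}\<close> within one turn.\<close>

lemma inverse_le_if_window_flag_leading:
  assumes n: "0 < n" and f: "f \<in> Bound k n" and V: "V \<in> open_positroid k n f"
    and x: "x \<in> {c..c + int n - 1}" and p: "x - int n \<le> p"
    and u: "u \<in> window_flag n c V p" "\<And>l. l \<in> {c..<x} \<Longrightarrow> u (cyc n l) = 0" "u (cyc n x) \<noteq> 0"
  shows "inv_into UNIV f x \<le> p"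
proof -
  have Gr: "V \<in> Gr k n" using V by (simp add: open_positroid_def)
  obtain v where v: "v \<in> V" "\<forall>l\<in>{c..c + int n - 1}. p < l \<longrightarrow> u (cyc n l) = v (cyc n l)"
    using u(1) unfolding window_flag_def by blast
  have "v (cyc n x) \<noteq> 0 \<and> (\<forall>l\<in>{p + 1..x - 1}. v (cyc n l) = 0)" if "p < x"
  proof (intro conjI ballI)
    show "v (cyc n x) \<noteq> 0" using v(2) x that u(3) by auto
    fix l assume l: "l \<in> {p + 1..x - 1}"
    \<comment> \<open>Inside the window the leading position of \<open>u\<close> gives the
      vanishing; before it, the translate by \<open>n\<close> falls under the condition beyond
      \<open>p + n\<close>.\<close>
    show "v (cyc n l) = 0"
    proof (cases "c \<le> l")
      case True
      then show ?thesis using v(2) u(2)[of l] l x by auto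
    next
      case False
      then have "l + int n \<in> {c..c + int n - 1}" "p + int n < l + int n" "p < l + int n"
        using l x p by auto
      then have "v (cyc n (l + int n)) = 0"
        using v(2) u(1) unfolding window_flag_def by auto
      moreover have "cyc n (l + int n) = cyc n l" by (simp add: cyc_eq_iff)
      ultimately show ?thesis by simp
    qed
  qed
  then show ?thesis
    using open_positroid_inverse_le_iff[OF n Gr f V, of x p] v(1) by (metis not_le)
qed

text \<open>Makes one-sided bounds sufficient. Smaller preimages give larger column differences, so
  the difference of the ranks grows with \<open>j\<close>; it is 0 on empty intervals and on full
  windows, since both elements share \<open>k\<close>.\<close>

lemma Bound_eq_if_inverse_le:
  assumes n: "0 < n" and f: "f \<in> Bound k n" and g: "g \<in> Bound k n"
    and le: "\<And>x. x \<in> {c..c + int n - 1} \<Longrightarrow> inv_into UNIV g x \<le> inv_into UNIV f x"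
  shows "g = f"
proof -
  interpret f: bounded_perm n f by (rule Bound_bounded_perm[OF f n])
  interpret g: bounded_perm n g by (rule Bound_bounded_perm[OF g n])
  have le': "inv_into UNIV g y \<le> inv_into UNIV f y" for y
  proof -
    let ?x = "c + (y - c) mod int n"
    obtain m where m: "y = ?x + m * int n"
      using mod_eq_add[of y n ?x] by (auto simp: mod_simps)
    have "inv_into UNIV g ?x \<le> inv_into UNIV f ?x"
      using pos_mod_bound[of "int n" "y - c"] pos_mod_sign[of "int n" "y - c"] n by (intro le) auto
    moreover have "inv_into UNIV g y = inv_into UNIV g ?x + m * int n"
      by (subst m) (rule periodic_mult[of "inv_into UNIV g", OF g.inv_periodic])
    moreover have "inv_into UNIV f y = inv_into UNIV f ?x + m * int n"
      by (subst m) (rule periodic_mult[of "inv_into UNIV f", OF f.inv_periodic])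
    ultimately show ?thesis by simp
  qed
  define e where "e i j = perm_rank g i j - perm_rank f i j" for i j
  have mono: "e i j \<le> e i j'" if "j \<le> j'" for i j j'
    using that
  proof (induction rule: int_ge_induct)
    case (step j')
    then show ?case
      using f.perm_rank_right[of i "j' + 1"] g.perm_rank_right[of i "j' + 1"] le'[of "j' + 1"]
      by (auto simp: e_def)
  qed simp
  have long: "e i j = 0" if "i + int n - 1 \<le> j" for i j
    using Bound_perm_rank_long[OF f n that] Bound_perm_rank_long[OF g n that] by (simp add: e_def)
  have short: "e i j = 0" if "j < i" for i j
    using f.perm_rank_empty[OF that] g.perm_rank_empty[OF that] by (simp add: e_def)
  have "e i j = 0" for i j
    using mono[of j "max j (i + int n - 1)" i] mono[of "min j (i - 1)" j i]
      long[of i "max j (i + int n - 1)"] short[of "min j (i - 1)" i] by simp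
  then show ?thesis
    using Bound_eq_if_perm_rank_eq[OF g f n] by (simp add: e_def)
qed

section \<open>Limits of bases\<close>

lemma is_basis_dim: "is_basis k B V \<Longrightarrow> cvec.dim V = k"
  unfolding is_basis_def by (metis card_image card_lessThan cvec.dim_span_eq_card_independent)

lemma is_basis_image:
  assumes "Vector_Spaces.linear cscale cscale U" "cvec.subspace V" "\<And>v. v \<in> V \<Longrightarrow> U v = 0 \<Longrightarrow> v = 0"
    and B: "is_basis k B V"
  shows "is_basis k (U \<circ> B) (U ` V)"
proof -
  interpret U: Vector_Spaces.linear cscale cscale U by (rule assms)
  have inj: "inj_on U V" using U.inj_on_iff_eq_0[OF assms(2)] assms(3) by blast
  have span: "cvec.span (B ` {..<k}) = V" and "B ` {..<k} \<subseteq> V"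
    using B by (auto simp: is_basis_def intro: cvec.span_base)
  have "inj_on (U \<circ> B) {..<k}"
    using B inj_on_subset[OF inj \<open>B ` {..<k} \<subseteq> V\<close>] by (simp add: is_basis_def comp_inj_on)
  moreover have "cvec.independent (U ` B ` {..<k})"
    using B inj by (intro U.independent_injective_image) (simp_all add: is_basis_def)
  moreover have "cvec.span (U ` B ` {..<k}) = U ` V"
    using U.span_image[of "B ` {..<k}"] span by simp
  ultimately show ?thesis by (simp add: is_basis_def image_comp)
qed

lemma det_mat: "det (mat k k h) = (\<Sum>p\<in>{p. p permutes {0..<k}}. signof p * (\<Prod>i = 0..<k. h (i, p i)))"
  unfolding det_def by (auto intro!: sum.cong prod.cong simp: permutes_in_image)

lemma tendsto_plucker:
  assumes "\<And>a y. a < k \<Longrightarrow> ((\<lambda>t. B t a y) \<longlongrightarrow> B' a y) F"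
  shows "((\<lambda>t. plucker k (B t) I) \<longlongrightarrow> plucker k B' I) F"
  unfolding plucker_def det_mat
  by (intro tendsto_sum tendsto_mult tendsto_const tendsto_prod) (auto intro: assms)

lemma tendsto_homog_poly:
  assumes "homog_poly J d p" "\<And>i. i \<in> J \<Longrightarrow> ((\<lambda>t. x t i) \<longlongrightarrow> x' i) F"
  shows "((\<lambda>t. p (x t)) \<longlongrightarrow> p x') F"
  using assms by (induction rule: homog_poly.induct) (auto intro!: tendsto_intros)

text \<open>Zariski closed sets contain limits in the usual topology: if bases converge, so do their
  Pluecker coordinates, and homogeneous polynomials are continuous.\<close>

lemma zariski_closed_limit:
  assumes "zariski_closed k n Z" and V: "V \<in> Gr k n"
    and lim: "\<And>B. is_basis k B V \<Longrightarrow> \<exists>B'. (\<forall>a<k. \<forall>y. ((\<lambda>t. B' t a y) \<longlongrightarrow> B a y) (at (0::complex))) \<and>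
      (\<forall>\<^sub>F t in at 0. \<exists>V'\<in>Z. is_basis k (B' t) V')"
  shows "V \<in> Z"
proof -
  obtain P where P: "\<forall>p\<in>P. \<exists>d. homog_poly (plucker_index k n) d p"
    and Z: "Z = {V \<in> Gr k n. \<forall>p\<in>P. \<forall>B. is_basis k B V \<longrightarrow> p (plucker k B) = 0}"
    using assms(1) unfolding zariski_closed_def by blast
  have "p (plucker k B) = 0" if p: "p \<in> P" and B: "is_basis k B V" for p B
  proof -
    obtain B' where B': "\<forall>a<k. \<forall>y. ((\<lambda>t. B' t a y) \<longlongrightarrow> B a y) (at (0::complex))"
      and ev: "\<forall>\<^sub>F t in at 0. \<exists>V'\<in>Z. is_basis k (B' t) V'"
      using lim[OF B] by blast
    obtain d where "homog_poly (plucker_index k n) d p" using P p by blast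
    then have "((\<lambda>t. p (plucker k (B' t))) \<longlongrightarrow> p (plucker k B)) (at 0)"
      by (rule tendsto_homog_poly) (rule tendsto_plucker, use B' in blast)
    moreover have "\<forall>\<^sub>F t in at 0. p (plucker k (B' t)) = 0"
      using ev by eventually_elim (use Z p in blast)
    ultimately have "((\<lambda>t. 0) \<longlongrightarrow> p (plucker k B)) (at (0::complex))"
      using tendsto_cong by fastforce
    then show ?thesis using tendsto_unique[OF _ tendsto_const] by (metis at_neq_bot)
  qed
  then show ?thesis using V Z by blast
qed

text \<open>Here \<open>\<sigma> x\<close> is a flag vector with leading position \<open>x\<close>,
  and \<open>q\<close> takes the value 1 on \<open>\<sigma> (f a)\<close> and 0 on the others. With
  \<open>P\<close> the vector \<open>\<sigma> (f b)\<close>, the map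
  \<open>1 + t P q\<^sup>T\<close> changes only \<open>\<sigma> (f a)\<close> among them, and this
  exchanges the leading positions \<open>f a\<close> and \<open>f b\<close>.\<close>

lemma window_shear_open_positroid:
  assumes n: "0 < n" and f: "f \<in> Bound k n" and V: "V \<in> open_positroid k n f"
    and ab: "a < b" "f b < f a"
    and \<sigma>: "\<And>x. x \<in> {f b..f b + int n - 1} \<Longrightarrow> \<sigma> x \<in> window_flag n (f b) V (inv_into UNIV f x) \<and>
        (\<forall>l\<in>{f b..<x}. \<sigma> x (cyc n l) = 0) \<and> \<sigma> x (cyc n x) \<noteq> 0"
    and q: "\<And>x. x \<in> {f b..f b + int n - 1} \<Longrightarrow>
        (\<Sum>j = f b..f b + int n - 1. q j * \<sigma> x (cyc n j)) = (if x = f a then 1 else 0)"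
    and P: "P = (\<lambda>j. \<sigma> (f b) (cyc n j))"
    and t: "t \<noteq> 0" "\<And>i. i \<in> {f b - 1..f b + int n - 1} \<Longrightarrow> 1 + t * (\<Sum>j = f b..i. P j * q j) \<noteq> 0"
  shows "window_shear n (f b) t P q ` V \<in> open_positroid k n (f \<circ> affine_transposition n a b)"
    and "is_basis k B V \<Longrightarrow> is_basis k (window_shear n (f b) t P q \<circ> B) (window_shear n (f b) t P q ` V)"
proof -
  interpret f: bounded_perm n f by (rule Bound_bounded_perm[OF f n])
  note ban = f.inversion_bounds(1)[OF ab] and mod = f.inversion_bounds(2)[OF ab]
  define c where "c = f b"
  define d where "d = f a"
  define h where "h = f \<circ> affine_transposition n a b"
  let ?U = "window_shear n c t P q"
  let ?W = "{c..c + int n - 1}"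
  have Gr: "V \<in> Gr k n" using V by (simp add: open_positroid_def)
  note \<sigma> = \<sigma>[folded c_def] and q = q[folded c_def d_def] and t = t[folded c_def] and P = P[folded c_def]
  have h: "h \<in> Bound k n" unfolding h_def by (rule Bound_comp_transposition[OF n f ab])
  interpret h: bounded_perm n h by (rule Bound_bounded_perm[OF h n])
  interpret U: Vector_Spaces.linear cscale cscale ?U by (rule window_shear_linear[OF n])
  have W: "c \<in> ?W" "d \<in> ?W" "c < d"
    using n ab f.upper[of a] f.lower[of b] by (auto simp: c_def d_def)
  have h_inv: "inv_into UNIV h x = affine_transposition n a b (inv_into UNIV f x)" for x
    using h.inv_f[of "affine_transposition n a b (inv_into UNIV f x)"]
    by (simp add: h_def affine_transposition_involutive[OF n mod])
  have kernel: "v = 0" if "v \<in> V" "?U v = 0" for v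
  proof (rule window_shear_inj[OF n t(2)])
    show "(\<Sum>j = c..c + int n - 1. q j * P j) = 0" using q[OF W(1)] W(3) by (simp add: P)
  qed (use that Gr_Cspace[OF Gr] in auto)
  show basis: "is_basis k (window_shear n (f b) t P q \<circ> B) (window_shear n (f b) t P q ` V)"
    if "is_basis k B V" for B
    using is_basis_image[OF window_shear_linear[OF n] Gr_subspace[OF Gr] kernel that] by (simp add: c_def)
  have "?U ` V \<in> Gr k n"
  proof -
    obtain B where "is_basis k B V" using ex_is_basis[OF Gr] .
    then have "cvec.dim (?U ` V) = k" using basis is_basis_dim unfolding c_def by blast
    then show ?thesis
      using U.subspace_image[OF Gr_subspace[OF Gr]] window_shear_Cspace[OF n] by (auto simp: Gr_def)
  qed
  then obtain g where g: "g \<in> Bound k n" "?U ` V \<in> open_positroid k n g"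
    using ex_Bound_interval_rank[OF n] open_positroid_iff[OF n] by metis
  interpret g: bounded_perm n g by (rule Bound_bounded_perm[OF g(1) n])
  \<comment> \<open>By \<open>Bound_eq_if_inverse_le\<close> it is enough to exhibit, for each
    \<open>x\<close>, one vector of the right flag step whose image has leading position
    \<open>x\<close>.\<close>
  have "inv_into UNIV g x \<le> inv_into UNIV h x" if x: "x \<in> ?W" for x
  proof -
    have "\<exists>v\<in>window_flag n c V (inv_into UNIV h x).
      (\<forall>l\<in>{c..<x}. v (cyc n l) + t * P l * (\<Sum>j = c..c + int n - 1. q j * v (cyc n j)) = 0) \<and>
      v (cyc n x) + t * P x * (\<Sum>j = c..c + int n - 1. q j * v (cyc n j)) \<noteq> 0"
    proof -
      consider "x = c" | "x = d" | "x \<noteq> c" "x \<noteq> d" by blast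
      then show ?thesis
      proof cases
        \<comment> \<open>At level \<open>a\<close>, \<open>\<sigma> d\<close> is sent to
          \<open>\<sigma> d + t \<sigma> c\<close>, whose leading position is
          \<open>c\<close>.\<close>
        case 1
        have "inv_into UNIV h x = inv_into UNIV f d"
          using affine_transposition_swap[OF n mod] by (simp add: 1 h_inv c_def d_def)
        moreover have "\<sigma> d (cyc n c) = 0" "P c \<noteq> 0" using \<sigma>[OF W(2)] \<sigma>[OF W(1)] W(3) by (simp_all add: P)
        ultimately show ?thesis
          using \<sigma>[OF W(2)] q[OF W(2)] t(1) by (intro bexI[of _ "\<sigma> d"]) (simp_all add: 1)
      next
        \<comment> \<open>At level \<open>b\<close> both vectors are available, and subtracting
          \<open>t \<sigma> c\<close> in advance makes the image equal to
          \<open>\<sigma> d\<close>.\<close>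
        case 2
        have b: "inv_into UNIV h x = b" "inv_into UNIV f c = b" "inv_into UNIV f d = a"
          using affine_transposition_swap[OF n mod] by (simp_all add: 2 h_inv c_def d_def)
        have "\<sigma> d \<in> window_flag n c V b" "\<sigma> c \<in> window_flag n c V b"
          using \<sigma>[OF W(2)] \<sigma>[OF W(1)] window_flag_mono[of a b n c V] ab(1) unfolding b by auto
        then have flag: "\<sigma> d - cscale t (\<sigma> c) \<in> window_flag n c V b"
          by (rule window_flag_diff_scale[OF Gr_subspace[OF Gr]])
        have "(\<Sum>j = c..c + int n - 1. q j * (\<sigma> d - cscale t (\<sigma> c)) (cyc n j)) =
          (\<Sum>j = c..c + int n - 1. q j * \<sigma> d (cyc n j)) - t * (\<Sum>j = c..c + int n - 1. q j * \<sigma> c (cyc n j))"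
          by (simp add: cscale_def sum_subtractf sum_distrib_left algebra_simps)
        also have "\<dots> = 1" using q[OF W(1)] q[OF W(2)] W(3) by simp
        finally show ?thesis
          unfolding b(1) using \<sigma>[OF W(2)] flag
          by (intro bexI[of _ "\<sigma> d - cscale t (\<sigma> c)"]) (simp_all add: 2 cscale_def P)
      next
        \<comment> \<open>The preimage of \<open>x\<close> is congruent to neither \<open>a\<close>
          nor \<open>b\<close>, and \<open>q\<close> vanishes on \<open>\<sigma> x\<close>, so level
          and vector are unchanged.\<close>
        case 3
        have "inv_into UNIV f x mod int n \<noteq> a mod int n"
        proof
          assume "inv_into UNIV f x mod int n = a mod int n"
          then obtain m where m: "inv_into UNIV f x = a + m * int n" using mod_eq_add by blast
          have "x = d + m * int n"
            using f.f_inv[of x] periodic_mult[of f n "int n" a m] f.periodic by (simp add: m d_def)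
          then have "cyc n x = cyc n d" by (simp add: cyc_eq_iff)
          then show False using cyc_window_inj[OF x W(2)] 3 by blast
        qed
        moreover have "inv_into UNIV f x mod int n \<noteq> b mod int n"
        proof
          assume "inv_into UNIV f x mod int n = b mod int n"
          then obtain m where m: "inv_into UNIV f x = b + m * int n" using mod_eq_add by blast
          have "x = c + m * int n"
            using f.f_inv[of x] periodic_mult[of f n "int n" b m] f.periodic by (simp add: m c_def)
          then have "cyc n x = cyc n c" by (simp add: cyc_eq_iff)
          then show False using cyc_window_inj[OF x W(1)] 3 by blast
        qed
        ultimately have "inv_into UNIV h x = inv_into UNIV f x"
          using affine_transposition_other[OF n mod] by (simp add: h_inv)
        then show ?thesis
          using \<sigma>[OF x] q[OF x] 3 by (intro bexI[of _ "\<sigma> x"]) simp_all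
      qed
    qed
    then obtain v where v: "v \<in> window_flag n c V (inv_into UNIV h x)"
      "\<And>l. l \<in> {c..<x} \<Longrightarrow> v (cyc n l) + t * P l * (\<Sum>j = c..c + int n - 1. q j * v (cyc n j)) = 0"
      "v (cyc n x) + t * P x * (\<Sum>j = c..c + int n - 1. q j * v (cyc n j)) \<noteq> 0" by blast
    note lead = window_shear_leading[OF n t(2) x refl v(2)]
    show ?thesis
      using inverse_le_if_window_flag_leading[OF n g x h.inv_lower window_flag_shear[OF n v(1)]]
        lead v(3) by metis
  qed
  then have "g = h" using Bound_eq_if_inverse_le[OF n h g(1)] by blast
  then show "window_shear n (f b) t P q ` V \<in> open_positroid k n (f \<circ> affine_transposition n a b)"
    using g(2) by (simp add: h_def c_def)
qed

text \<open>For \<open>t\<close> near 0 the spaces \<open>U V\<close> lie in the stratum of the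
  uncrossed permutation and have bases converging to one of \<open>V\<close>, so
  \<open>zariski_closed_limit\<close> applies.\<close>

lemma closed_contains_higher_stratum:
  assumes n: "0 < n" and f: "f \<in> Bound k n" and ab: "a < b" "f b < f a"
    and Z: "zariski_closed k n Z" "open_positroid k n (f \<circ> affine_transposition n a b) \<subseteq> Z"
  shows "open_positroid k n f \<subseteq> Z"
proof
  fix V assume V: "V \<in> open_positroid k n f"
  define c where "c = f b"
  have Gr: "V \<in> Gr k n" using V by (simp add: open_positroid_def)
  define \<sigma> where "\<sigma> x = (SOME u. u \<in> window_flag n c V (inv_into UNIV f x) \<and>
    (\<forall>l\<in>{c..<x}. u (cyc n l) = 0) \<and> u (cyc n x) \<noteq> 0)" for x
  have \<sigma>: "\<sigma> x \<in> window_flag n c V (inv_into UNIV f x) \<and>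
    (\<forall>l\<in>{c..<x}. \<sigma> x (cyc n l) = 0) \<and> \<sigma> x (cyc n x) \<noteq> 0" if "x \<in> {c..c + int n - 1}" for x
    unfolding \<sigma>_def using ex_window_flag_leading[OF n f V that] unfolding Bex_def by (rule someI_ex)
  \<comment> \<open>The vectors \<open>\<sigma> x\<close> form a triangular matrix with nonzero
    diagonal, so a functional with prescribed values on them exists.\<close>
  obtain q where q: "\<forall>x\<in>{c..c + int n - 1}.
    (\<Sum>j = c..c + int n - 1. q j * \<sigma> x (cyc n j)) = (if x = f a then 1 else 0)"
    using triangular_solvable[of c "c + int n - 1" "\<lambda>x j. \<sigma> x (cyc n j)" "\<lambda>x. if x = f a then 1 else 0"] \<sigma>
    by auto
  define P where "P = (\<lambda>j. \<sigma> c (cyc n j))"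
  let ?U = "\<lambda>t. window_shear n c t P q"
  \<comment> \<open>The finitely many principal minors tend to 1, so none vanishes for
    \<open>t\<close> near 0.\<close>
  have "\<forall>\<^sub>F t in at 0. \<forall>i\<in>{c - 1..c + int n - 1}. 1 + t * (\<Sum>j = c..i. P j * q j) \<noteq> 0"
  proof (intro eventually_ball_finite ballI)
    fix i
    have "((\<lambda>t. 1 + t * (\<Sum>j = c..i. P j * q j)) \<longlongrightarrow> 1 + 0 * (\<Sum>j = c..i. P j * q j)) (at 0)"
      by (intro tendsto_intros)
    then show "\<forall>\<^sub>F t in at 0. 1 + t * (\<Sum>j = c..i. P j * q j) \<noteq> 0"
      by (rule tendsto_imp_eventually_ne) simp
  qed simp
  moreover have "\<forall>\<^sub>F t::complex in at 0. t \<noteq> 0" by (simp add: eventually_at_filter)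
  ultimately have good: "\<forall>\<^sub>F t in at 0. ?U t ` V \<in> Z \<and> (\<forall>B. is_basis k B V \<longrightarrow> is_basis k (?U t \<circ> B) (?U t ` V))"
  proof eventually_elim
    case (elim t)
    note * = window_shear_open_positroid[OF n f V ab, of \<sigma> q P t, folded c_def, OF \<sigma> q[rule_format] P_def elim(2) elim(1)[rule_format]]
    show ?case using *(1) *(2) Z(2) by blast
  qed
  show "V \<in> Z"
  proof (rule zariski_closed_limit[OF Z(1) Gr])
    fix B assume B: "is_basis k B V"
    have "B a \<in> Cspace n" if "a < k" for a
    proof -
      have "B a \<in> V" using B that by (auto simp: is_basis_def intro: cvec.span_base)
      then show ?thesis using Gr_Cspace[OF Gr] by blast
    qed
    then have "\<forall>a<k. \<forall>y. ((\<lambda>t. (?U t \<circ> B) a y) \<longlongrightarrow> B a y) (at 0)"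
      using window_shear_tendsto[OF n] by simp
    moreover have "\<forall>\<^sub>F t in at 0. \<exists>V'\<in>Z. is_basis k (?U t \<circ> B) V'"
      using good by eventually_elim (use B in blast)
    ultimately show "\<exists>B'. (\<forall>a<k. \<forall>y. ((\<lambda>t. B' t a y) \<longlongrightarrow> B a y) (at (0::complex))) \<and>
      (\<forall>\<^sub>F t in at 0. \<exists>V'\<in>Z. is_basis k (B' t) V')"
      by (intro exI[of _ "\<lambda>t. ?U t \<circ> B"]) blast
  qed
qed


section \<open>Stratification of positroid varieties\<close>

lemma dim_linear_image:
  assumes "Vector_Spaces.linear cscale cscale L" "inj L" "cvec.subspace W"
  shows "cvec.dim (L ` W) = cvec.dim W"
proof -
  interpret L: Vector_Spaces.linear cscale cscale L by (rule assms)
  obtain B where B: "B \<subseteq> W" "cvec.independent B" "W \<subseteq> cvec.span B" "card B = cvec.dim W"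
    using cvec.basis_exists[of W] by blast
  have inj: "inj_on L X" for X using assms(2) inj_on_subset by blast
  have span: "cvec.span B = W" using cvec.span_subspace B assms(3) by blast
  have "cvec.dim (L ` W) = card (L ` B)"
  proof (rule cvec.dim_unique)
    show "L ` B \<subseteq> L ` W" using B(1) by (rule image_mono)
    show "L ` W \<subseteq> cvec.span (L ` B)" using L.span_image[of B] span by simp
    show "cvec.independent (L ` B)" using L.independent_injective_image[OF B(2) inj] .
  qed simp
  then show ?thesis using card_image[OF inj, of B] B(4) by simp
qed

section \<open>Cyclic shifts, Schubert varieties and juggling sequences\<close>

context
  fixes n :: nat
  assumes n: "0 < n"
begin

lemma chi_cyc: "chi n (cyc n x) = cyc n (x + 1)"
proof -
  have "cyc n x = int n \<or> cyc n x \<in> {1..int n - 1}" using cyc_in[OF n, of x] by auto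
  moreover have "(x + 1) mod int n = (cyc n x + 1) mod int n" by (metis cyc_mod mod_add_left_eq)
  then have "cyc n (x + 1) = cyc n (cyc n x + 1)" by (simp add: cyc_eq_iff)
  moreover have "cyc n (int n + 1) = 1" using n by (simp add: cyc_def)
  moreover have "cyc n (y + 1) = y + 1" if "y \<in> {1..int n - 1}" for y
    using that by (intro cyc_id) simp
  ultimately show ?thesis by (auto simp: chi_def)
qed

lemma chi_in_iff: "chi n y \<in> {1..int n} \<longleftrightarrow> y \<in> {1..int n}"
  using n by (auto simp: chi_def)

lemma bij_chi: "bij (chi n)"
proof (rule o_bij)
  let ?g = "\<lambda>y. if 1 < y \<and> y \<le> int n then y - 1 else if y = 1 then int n else y"
  show "?g \<circ> chi n = id" "chi n \<circ> ?g = id"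
    using n by (auto simp: chi_def fun_eq_iff)
qed

lemma inv_chi [simp]: "inv_into UNIV (chi n) (chi n y) = y" "chi n (inv_into UNIV (chi n) y) = y"
  using bij_chi by (simp_all add: bij_is_inj bij_is_surj surj_f_inv_f)

lemma Gr_image:
  assumes V: "V \<in> Gr k n" and h: "bij h" "\<And>y. h y \<in> {1..int n} \<longleftrightarrow> y \<in> {1..int n}"
  shows "(\<lambda>v. v \<circ> h) ` V \<in> Gr k n"
    and "proj_rank ((\<lambda>v. v \<circ> h) ` V) S = proj_rank V (h ` S)"
proof -
  let ?L = "\<lambda>v. v \<circ> h"
  have linear: "Vector_Spaces.linear cscale cscale ?L"
    by unfold_locales (auto simp: cscale_def fun_eq_iff)
  interpret L: Vector_Spaces.linear cscale cscale ?L by (rule linear)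
  have inj: "inj ?L"
  proof (rule injI)
    fix u v assume "u \<circ> h = v \<circ> h"
    then have "u (h x) = v (h x)" for x by (simp add: fun_eq_iff)
    then show "u = v" using h(1) by (metis bij_is_surj surjD ext)
  qed
  have "v \<circ> h \<in> Cspace n" if "v \<in> Cspace n" for v
    using that h(2) unfolding Cspace_def mem_Collect_eq o_apply by blast
  then show "?L ` V \<in> Gr k n"
    using L.subspace_image[OF Gr_subspace[OF V]] dim_linear_image[OF linear inj Gr_subspace[OF V]]
      Gr_dim[OF V] Gr_Cspace[OF V] by (auto simp: Gr_def)
  interpret p: Vector_Spaces.linear cscale cscale "project (h ` S)" by (rule linear_project)
  have "project S (v \<circ> h) = project (h ` S) v \<circ> h" for v
    using bij_is_inj[OF h(1)] by (auto simp: project_def fun_eq_iff inj_image_mem_iff)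
  then have "project S ` ?L ` V = ?L ` project (h ` S) ` V" by (simp only: image_image)
  then show "proj_rank (?L ` V) S = proj_rank V (h ` S)"
    using dim_linear_image[OF linear inj p.subspace_image[OF Gr_subspace[OF V]]] by simp
qed

lemma chi_Gr_image:
  assumes "V \<in> Gr k n"
  shows "chi_Gr n V \<in> Gr k n" "proj_rank (chi_Gr n V) (cyc n ` {i + 1..j + 1}) = proj_rank V (cyc n ` {i..j})"
proof -
  have h: "bij (inv_into UNIV (chi n))" using bij_chi by (rule bij_imp_bij_inv)
  have range: "inv_into UNIV (chi n) y \<in> {1..int n} \<longleftrightarrow> y \<in> {1..int n}" for y
    using chi_in_iff[of "inv_into UNIV (chi n) y"] by simp
  show "chi_Gr n V \<in> Gr k n" unfolding chi_Gr_def by (rule Gr_image(1)[OF assms h range])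
  have "cyc n ` {i + 1..j + 1} = (\<lambda>x. cyc n (x + 1)) ` {i..j}"
    by (simp add: image_image[of "cyc n" "\<lambda>x. x + 1", symmetric])
  also have "\<dots> = chi n ` cyc n ` {i..j}" by (simp add: image_image chi_cyc)
  finally have "inv_into UNIV (chi n) ` cyc n ` {i + 1..j + 1} = cyc n ` {i..j}"
    by (simp add: image_image)
  then show "proj_rank (chi_Gr n V) (cyc n ` {i + 1..j + 1}) = proj_rank V (cyc n ` {i..j})"
    unfolding chi_Gr_def using Gr_image(2)[OF assms h range] by simp
qed

lemma ex_chi_Gr_eq: "V \<in> Gr k n \<Longrightarrow> \<exists>V'\<in>Gr k n. chi_Gr n V' = V"
proof (intro bexI)
  assume V: "V \<in> Gr k n"
  show "(\<lambda>v. v \<circ> chi n) ` V \<in> Gr k n" by (rule Gr_image(1)[OF V bij_chi chi_in_iff])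
  have "chi n \<circ> inv_into UNIV (chi n) = id" by (simp add: fun_eq_iff)
  then show "chi_Gr n ((\<lambda>v. v \<circ> chi n) ` V) = V"
    by (simp add: chi_Gr_def image_image comp_assoc)
qed

text \<open>Each application of \<open>chi_Gr\<close> rotates the initial intervals by one step;
  since it maps onto \<open>Gr k n\<close>, the image is again cut out by rank conditions.\<close>

lemma chi_Gr_schubert:
  "(chi_Gr n ^^ m) ` schubert k n I =
    {V \<in> Gr k n. \<forall>j\<in>{1..int n}. proj_rank V (cyc n ` {int m + 1..int m + j}) \<le> card (I \<inter> {1..j})}"
proof (induction m)
  case 0
  have "cyc n ` {1..j} = {1..j}" if "j \<in> {1..int n}" for j
    using that cyc_id by force
  then show ?case by (auto simp: schubert_def)
next
  case (Suc m)
  have rank: "proj_rank (chi_Gr n V) (cyc n ` {int (Suc m) + 1..int (Suc m) + j})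
    = proj_rank V (cyc n ` {int m + 1..int m + j})" if "V \<in> Gr k n" for V j
    using chi_Gr_image(2)[OF that, of "int m + 1" "int m + j"] by (simp add: algebra_simps)
  have "(chi_Gr n ^^ Suc m) ` schubert k n I = chi_Gr n ` (chi_Gr n ^^ m) ` schubert k n I"
    by (simp add: image_comp)
  also have "\<dots> = {V \<in> Gr k n. \<forall>j\<in>{1..int n}.
      proj_rank V (cyc n ` {int (Suc m) + 1..int (Suc m) + j}) \<le> card (I \<inter> {1..j})}"
    (is "_ ` ?A = ?B") unfolding Suc.IH
  proof (intro equalityI subsetI)
    fix V assume "V \<in> ?B"
    moreover from this obtain V' where "V' \<in> Gr k n" "chi_Gr n V' = V" using ex_chi_Gr_eq by blast
    ultimately show "V \<in> chi_Gr n ` {V \<in> Gr k n. \<forall>j\<in>{1..int n}.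
        proj_rank V (cyc n ` {int m + 1..int m + j}) \<le> card (I \<inter> {1..j})}"
      using rank by (intro image_eqI[of _ _ V']) auto
  qed (use rank chi_Gr_image(1) in auto)
  finally show ?case .
qed

text \<open>By \<open>perm_rank_interval\<close> the rank counts dots in rows before
  \<open>r\<close> with columns from \<open>r\<close> on, and their shifted columns are the entries
  of the juggling state.\<close>

lemma card_jugg_seq:
  assumes f: "f \<in> Bound k n" and j: "0 \<le> j" "j \<le> int n"
  shows "int (card (jugg_seq n f r \<inter> {1..j})) = perm_rank f (int r) (int r + j - 1)"
proof -
  interpret bounded_perm n f by (rule Bound_bounded_perm[OF f n])
  let ?X = "{x. x < int r \<and> int r \<le> f x \<and> f x \<le> int r + j - 1}"
  have "jugg_seq n f r \<inter> {1..j} = (\<lambda>x. f x - (int r - 1)) ` ?X"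
    using j by (auto simp: jugg_seq_def)
  moreover have "inj_on (\<lambda>x. f x - (int r - 1)) ?X"
    by (rule inj_onI) (simp add: inj_eq[OF bij_is_inj[OF bij]])
  ultimately have "card (jugg_seq n f r \<inter> {1..j}) = card ?X" by (simp add: card_image)
  then show ?thesis using perm_rank_interval[of "int r" "int r + j - 1"] j by simp
qed

lemma jugg_seq_in_Jugg:
  assumes f: "f \<in> Bound k n"
  shows "jugg_seq n f \<in> Jugg k n"
proof -
  interpret bounded_perm n f by (rule Bound_bounded_perm[OF f n])
  have sub: "jugg_seq n f r \<subseteq> {1..int n}" for r by (auto simp: jugg_seq_def)
  then have "jugg_seq n f r \<inter> {1..int n} = jugg_seq n f r" for r by blast
  then have card: "card (jugg_seq n f r) = k" for r
    using card_jugg_seq[OF f, of "int n" r] Bound_perm_rank_long[OF f n, of "int r" "int r + int n - 1"] by simp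
  have "j - 1 \<in> jugg_seq n f (if r = n then 1 else r + 1)" if "j \<in> jugg_seq n f r" "j \<noteq> 1" for r j
  proof -
    obtain i where i: "j = f i - (int r - 1)" "i \<le> int r - 1" "j \<in> {1..int n}"
      using \<open>j \<in> jugg_seq n f r\<close> by (auto simp: jugg_seq_def)
    show ?thesis
    proof (cases "r = n")
      \<comment> \<open>After \<open>r = n\<close> the sequence returns to index 1, so the preimage
        is moved back by one period.\<close>
      case True
      then show ?thesis
        using i \<open>j \<noteq> 1\<close> periodic[of "i - int n"]
        by (auto simp: jugg_seq_def intro!: exI[of _ "i - int n"])
    next
      case False
      then show ?thesis using i \<open>j \<noteq> 1\<close> by (auto simp: jugg_seq_def intro!: exI[of _ i])
    qed
  qed
  then have "(\<lambda>j. j - 1) ` (jugg_seq n f r - {1}) \<subseteq> jugg_seq n f (if r = n then 1 else r + 1)" for r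
    by blast
  then show ?thesis unfolding Jugg_def using sub card by blast
qed

lemma interval_rank_periodic_mult:
  assumes "V \<in> Gr k n"
  shows "interval_rank n V (i + m * int n) (j + m * int n) = interval_rank n V i j"
proof (induction m rule: int_induct[of _ 0])
  case (step1 m)
  then show ?case
    using interval_rank_periodic[OF n assms, of "i + m * int n" "j + m * int n"] by (simp add: algebra_simps)
next
  case (step2 m)
  then show ?case
    using interval_rank_periodic[OF n assms, of "i + (m - 1) * int n" "j + (m - 1) * int n"]
    by (simp add: algebra_simps)
qed simp

text \<open>The \<open>r\<close>-th Schubert variety bounds the ranks of intervals of length at most
  \<open>n\<close> starting at \<open>r\<close>. Periodicity moves every interval to such a start,
  and on empty or longer intervals the two ranks agree.\<close>

lemma schubert_intersection:
  assumes f: "f \<in> Bound k n"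
  shows "(\<Inter>r\<in>{1..n}. (chi_Gr n ^^ (r - 1)) ` schubert k n (jugg_seq n f r))
    = {V \<in> Gr k n. \<forall>i j. interval_rank n V i j \<le> perm_rank f i j}"
proof -
  interpret bounded_perm n f by (rule Bound_bounded_perm[OF f n])
  have bound: "proj_rank V (cyc n ` {int (r - 1) + 1..int (r - 1) + j}) \<le> card (jugg_seq n f r \<inter> {1..j}) \<longleftrightarrow>
    interval_rank n V (int r) (int r + j - 1) \<le> perm_rank f (int r) (int r + j - 1)"
    if V: "V \<in> Gr k n" and r: "r \<in> {1..n}" and j: "j \<in> {1..int n}" for V r j
  proof -
    have "int (r - 1) + 1 = int r" "int (r - 1) + j = int r + j - 1" using r by auto
    moreover have "int (card (jugg_seq n f r \<inter> {1..j})) = perm_rank f (int r) (int r + j - 1)"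
      using card_jugg_seq[OF f, of j r] j by simp
    moreover have "interval_rank n V (int r) (int r + j - 1) = int (proj_rank V (cyc n ` {int r..int r + j - 1}))"
      using interval_rank_eq[OF n V, of "int r" "int r + j - 1"] j by simp
    ultimately show ?thesis by (metis of_nat_le_iff)
  qed
  have all: "(\<forall>i j. interval_rank n V i j \<le> perm_rank f i j) \<longleftrightarrow>
    (\<forall>r\<in>{1..n}. \<forall>j\<in>{1..int n}. interval_rank n V (int r) (int r + j - 1) \<le> perm_rank f (int r) (int r + j - 1))"
    if V: "V \<in> Gr k n" for V
  proof (intro iffI allI ballI)
    fix i j
    assume *: "\<forall>r\<in>{1..n}. \<forall>j\<in>{1..int n}. interval_rank n V (int r) (int r + j - 1) \<le> perm_rank f (int r) (int r + j - 1)"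
    obtain m where m: "cyc n i = i + m * int n" using cyc_eq_add by blast
    define r where "r = nat (cyc n i)"
    define l where "l = j + m * int n - cyc n i + 1"
    have r: "int r = i + m * int n" "r \<in> {1..n}" using cyc_in[OF n, of i] by (auto simp: r_def m)
    have j: "j + m * int n = int r + l - 1" by (simp add: l_def r(1) m)
    have "interval_rank n V (int r) (int r + l - 1) \<le> perm_rank f (int r) (int r + l - 1)"
    proof -
      consider "l < 1" | "l \<in> {1..int n}" | "int n < l" by fastforce
      then show ?thesis
      proof cases
        case 1
        then show ?thesis by (cases "l = 0") (simp_all add: perm_rank_empty interval_rank_def)
      next
        case 2
        then show ?thesis using * r(2) by blast
      next
        case 3
        then show ?thesis
          using interval_rank_long[OF n V, of "int r" "int r + l - 1"]
            Bound_perm_rank_long[OF f n, of "int r" "int r + l - 1"] by simp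
      qed
    qed
    then show "interval_rank n V i j \<le> perm_rank f i j"
      using interval_rank_periodic_mult[OF V, of i m j] perm_rank_periodic_mult[of i m j] r(1) j by simp
  qed blast
  \<comment> \<open>A nonempty index set makes membership in \<open>Gr k n\<close> part of the
    intersection.\<close>
  have "1 \<in> {1..n}" using n by simp
  then have "V \<in> (\<Inter>r\<in>{1..n}. (chi_Gr n ^^ (r - 1)) ` schubert k n (jugg_seq n f r)) \<longleftrightarrow>
    V \<in> Gr k n \<and> (\<forall>r\<in>{1..n}. \<forall>j\<in>{1..int n}.
      proj_rank V (cyc n ` {int (r - 1) + 1..int (r - 1) + j}) \<le> card (jugg_seq n f r \<inter> {1..j}))" for V
    unfolding chi_Gr_schubert by blast
  then have "V \<in> (\<Inter>r\<in>{1..n}. (chi_Gr n ^^ (r - 1)) ` schubert k n (jugg_seq n f r)) \<longleftrightarrow>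
    V \<in> Gr k n \<and> (\<forall>i j. interval_rank n V i j \<le> perm_rank f i j)" for V
    using bound[of V] all[of V] by (cases "V \<in> Gr k n") simp_all
  then show ?thesis by blast
qed

text \<open>Every \<open>V\<close> lies in the stratum of the permutation recording its ranks, and
  comparing ranks is the Bruhat order.\<close>

lemma rank_variety_strata:
  assumes f: "f \<in> Bound k n"
  shows "(\<Union>f'\<in>{f'\<in>Bound k n. affine_le n (int k) f f'}. open_positroid k n f')
    = {V \<in> Gr k n. \<forall>i j. interval_rank n V i j \<le> perm_rank f i j}"
proof (intro equalityI subsetI)
  fix V assume "V \<in> (\<Union>f'\<in>{f'\<in>Bound k n. affine_le n (int k) f f'}. open_positroid k n f')"
  then obtain g where g: "g \<in> Bound k n" "affine_le n (int k) f g" and Vg: "V \<in> open_positroid k n g" by blast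
  then have V: "V \<in> Gr k n" by (simp add: open_positroid_def)
  show "V \<in> {V \<in> Gr k n. \<forall>i j. interval_rank n V i j \<le> perm_rank f i j}"
    using affine_le_iff_perm_rank[OF n f g(1)] g(2) open_positroid_iff[OF n V g(1)] V Vg by simp
next
  fix V assume V: "V \<in> {V \<in> Gr k n. \<forall>i j. interval_rank n V i j \<le> perm_rank f i j}"
  then obtain g where g: "g \<in> Bound k n" "\<forall>i j. perm_rank g i j = interval_rank n V i j"
    using ex_Bound_interval_rank[OF n] by blast
  then have "V \<in> open_positroid k n g" "affine_le n (int k) f g"
    using V open_positroid_iff[OF n _ g(1)] affine_le_iff_perm_rank[OF n f g(1)] by auto
  then show "V \<in> (\<Union>f'\<in>{f'\<in>Bound k n. affine_le n (int k) f f'}. open_positroid k n f')"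
    using g(1) by blast
qed

lemma rank_variety_closed:
  assumes f: "f \<in> Bound k n"
  shows "zariski_closed k n {V \<in> Gr k n. \<forall>i j. interval_rank n V i j \<le> perm_rank f i j}"
proof -
  interpret bounded_perm n f by (rule Bound_bounded_perm[OF f n])
  \<comment> \<open>Only nonempty intervals impose conditions, and there \<open>perm_rank\<close> is
    nonnegative by \<open>perm_rank_interval\<close>, so \<open>nat\<close> loses nothing.\<close>
  let ?C = "{(cyc n ` {i..j}, nat (perm_rank f i j)) | i j. i \<le> j}"
  have "(\<forall>i j. interval_rank n V i j \<le> perm_rank f i j) \<longleftrightarrow> (\<forall>(S, m)\<in>?C. proj_rank V S \<le> m)"
    if V: "V \<in> Gr k n" for V
  proof -
    have "interval_rank n V i j \<le> perm_rank f i j \<longleftrightarrow> (i \<le> j \<longrightarrow> proj_rank V (cyc n ` {i..j}) \<le> nat (perm_rank f i j))"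
      for i j
    proof (cases "i \<le> j")
      case True
      then show ?thesis using interval_rank_eq[OF n V, of i j] perm_rank_interval[of i j] by simp
    next
      case False
      then show ?thesis by (simp add: interval_rank_def perm_rank_empty)
    qed
    then show ?thesis by blast
  qed
  then have "{V \<in> Gr k n. \<forall>i j. interval_rank n V i j \<le> perm_rank f i j}
    = {V \<in> Gr k n. \<forall>(S, m)\<in>?C. proj_rank V S \<le> m}" by blast
  moreover have "zariski_closed k n {V \<in> Gr k n. \<forall>(S, m)\<in>?C. proj_rank V S \<le> m}"
    by (rule zariski_closed_proj_rank) (use cyc_in[OF n] in auto)
  ultimately show ?thesis by simp
qed

text \<open>One inclusion is closedness of the rank variety. For the other, a closed set containing
  the stratum of \<open>f\<close> acquires all higher strata, one inversion at a time, by
  \<open>descent_induct\<close>.\<close>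

lemma positroid_eq_rank_variety:
  assumes f: "f \<in> Bound k n"
  shows "positroid k n f = {V \<in> Gr k n. \<forall>i j. interval_rank n V i j \<le> perm_rank f i j}"
    (is "_ = ?X")
proof
  have "open_positroid k n f \<subseteq> ?X"
  proof
    fix V assume Vf: "V \<in> open_positroid k n f"
    then have V: "V \<in> Gr k n" by (simp add: open_positroid_def)
    then show "V \<in> ?X" using open_positroid_iff[OF n V f] Vf by simp
  qed
  then show "positroid k n f \<subseteq> ?X"
    unfolding positroid_def zariski_closure_def using rank_variety_closed[OF f] by blast
  show "?X \<subseteq> positroid k n f"
    unfolding positroid_def zariski_closure_def rank_variety_strata[OF f, symmetric]
  proof (intro Inter_greatest UN_least)
    fix Z g
    assume "Z \<in> {Z. zariski_closed k n Z \<and> open_positroid k n f \<subseteq> Z}"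
      and "g \<in> {g \<in> Bound k n. affine_le n (int k) f g}"
    then have Z: "zariski_closed k n Z" "open_positroid k n f \<subseteq> Z" and g: "g \<in> Bound k n"
      and le: "\<And>i j. perm_rank g i j \<le> perm_rank f i j"
      using affine_le_iff_perm_rank[OF n f] by blast+
    from n f g le show "open_positroid k n g \<subseteq> Z"
    proof (induction rule: descent_induct)
      case refl
      then show ?case using Z(2) .
    next
      case (step g a b)
      then show ?case using closed_contains_higher_stratum[OF n _ _ _ Z(1)] by blast
    qed
  qed
qed

end

theorem theorem5p10:
  fixes k n :: nat
  assumes "0 < n" and "k \<le> n"
  shows "Gr k n = (\<Union>f\<in>Bound k n. open_positroid k n f) \<and>
    disjoint_family_on (open_positroid k n) (Bound k n) \<and>
    (\<forall>f\<in>Bound k n.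
       jugg_seq n f \<in> Jugg k n \<and>
       positroid k n f =
         (\<Union>f'\<in>{f'\<in>Bound k n. affine_le n (int k) f f'}. open_positroid k n f') \<and>
       positroid k n f =
         (\<Inter>r\<in>{1..n}. (chi_Gr n ^^ (r - 1)) ` schubert k n (jugg_seq n f r)))"
proof (intro conjI ballI)
  note n = \<open>0 < n\<close>
  show "Gr k n = (\<Union>f\<in>Bound k n. open_positroid k n f)"
  proof (intro equalityI subsetI)
    fix V assume V: "V \<in> Gr k n"
    then obtain f where "f \<in> Bound k n" "\<forall>i j. perm_rank f i j = interval_rank n V i j"
      using ex_Bound_interval_rank[OF n] by blast
    then have "V \<in> open_positroid k n f" "f \<in> Bound k n" using open_positroid_iff[OF n V] by simp_all
    then show "V \<in> (\<Union>f\<in>Bound k n. open_positroid k n f)" by blast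
  qed (auto simp: open_positroid_def)
  have "f = g" if "f \<in> Bound k n" "g \<in> Bound k n" "V \<in> open_positroid k n f" "V \<in> open_positroid k n g" for f g V
  proof -
    have V: "V \<in> Gr k n" using that(3) by (simp add: open_positroid_def)
    show ?thesis
      using Bound_eq_if_perm_rank_eq[OF that(1,2) n] open_positroid_iff[OF n V that(1)]
        open_positroid_iff[OF n V that(2)] that(3,4) by metis
  qed
  then show "disjoint_family_on (open_positroid k n) (Bound k n)"
    unfolding disjoint_family_on_def by blast
  fix f assume f: "f \<in> Bound k n"
  show "jugg_seq n f \<in> Jugg k n" by (rule jugg_seq_in_Jugg[OF n f])
  show "positroid k n f = (\<Union>f'\<in>{f'\<in>Bound k n. affine_le n (int k) f f'}. open_positroid k n f')"
    using positroid_eq_rank_variety[OF n f] rank_variety_strata[OF n f] by simp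
  show "positroid k n f = (\<Inter>r\<in>{1..n}. (chi_Gr n ^^ (r - 1)) ` schubert k n (jugg_seq n f r))"
    using positroid_eq_rank_variety[OF n f] schubert_intersection[OF n f] by simp
qed

end
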